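(* Let $S^{\alpha\beta}$ be a smooth real symmetric tensor field on Minkowski space that is contraction-free ($\eta_{\alpha\beta}S^{\alpha\beta}=0$), let $\zeta$ be a real constant, and let $\theta_\alpha=N_\alpha:=\eta_{\alpha\beta}S^{\beta\epsilon}(\cos\zeta+i\sin\zeta\,\mathcal J)\Theta_\epsilon$. Then $$\begin{aligned}L_V=\;&64\cos^22\zeta\,\bigl[S^{\alpha\beta}S_{\beta\rho}S^{\rho\sigma}S_{\sigma\alpha}-(S^{\alpha\beta}S_{\alpha\beta})^2\bigr]\\&-32\cos2\zeta\,\bigl[(\partial_\alpha S^{\beta\rho})(\partial^\alpha S_{\beta\rho})-(\partial^\alpha S^{\beta\rho})(\partial_\beta S_{\alpha\rho})\bigr].\end{aligned}$$ If $\tau\ne0$ is a real constant and $\cos2\zeta\neq0$, then the field equation obtained by varying $L=L_K-\tau L_V$ with respect to $S^{\alpha\beta}$, subject to the constraint $\eta_{\rho\sigma}S^{\rho\sigma}=0$, is $$\begin{aligned}&\partial_\mu\partial^\mu S_{\alpha\beta}-\tfrac12\partial_\alpha\partial^\mu S_{\mu\beta}-\tfrac12\partial_\beta\partial^\mu S_{\mu\alpha}+\tfrac14\eta_{\alpha\beta}\partial_\mu\partial_\nu S^{\mu\nu}\\&\quad+4\cos2\zeta\,\bigl[S_{\alpha\mu}S^{\mu\nu}S_{\nu\beta}-(S^{\mu\nu}S_{\mu\nu})S_{\alpha\beta}-\tfrac14\eta_{\alpha\beta}S_\mu^\nu S_\nu^\sigma S_\sigma^\mu\bigr]\\&=\frac{1}{128\,\tau\cos2\zeta}\,\psi^\dagger\hat\eta(\cos\zeta+i\sin\zeta\,\mathcal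 J)\bigl(\gamma_\alpha\Theta_\beta+\gamma_\beta\Theta_\alpha-\tfrac12\eta_{\alpha\beta}\gamma^\mu\Theta_\mu\bigr)\psi .\end{aligned}$$
   Context: Minkowski space is $\mathbb R^4$ with coordinates $x^\alpha$ and constant metric $\eta=\mathrm{diag}(1,-1,-1,-1)$; indices are raised and lowered with $\eta$, and repeated indices are summed. The complex exterior algebra $\bigwedge_*$ of $\mathbb R^4$ has basis $\mathbf e_I=\mathbf e_{\alpha_1}\wedge\cdots\wedge\mathbf e_{\alpha_k}$, $\alpha_1<\dots<\alpha_k$, $|I|=k$ ($\mathbf e_\emptyset=1$); $16\times16$ matrices are operators on it in this basis and $\dagger$ is conjugate transpose. Gamma matrices: $\gamma_\alpha\psi=\mathbf e_\alpha\wedge\psi-\iota_\alpha\psi$, where $\iota_\alpha$ is the linear operator with $\iota_\alpha\mathbf e_\emptyset=0$, $\iota_\alpha\mathbf e_\beta=\eta_{\alpha\beta}\mathbf e_\emptyset$, $\iota_\alpha(\mathbf e_I\wedge\mathbf e_J)=(\iota_\alpha\mathbf e_I)\wedge\mathbf e_J+(-1)^{|I|}\mathbf e_I\wedge\iota_\alpha\mathbf e_J$. Extended metric: $\hat\eta_{IJ}=0$ if $|I|\ne|J|$, and $\hat\eta_{IJ}=\det(\eta_{\alpha_i\beta_j})$ if $I=\alpha_1\cdots\alpha_k$, $J=\beta_1\cdots\beta_k$. $\Theta_I$ is the $16\times16$ matrix that commutes with all gamma matrices and satisfies $\Theta_I\mathbf e_\emptyset=\mathbf e_I$; $\mathcal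 J=\Theta_{0123}$ (scalars stand for multiples of the identity). Given four matrix-valued fields $\theta_\alpha$, put $\Omega_{\alpha\beta}=\partial_\alpha\theta_\beta-\partial_\beta\theta_\alpha+\theta_\alpha\theta_\beta-\theta_\beta\theta_\alpha$ and $$L_V=\tfrac12\,\mathrm{tr}(\Omega_{\alpha\beta}\Omega^{\alpha\beta})+c.c.$$ For a smooth field $\psi:\mathbb R^4\to\bigwedge_*\cong\mathbb C^{16}$ and a real constant $m$, put $D\psi=\gamma^\alpha(\partial_\alpha\psi+\theta_\alpha\psi)$ and $$L_K=\tfrac12\psi^\dagger\hat\eta D\psi+c.c.-m\,\psi^\dagger\hat\eta\psi ,$$ where $c.c.$ is the complex conjugate of the preceding term. The (constrained) field equation means: stationarity of $\int L\,d^4x$ under compactly supported variations of $S^{\alpha\beta}$ through symmetric contraction-free tensor fields, with $\psi$ fixed. *)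

theory Defs
  imports "HOL-Analysis.Analysis"
begin

section \<open>Minkowski space\<close>

text \<open>Space-time indices are the elements 0, 1, 2, 3 of the numeral type 4 (with 0 the time
  index), ordered as numbers. The matrix of the metric is its own inverse, so
  \<open>eta\<close> serves for lowering and for raising indices.\<close>

type_synonym spacetime = "real ^ 4"

definition eta :: "4 \<Rightarrow> 4 \<Rightarrow> real" where
  "eta \<alpha> \<beta> = (if \<alpha> \<noteq> \<beta> then 0 else if \<alpha> = 0 then 1 else - 1)"

definition partial :: "4 \<Rightarrow> (spacetime \<Rightarrow> 'a::real_normed_vector) \<Rightarrow> spacetime \<Rightarrow> 'a" where
  "partial \<alpha> f x = vector_derivative (\<lambda>t. f (x + t *\<^sub>R axis \<alpha> 1)) (at 0)"

definition partial_up :: "4 \<Rightarrow> (spacetime \<Rightarrow> 'a::real_normed_vector) \<Rightarrow> spacetime \<Rightarrow> 'a" where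
  "partial_up \<alpha> f x = (\<Sum>\<beta>\<in>UNIV. eta \<alpha> \<beta> *\<^sub>R partial \<beta> f x)"

text \<open>Smooth means infinitely differentiable: every iterated partial derivative is
  (totally) differentiable, in particular continuous.\<close>

definition smooth :: "(spacetime \<Rightarrow> 'a::real_normed_vector) \<Rightarrow> bool" where
  "smooth f \<longleftrightarrow> (\<forall>\<alpha>s. foldr partial \<alpha>s f differentiable_on UNIV)"


section \<open>The exterior algebra\<close>

text \<open>A multi-index \<open>\<alpha>\<^sub>1 < \<dots> < \<alpha>\<^sub>k\<close> is the set of its entries, so that the
  complex exterior algebra has the coordinate space indexed by the 16 subsets of the index type.\<close>

type_synonym ext = "complex ^ (4 set)"
type_synonym ext_op = "complex ^ (4 set) ^ (4 set)"

abbreviation eb :: "4 set \<Rightarrow> ext" where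
  "eb I \<equiv> axis I 1"

definition shuffle_sign :: "4 set \<Rightarrow> 4 set \<Rightarrow> complex" where
  "shuffle_sign I J = (- 1) ^ card {(i, j). i \<in> I \<and> j \<in> J \<and> j < i}"

definition wedge :: "ext \<Rightarrow> ext \<Rightarrow> ext"  (infixr \<open>\<^bold>\<and>\<close> 70) where
  "u \<^bold>\<and> v = (\<chi> K. \<Sum>I\<in>Pow K. shuffle_sign I (K - I) * u $ I * v $ (K - I))"

definition is_iota :: "4 \<Rightarrow> ext_op \<Rightarrow> bool" where
  "is_iota \<alpha> A \<longleftrightarrow>
     A *v eb {} = 0 \<and>
     (\<forall>\<beta>. A *v eb {\<beta>} = complex_of_real (eta \<alpha> \<beta>) *s eb {}) \<and>
     (\<forall>I J. A *v (eb I \<^bold>\<and> eb J) = (A *v eb I) \<^bold>\<and> eb J + (- 1) ^ card I *s (eb I \<^bold>\<and> (A *v eb J)))"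

definition iota :: "4 \<Rightarrow> ext_op" where
  "iota \<alpha> = (THE A. is_iota \<alpha> A)"

text \<open>There is exactly one such operator.\<close>

lemma op_eb_nth: "((A :: ext_op) *v eb k) $ i = A $ i $ k"
  by (simp add: matrix_vector_mult_def axis_def if_distrib cong: if_cong)

lemma ext_op_eqI:
  fixes A B :: ext_op
  assumes "\<And>I. A *v eb I = B *v eb I"
  shows "A = B"
proof -
  have "A $ i $ j = B $ i $ j" for i j
  proof -
    have "(A *v eb j) $ i = (B *v eb j) $ i" using assms by simp
    then show ?thesis by (simp add: op_eb_nth)
  qed
  then show ?thesis by (simp add: vec_eq_iff)
qed

lemma shuffle_sign_nz: "shuffle_sign I J \<noteq> 0"
  by (simp add: shuffle_sign_def)

lemma wedge_eb:
  "eb I \<^bold>\<and> eb J = (if I \<inter> J = {} then shuffle_sign I J *s eb (I \<union> J) else 0)"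
proof -
  have "(eb I \<^bold>\<and> eb J) $ K = (if I \<inter> J = {} then shuffle_sign I J *s eb (I \<union> J) else 0) $ K" for K
  proof -
    have "(eb I \<^bold>\<and> eb J) $ K =
        (\<Sum>I'\<in>Pow K. if I' = I then (if K - I = J then shuffle_sign I J else 0) else 0)"
      unfolding wedge_def vec_lambda_beta by (rule sum.cong) (auto simp: axis_def)
    also have "\<dots> = (if I \<subseteq> K \<and> K - I = J then shuffle_sign I J else 0)"
      by (subst sum.delta) auto
    also have "(I \<subseteq> K \<and> K - I = J) \<longleftrightarrow> (I \<inter> J = {} \<and> K = I \<union> J)" by blast
    finally show ?thesis by (auto simp: axis_def)
  qed
  then show ?thesis by (simp add: vec_eq_iff)
qed

lemma wedge_add_right: "u \<^bold>\<and> (v + w) = u \<^bold>\<and> v + u \<^bold>\<and> w"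
  by (simp add: wedge_def vec_eq_iff algebra_simps sum.distrib)

lemma wedge_scale_right: "u \<^bold>\<and> (c *s v) = c *s (u \<^bold>\<and> v)"
  by (simp add: wedge_def vec_eq_iff algebra_simps sum_distrib_left)

lemma wedge_scale_left: "(c *s u) \<^bold>\<and> v = c *s (u \<^bold>\<and> v)"
  by (simp add: wedge_def vec_eq_iff algebra_simps sum_distrib_left)

lemma wedge_zero [simp]: "u \<^bold>\<and> 0 = 0" "0 \<^bold>\<and> u = 0"
  by (simp_all add: wedge_def vec_eq_iff)

definition below :: "4 \<Rightarrow> 4 set \<Rightarrow> nat" where
  "below \<alpha> J = card {j \<in> J. j < \<alpha>}"

lemma shuffle_sign_left:
  assumes "\<alpha> \<in> I"
  shows "shuffle_sign I J = shuffle_sign (I - {\<alpha>}) J * (- 1) ^ below \<alpha> J"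
proof -
  have "{(i, j). i \<in> I \<and> j \<in> J \<and> j < i} =
      {(i, j). i \<in> I - {\<alpha>} \<and> j \<in> J \<and> j < i} \<union> Pair \<alpha> ` {j \<in> J. j < \<alpha>}"
    using assms by auto
  moreover have "card \<dots> = card {(i, j). i \<in> I - {\<alpha>} \<and> j \<in> J \<and> j < i} + below \<alpha> J"
    by (subst card_Un_disjoint) (auto simp: card_image inj_on_def below_def)
  ultimately show ?thesis by (simp add: shuffle_sign_def power_add)
qed

lemma shuffle_sign_right:
  assumes "\<alpha> \<in> J"
  shows "shuffle_sign I J = shuffle_sign I (J - {\<alpha>}) * (- 1) ^ card {i \<in> I. \<alpha> < i}"
proof -
  have "{(i, j). i \<in> I \<and> j \<in> J \<and> j < i} =
      {(i, j). i \<in> I \<and> j \<in> J - {\<alpha>} \<and> j < i} \<union> (\<lambda>i. (i, \<alpha>)) ` {i \<in> I. \<alpha> < i}"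
    using assms by auto
  moreover have "card \<dots> = card {(i, j). i \<in> I \<and> j \<in> J - {\<alpha>} \<and> j < i} + card {i \<in> I. \<alpha> < i}"
    by (subst card_Un_disjoint) (auto simp: card_image inj_on_def below_def)
  ultimately show ?thesis by (simp add: shuffle_sign_def power_add)
qed

lemma shuffle_sign_single: "shuffle_sign {\<alpha>} J = (- 1) ^ below \<alpha> J"
  by (subst shuffle_sign_left[of \<alpha>]) (simp_all add: shuffle_sign_def)

lemma below_insert: "\<beta> \<notin> J \<Longrightarrow> below \<alpha> (insert \<beta> J) = below \<alpha> J + (if \<beta> < \<alpha> then 1 else 0)"
proof -
  assume "\<beta> \<notin> J"
  moreover have "{j \<in> insert \<beta> J. j < \<alpha>} = (if \<beta> < \<alpha> then insert \<beta> {j \<in> J. j < \<alpha>} else {j \<in> J. j < \<alpha>})"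
    by auto
  ultimately show ?thesis by (simp add: below_def)
qed

lemma below_Un: "I \<inter> J = {} \<Longrightarrow> below \<alpha> (I \<union> J) = below \<alpha> I + below \<alpha> J"
proof -
  assume "I \<inter> J = {}"
  moreover have "{j \<in> I \<union> J. j < \<alpha>} = {j \<in> I. j < \<alpha>} \<union> {j \<in> J. j < \<alpha>}" by auto
  ultimately show ?thesis by (simp add: below_def card_Un_disjoint disjoint_iff)
qed

lemma below_Diff [simp]: "below \<alpha> (J - {\<alpha>}) = below \<alpha> J"
  unfolding below_def by (rule arg_cong[where f = card]) auto

lemma below_single [simp]: "below \<alpha> {\<alpha>} = 0"
  by (auto simp: below_def)

lemma card_split: "card (I :: 4 set) = below \<alpha> I + card {i \<in> I. \<alpha> < i} + (if \<alpha> \<in> I then 1 else 0)"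
proof -
  have "I = ({i \<in> I. i < \<alpha>} \<union> {i \<in> I. \<alpha> < i}) \<union> (if \<alpha> \<in> I then {\<alpha>} else {})"
    using linorder_less_linear[of \<alpha>] by auto
  then have "card I = card (({i \<in> I. i < \<alpha>} \<union> {i \<in> I. \<alpha> < i}) \<union> (if \<alpha> \<in> I then {\<alpha>} else {}))"
    by (rule arg_cong)
  also have "\<dots> = card ({i \<in> I. i < \<alpha>} \<union> {i \<in> I. \<alpha> < i}) + (if \<alpha> \<in> I then 1 else 0)"
    by (subst card_Un_disjoint) auto
  also have "card ({i \<in> I. i < \<alpha>} \<union> {i \<in> I. \<alpha> < i}) = below \<alpha> I + card {i \<in> I. \<alpha> < i}"
    by (subst card_Un_disjoint) (auto simp: below_def)
  finally show ?thesis .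
qed

definition iota_explicit :: "4 \<Rightarrow> ext_op" where
  "iota_explicit \<alpha> = (\<chi> I J. if \<alpha> \<in> J \<and> I = J - {\<alpha>}
     then complex_of_real (eta \<alpha> \<alpha>) * (- 1) ^ below \<alpha> J else 0)"

lemma iota_explicit_eb:
  "iota_explicit \<alpha> *v eb J =
     (if \<alpha> \<in> J then (complex_of_real (eta \<alpha> \<alpha>) * (- 1) ^ below \<alpha> J) *s eb (J - {\<alpha>}) else 0)"
  unfolding vec_eq_iff op_eb_nth by (simp add: iota_explicit_def axis_def)

lemma is_iota_explicit: "is_iota \<alpha> (iota_explicit \<alpha>)"
  unfolding is_iota_def
proof (intro conjI allI)
  show "iota_explicit \<alpha> *v eb {} = 0" by (simp add: iota_explicit_eb)
  show "iota_explicit \<alpha> *v eb {\<beta>} = complex_of_real (eta \<alpha> \<beta>) *s eb {}" for \<beta>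
    by (auto simp: iota_explicit_eb eta_def cong: conj_cong)
  fix I J
  define h where "h = complex_of_real (eta \<alpha> \<alpha>)"
  have hI: "iota_explicit \<alpha> *v eb J = (if \<alpha> \<in> J then (h * (- 1) ^ below \<alpha> J) *s eb (J - {\<alpha>}) else 0)"
    for J by (simp add: iota_explicit_eb h_def)
  have sq: "(- 1 :: complex) ^ n * (- 1) ^ n = 1" for n :: nat
    by (simp flip: power_add)
  have sq2: "(- 1 :: complex) ^ n * ((- 1) ^ n * z) = z" for n :: nat and z
    using sq[of n] by (simp flip: mult.assoc)
  let ?s = shuffle_sign
  have cI: "(- 1 :: complex) ^ card I =
      (- 1) ^ below \<alpha> I * (- 1) ^ card {i \<in> I. \<alpha> < i} * (if \<alpha> \<in> I then - 1 else 1)"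
    by (subst card_split[of I \<alpha>]) (simp add: power_add)
  show "iota_explicit \<alpha> *v (eb I \<^bold>\<and> eb J) =
      (iota_explicit \<alpha> *v eb I) \<^bold>\<and> eb J + (- 1) ^ card I *s (eb I \<^bold>\<and> (iota_explicit \<alpha> *v eb J))"
  proof (cases "I \<inter> J = {}")
    case disj: True
    consider "\<alpha> \<in> I" "\<alpha> \<notin> J" | "\<alpha> \<notin> I" "\<alpha> \<in> J" | "\<alpha> \<notin> I" "\<alpha> \<notin> J"
      using disj by blast
    then show ?thesis
    proof cases
      case 1
      have "(I - {\<alpha>}) \<inter> J = {}" "I \<union> J - {\<alpha>} = I - {\<alpha>} \<union> J" using disj 1 by auto
      then show ?thesis using 1 disj
        by (simp add: hI wedge_eb wedge_scale_left wedge_scale_right matrix_vector_mult_scaleR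
            vector_scalar_commute below_Un shuffle_sign_left[of \<alpha> I J] power_add sq2 ac_simps)
    next
      case 2
      have "I \<inter> (J - {\<alpha>}) = {}" "I \<union> J - {\<alpha>} = I \<union> (J - {\<alpha>})" using disj 2 by auto
      then show ?thesis using 2 disj
        by (simp add: hI wedge_eb wedge_scale_left wedge_scale_right
            vector_scalar_commute below_Un shuffle_sign_right[of \<alpha> J I] power_add cI sq2 ac_simps)
    next
      case 3
      then show ?thesis using disj by (simp add: hI wedge_eb vector_scalar_commute)
    qed
  next
    case nd: False
    show ?thesis
    proof (cases "I \<inter> J = {\<alpha>}")
      case True
      then have a: "\<alpha> \<in> I" "\<alpha> \<in> J" "(I - {\<alpha>}) \<inter> J = {}" "I \<inter> (J - {\<alpha>}) = {}"
        "I - {\<alpha>} \<union> J = I \<union> J" "I \<union> (J - {\<alpha>}) = I \<union> J" by auto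
      have "?s (I - {\<alpha>}) J = ?s (I - {\<alpha>}) (J - {\<alpha>}) * (- 1) ^ card {i \<in> I. \<alpha> < i}"
      proof -
        have "{i \<in> I - {\<alpha>}. \<alpha> < i} = {i \<in> I. \<alpha> < i}" by auto
        then show ?thesis using shuffle_sign_right[of \<alpha> J "I - {\<alpha>}"] a by simp
      qed
      moreover have "?s I (J - {\<alpha>}) = ?s (I - {\<alpha>}) (J - {\<alpha>}) * (- 1) ^ below \<alpha> J"
        using shuffle_sign_left[of \<alpha> I "J - {\<alpha>}"] a by simp
      ultimately show ?thesis using nd a
        by (simp add: hI wedge_eb wedge_scale_left wedge_scale_right cI sq2 ac_simps
            flip: vector_sadd_rdistrib)
    next
      case False
      with nd have "\<alpha> \<in> I \<Longrightarrow> (I - {\<alpha>}) \<inter> J \<noteq> {}" "\<alpha> \<in> J \<Longrightarrow> I \<inter> (J - {\<alpha>}) \<noteq> {}" by auto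
      with nd show ?thesis by (simp add: hI wedge_eb wedge_scale_left wedge_scale_right)
    qed
  qed
qed

lemma eb_insert:
  assumes "a \<notin> A"
  shows "eb (insert a A) = inverse (shuffle_sign {a} A) *s (eb {a} \<^bold>\<and> eb A)"
  using assms by (simp add: wedge_eb shuffle_sign_nz)

lemma is_iota_unique:
  assumes A: "is_iota \<alpha> A" and B: "is_iota \<alpha> B"
  shows "A = B"
proof (rule ext_op_eqI)
  fix I :: "4 set"
  show "A *v eb I = B *v eb I"
  proof (induction I rule: finite_induct[OF finite])
    case 1
    then show ?case using A B by (simp add: is_iota_def)
  next
    case (2 x F)
    have "A *v (eb {x} \<^bold>\<and> eb F) = B *v (eb {x} \<^bold>\<and> eb F)"
      using A B 2 by (simp add: is_iota_def)
    then show ?case using 2 by (simp add: eb_insert[of x F] vector_scalar_commute)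
  qed
qed

theorem ex1_iota: "\<exists>!A. is_iota \<alpha> A"
  using is_iota_explicit is_iota_unique by blast

lemma is_iota_iota: "is_iota \<alpha> (iota \<alpha>)"
  unfolding iota_def by (rule theI'[OF ex1_iota])

lemma iota_eb:
  "iota \<alpha> *v eb J =
     (if \<alpha> \<in> J then (complex_of_real (eta \<alpha> \<alpha>) * (- 1) ^ below \<alpha> J) *s eb (J - {\<alpha>}) else 0)"
  using is_iota_unique[OF is_iota_iota is_iota_explicit] by (simp add: iota_explicit_eb)

definition gamma :: "4 \<Rightarrow> ext_op" where
  "gamma \<alpha> = matrix (\<lambda>\<psi>. eb {\<alpha>} \<^bold>\<and> \<psi> - iota \<alpha> *v \<psi>)"

definition gamma_up :: "4 \<Rightarrow> ext_op" where
  "gamma_up \<alpha> = (\<Sum>\<beta>\<in>UNIV. eta \<alpha> \<beta> *\<^sub>R gamma \<beta>)"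

text \<open>The entries of the extended metric are minors of the metric, of varying size; the
  determinant is written out as its Leibniz expansion.\<close>

definition hat_eta :: ext_op where
  "hat_eta = (\<chi> I J. if card I \<noteq> card J then 0
     else complex_of_real (\<Sum>p | p permutes {..<card I}. of_int (sign p) *
            (\<Prod>i<card I. eta (sorted_list_of_set I ! i) (sorted_list_of_set J ! p i))))"

definition is_Theta :: "4 set \<Rightarrow> ext_op \<Rightarrow> bool" where
  "is_Theta I A \<longleftrightarrow> (\<forall>\<alpha>. A ** gamma \<alpha> = gamma \<alpha> ** A) \<and> A *v eb {} = eb I"

definition Theta :: "4 set \<Rightarrow> ext_op" where
  "Theta I = (THE A. is_Theta I A)"

text \<open>Existence and uniqueness of \<open>Theta I\<close>: the generators are
  \<open>Theta {\<alpha>} = (eb {\<alpha>} \<and> \<cdot> + iota \<alpha>) P\<close> with the parity operator \<open>P\<close>.\<close>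

definition wedge_op :: "4 \<Rightarrow> ext_op" where
  "wedge_op \<alpha> = matrix (\<lambda>\<psi>. eb {\<alpha>} \<^bold>\<and> \<psi>)"

definition parity_op :: ext_op where
  "parity_op = (\<chi> I J. if I = J then (- 1) ^ card I else 0)"

lemma wedge_op_eb:
  "wedge_op \<alpha> *v eb J = (if \<alpha> \<in> J then 0 else (- 1) ^ below \<alpha> J *s eb (insert \<alpha> J))"
proof -
  have "wedge_op \<alpha> *v eb J = eb {\<alpha>} \<^bold>\<and> eb J"
    unfolding vec_eq_iff op_eb_nth by (simp add: wedge_op_def matrix_def)
  then show ?thesis by (simp add: wedge_eb shuffle_sign_single)
qed

lemma parity_op_eb: "parity_op *v eb J = (- 1) ^ card J *s eb J"
  unfolding vec_eq_iff op_eb_nth by (simp add: parity_op_def axis_def)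

lemma gamma_eq: "gamma \<alpha> = wedge_op \<alpha> - iota \<alpha>"
  by (simp add: gamma_def wedge_op_def matrix_def vec_eq_iff op_eb_nth)

lemma op_mult_simps:
  fixes A B :: ext_op
  shows "(A ** B) *v v = A *v (B *v v)" "(A + B) *v v = A *v v + B *v v"
    "(A - B) *v v = A *v v - B *v v" "(- A) *v v = - (A *v v)" "A *v (c *s v) = c *s (A *v v)"
  by (simp_all add: matrix_vector_mul_assoc matrix_vector_mult_add_rdistrib
      matrix_vector_mult_diff_rdistrib vector_scalar_commute)
    (simp add: matrix_vector_mult_def vec_eq_iff sum_negf)

lemma wedge_wedge: "wedge_op \<alpha> ** wedge_op \<beta> + wedge_op \<beta> ** wedge_op \<alpha> = 0"
proof (rule ext_op_eqI)
  fix J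
  show "(wedge_op \<alpha> ** wedge_op \<beta> + wedge_op \<beta> ** wedge_op \<alpha>) *v eb J = 0 *v eb J"
  proof (cases "\<alpha> \<notin> J \<and> \<beta> \<notin> J \<and> \<alpha> \<noteq> \<beta>")
    case True
    have "(- 1 :: complex) ^ below \<beta> J * (- 1) ^ below \<alpha> (insert \<beta> J)
        + (- 1) ^ below \<alpha> J * (- 1) ^ below \<beta> (insert \<alpha> J) = 0"
      using True below_insert[of \<alpha> J \<beta>] below_insert[of \<beta> J \<alpha>]
      by (cases \<alpha> \<beta> rule: linorder_cases) (simp_all add: not_less_iff_gr_or_eq)
    then show ?thesis
      using True True[THEN conjunct2, THEN conjunct2, symmetric] unfolding op_mult_simps
      by (simp add: wedge_op_eb op_mult_simps vector_smult_assoc insert_commute[of \<beta> \<alpha>]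
          flip: vector_sadd_rdistrib)
  next
    case False
    then show ?thesis by (auto simp: op_mult_simps wedge_op_eb)
  qed
qed

lemma below_remove: "\<beta> \<in> J \<Longrightarrow> below \<alpha> J = below \<alpha> (J - {\<beta>}) + (if \<beta> < \<alpha> then 1 else 0)"
  using below_insert[of \<beta> "J - {\<beta>}" \<alpha>] by (simp add: insert_absorb)

lemma iota_iota: "iota \<alpha> ** iota \<beta> + iota \<beta> ** iota \<alpha> = 0"
proof (rule ext_op_eqI)
  fix J
  have c: "J - {\<beta>} - {\<alpha>} = J - {\<alpha>} - {\<beta>}" by blast
  show "(iota \<alpha> ** iota \<beta> + iota \<beta> ** iota \<alpha>) *v eb J = 0 *v eb J"
  proof (cases "\<alpha> \<in> J \<and> \<beta> \<in> J \<and> \<alpha> \<noteq> \<beta>")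
    case True
    have "(- 1 :: complex) ^ below \<beta> J * (- 1) ^ below \<alpha> (J - {\<beta>})
        = - ((- 1) ^ below \<alpha> J * (- 1) ^ below \<beta> (J - {\<alpha>}))"
    proof -
      have r: "below \<alpha> J = below \<alpha> (J - {\<beta>}) + (if \<beta> < \<alpha> then 1 else 0)"
        "below \<beta> J = below \<beta> (J - {\<alpha>}) + (if \<alpha> < \<beta> then 1 else 0)"
        using True below_remove by blast+
      consider "\<alpha> < \<beta>" "\<not> \<beta> < \<alpha>" | "\<beta> < \<alpha>" "\<not> \<alpha> < \<beta>"
        using True by (metis linorder_less_linear order_less_asym)
      then show ?thesis unfolding r by cases simp_all
    qed
    then have "complex_of_real (eta \<beta> \<beta>) * complex_of_real (eta \<alpha> \<alpha>) *
          ((- 1) ^ below \<beta> J * (- 1) ^ below \<alpha> (J - {\<beta>})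
           + (- 1) ^ below \<alpha> J * (- 1) ^ below \<beta> (J - {\<alpha>})) = 0"
      by simp
    then have "complex_of_real (eta \<beta> \<beta>) * (- 1) ^ below \<beta> J
          * (complex_of_real (eta \<alpha> \<alpha>) * (- 1) ^ below \<alpha> (J - {\<beta>}))
        + complex_of_real (eta \<alpha> \<alpha>) * (- 1) ^ below \<alpha> J
          * (complex_of_real (eta \<beta> \<beta>) * (- 1) ^ below \<beta> (J - {\<alpha>})) = 0"
      by (simp add: algebra_simps)
    then show ?thesis
      using True True[THEN conjunct2, THEN conjunct2, symmetric] unfolding op_mult_simps
      by (simp add: iota_eb op_mult_simps c vector_smult_assoc flip: vector_sadd_rdistrib)
  next
    case False
    then show ?thesis by (auto simp: op_mult_simps iota_eb)
  qed
qed

lemma iota_wedge: "iota \<alpha> ** wedge_op \<beta> + wedge_op \<beta> ** iota \<alpha> = mat (complex_of_real (eta \<alpha> \<beta>))"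
proof (rule ext_op_eqI)
  fix J
  have w: "wedge_op \<beta> *v v = eb {\<beta>} \<^bold>\<and> v" for v
    unfolding wedge_op_def
    by (rule matrix_works) (simp add: Vector_Spaces.linear_iff wedge_add_right wedge_scale_right
        vec.vector_space_axioms)
  have "iota \<alpha> *v (eb {\<beta>} \<^bold>\<and> eb J) =
      complex_of_real (eta \<alpha> \<beta>) *s eb J - eb {\<beta>} \<^bold>\<and> (iota \<alpha> *v eb J)"
    using is_iota_iota[of \<alpha>] wedge_eb[of "{}" J]
    by (simp add: is_iota_def wedge_scale_left shuffle_sign_def)
  then show "(iota \<alpha> ** wedge_op \<beta> + wedge_op \<beta> ** iota \<alpha>) *v eb J
      = mat (complex_of_real (eta \<alpha> \<beta>)) *v eb J"
    by (simp add: op_mult_simps w)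
      (simp only: vec_eq_iff op_eb_nth, simp add: mat_def axis_def)
qed

lemma parity_ops:
  "parity_op ** wedge_op \<alpha> = - (wedge_op \<alpha> ** parity_op)"
  "parity_op ** iota \<alpha> = - (iota \<alpha> ** parity_op)"
proof -
  show "parity_op ** wedge_op \<alpha> = - (wedge_op \<alpha> ** parity_op)"
    by (rule ext_op_eqI) (simp add: op_mult_simps parity_op_eb wedge_op_eb ac_simps)
  show "parity_op ** iota \<alpha> = - (iota \<alpha> ** parity_op)"
  proof (rule ext_op_eqI)
    fix J :: "4 set"
    have "(- 1 :: complex) ^ card J = - ((- 1) ^ (card J - Suc 0))" if "\<alpha> \<in> J"
    proof -
      have "card J = Suc (card J - Suc 0)"
        using that card_gt_0_iff[of J] by auto
      then show ?thesis by (metis mult_minus1 power_Suc)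
    qed
    then show "parity_op ** iota \<alpha> *v eb J = - (iota \<alpha> ** parity_op) *v eb J"
      by (simp add: op_mult_simps parity_op_eb iota_eb ac_simps)
  qed
qed

lemma gamma_eb_min:
  assumes "\<And>a. a \<in> A \<Longrightarrow> b < a"
  shows "gamma b *v eb A = eb (insert b A)" "(wedge_op b + iota b) *v eb A = eb (insert b A)"
proof -
  have "b \<notin> A" "below b A = 0" using assms by (auto simp: below_def dest: less_imp_not_less)
  then show "gamma b *v eb A = eb (insert b A)" "(wedge_op b + iota b) *v eb A = eb (insert b A)"
    by (simp_all add: gamma_eq op_mult_simps wedge_op_eb iota_eb)
qed

lemma generator_commutes:
  "((wedge_op \<alpha> + iota \<alpha>) ** parity_op) ** gamma \<beta> = gamma \<beta> ** ((wedge_op \<alpha> + iota \<alpha>) ** parity_op)"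
proof (rule ext_op_eqI)
  fix J
  let ?W = wedge_op
  define v where "v = parity_op *v eb J"
  have ww: "?W \<alpha> *v (?W \<beta> *v v) + ?W \<beta> *v (?W \<alpha> *v v) = 0"
    using arg_cong[OF wedge_wedge[of \<alpha> \<beta>], of "\<lambda>A. A *v v"] by (simp add: op_mult_simps)
  have ii: "iota \<alpha> *v (iota \<beta> *v v) + iota \<beta> *v (iota \<alpha> *v v) = 0"
    using arg_cong[OF iota_iota[of \<alpha> \<beta>], of "\<lambda>A. A *v v"] by (simp add: op_mult_simps)
  have iw: "iota \<alpha> *v (?W \<beta> *v v) + ?W \<beta> *v (iota \<alpha> *v v)
      = iota \<beta> *v (?W \<alpha> *v v) + ?W \<alpha> *v (iota \<beta> *v v)"
  proof -
    have "eta \<alpha> \<beta> = eta \<beta> \<alpha>" by (simp add: eta_def)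
    then have "iota \<alpha> ** ?W \<beta> + ?W \<beta> ** iota \<alpha> = iota \<beta> ** ?W \<alpha> + ?W \<alpha> ** iota \<beta>"
      by (simp add: iota_wedge)
    from arg_cong[OF this, of "\<lambda>A. A *v v"] show ?thesis by (simp add: op_mult_simps)
  qed
  have p: "parity_op *v (gamma \<beta> *v eb J) = - (gamma \<beta> *v v)"
    using arg_cong[OF parity_ops(1)[of \<beta>], of "\<lambda>A. A *v eb J"]
      arg_cong[OF parity_ops(2)[of \<beta>], of "\<lambda>A. A *v eb J"]
    by (simp add: op_mult_simps gamma_eq v_def matrix_vector_mult_diff_distrib)
  have "(?W \<alpha> + iota \<alpha>) *v (gamma \<beta> *v v) + gamma \<beta> *v ((?W \<alpha> + iota \<alpha>) *v v) =
     (?W \<alpha> *v (?W \<beta> *v v) + ?W \<beta> *v (?W \<alpha> *v v)) - (iota \<alpha> *v (iota \<beta> *v v) + iota \<beta> *v (iota \<alpha> *v v))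
     + ((iota \<alpha> *v (?W \<beta> *v v) + ?W \<beta> *v (iota \<alpha> *v v))
        - (iota \<beta> *v (?W \<alpha> *v v) + ?W \<alpha> *v (iota \<beta> *v v)))"
    by (simp add: gamma_eq op_mult_simps matrix_vector_mult_diff_distrib matrix_vector_right_distrib)
  then have "(?W \<alpha> + iota \<alpha>) *v (gamma \<beta> *v v) + gamma \<beta> *v ((?W \<alpha> + iota \<alpha>) *v v) = 0"
    by (simp add: ww ii iw)
  then have *: "- ((?W \<alpha> + iota \<alpha>) *v (gamma \<beta> *v v)) = gamma \<beta> *v ((?W \<alpha> + iota \<alpha>) *v v)"
    by (simp add: neg_eq_iff_add_eq_0)
  have neg: "A *v (- u) = - (A *v u)" for A :: ext_op and u
    by (simp add: matrix_vector_mult_def vec_eq_iff sum_negf)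
  show "((?W \<alpha> + iota \<alpha>) ** parity_op) ** gamma \<beta> *v eb J
      = gamma \<beta> ** ((?W \<alpha> + iota \<alpha>) ** parity_op) *v eb J"
    unfolding op_mult_simps(1) p neg * v_def[symmetric] ..
qed

theorem ex1_Theta: "\<exists>!A. is_Theta I A"
proof (rule ex_ex1I)
  show "\<exists>A. is_Theta I A"
  proof (induction I rule: finite_linorder_min_induct[OF finite])
    case 1
    show ?case by (rule exI[of _ "mat 1"]) (simp add: is_Theta_def)
  next
    case (2 b A)
    then obtain T where T: "\<And>\<alpha>. T ** gamma \<alpha> = gamma \<alpha> ** T" "T *v eb {} = eb A"
      by (auto simp: is_Theta_def)
    define G where "G = (wedge_op b + iota b) ** parity_op"
    define c :: complex where "c = (- 1) ^ card A"
    have "c * c = 1" by (simp add: c_def flip: power_add)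
    have G: "G ** gamma \<alpha> = gamma \<alpha> ** G" for \<alpha>
      unfolding G_def by (rule generator_commutes)
    have GA: "G *v eb A = c *s eb (insert b A)"
      using gamma_eb_min(2)[of A b] 2
      by (simp only: G_def op_mult_simps(1) parity_op_eb op_mult_simps(5) c_def)
    have mc: "mat c *v v = c *s v" for v :: ext
      by (simp add: matrix_vector_mult_def mat_def vec_eq_iff if_distrib if_distribR cong: if_cong)
    have "is_Theta (insert b A) (mat c ** (G ** T))"
      unfolding is_Theta_def
    proof (intro conjI allI)
      fix \<alpha>
      show "mat c ** (G ** T) ** gamma \<alpha> = gamma \<alpha> ** (mat c ** (G ** T))"
      proof (rule ext_op_eqI)
        fix J
        have "T *v (gamma \<alpha> *v v) = gamma \<alpha> *v (T *v v)" "G *v (gamma \<alpha> *v v) = gamma \<alpha> *v (G *v v)" for v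
          using arg_cong[OF T(1)[of \<alpha>], of "\<lambda>A. A *v v"] arg_cong[OF G[of \<alpha>], of "\<lambda>A. A *v v"]
          by (simp_all only: op_mult_simps(1))
        then show "mat c ** (G ** T) ** gamma \<alpha> *v eb J = gamma \<alpha> ** (mat c ** (G ** T)) *v eb J"
          by (simp add: op_mult_simps mc)
      qed
      show "mat c ** (G ** T) *v eb {} = eb (insert b A)"
        using \<open>c * c = 1\<close> by (simp add: op_mult_simps mc T GA vector_smult_assoc)
    qed
    then show ?case ..
  qed
next
  fix A B
  assume A: "is_Theta I A" and B: "is_Theta I B"
  show "A = B"
  proof (rule ext_op_eqI)
    fix K :: "4 set"
    show "A *v eb K = B *v eb K"
    proof (induction K rule: finite_linorder_min_induct[OF finite])
      case 1
      then show ?case using A B by (simp add: is_Theta_def)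
    next
      case (2 b K)
      have "X *v eb (insert b K) = gamma b *v (X *v eb K)" if "is_Theta I X" for X
      proof -
        have "X ** gamma b *v eb K = gamma b ** X *v eb K"
          using that by (simp add: is_Theta_def)
        moreover have "gamma b *v eb K = eb (insert b K)" using gamma_eb_min(1)[of K b] 2 by blast
        ultimately show ?thesis by (simp only: op_mult_simps(1))
      qed
      then show ?case using A B 2 by simp
    qed
  qed
qed

definition JJ :: ext_op where
  "JJ = Theta {0, 1, 2, 3}"

text \<open>The form \<open>\<psi>\<^sup>\<dagger> \<phi>\<close>.\<close>

definition dagger_dot :: "ext \<Rightarrow> ext \<Rightarrow> complex" where
  "dagger_dot \<psi> \<phi> = (\<Sum>I\<in>UNIV. cnj (\<psi> $ I) * \<phi> $ I)"


section \<open>Lagrangians\<close>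

definition Omega :: "(4 \<Rightarrow> spacetime \<Rightarrow> ext_op) \<Rightarrow> 4 \<Rightarrow> 4 \<Rightarrow> spacetime \<Rightarrow> ext_op" where
  "Omega \<theta> \<alpha> \<beta> x = partial \<alpha> (\<theta> \<beta>) x - partial \<beta> (\<theta> \<alpha>) x
     + \<theta> \<alpha> x ** \<theta> \<beta> x - \<theta> \<beta> x ** \<theta> \<alpha> x"

definition Omega_up :: "(4 \<Rightarrow> spacetime \<Rightarrow> ext_op) \<Rightarrow> 4 \<Rightarrow> 4 \<Rightarrow> spacetime \<Rightarrow> ext_op" where
  "Omega_up \<theta> \<alpha> \<beta> x = (\<Sum>\<mu>\<in>UNIV. \<Sum>\<nu>\<in>UNIV. (eta \<alpha> \<mu> * eta \<beta> \<nu>) *\<^sub>R Omega \<theta> \<mu> \<nu> x)"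

definition plus_cc :: "complex \<Rightarrow> complex" where
  "plus_cc z = z + cnj z"

definition L_V :: "(4 \<Rightarrow> spacetime \<Rightarrow> ext_op) \<Rightarrow> spacetime \<Rightarrow> complex" where
  "L_V \<theta> x =
     plus_cc (1 / 2 * trace (\<Sum>\<alpha>\<in>UNIV. \<Sum>\<beta>\<in>UNIV. Omega \<theta> \<alpha> \<beta> x ** Omega_up \<theta> \<alpha> \<beta> x))"

definition Dirac :: "(4 \<Rightarrow> spacetime \<Rightarrow> ext_op) \<Rightarrow> (spacetime \<Rightarrow> ext) \<Rightarrow> spacetime \<Rightarrow> ext" where
  "Dirac \<theta> \<psi> x = (\<Sum>\<alpha>\<in>UNIV. gamma_up \<alpha> *v (partial \<alpha> \<psi> x + \<theta> \<alpha> x *v \<psi> x))"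

definition L_K :: "real \<Rightarrow> (4 \<Rightarrow> spacetime \<Rightarrow> ext_op) \<Rightarrow> (spacetime \<Rightarrow> ext) \<Rightarrow> spacetime \<Rightarrow> complex" where
  "L_K m \<theta> \<psi> x =
     plus_cc (1 / 2 * dagger_dot (\<psi> x) (hat_eta *v Dirac \<theta> \<psi> x))
     - complex_of_real m * dagger_dot (\<psi> x) (hat_eta *v \<psi> x)"


section \<open>Tensor fields and the constrained variational problem\<close>

text \<open>The field value \<open>S x $ \<alpha> $ \<beta>\<close> is the component with upper indices.\<close>

type_synonym tensor_field = "spacetime \<Rightarrow> real ^ 4 ^ 4"

definition sym_field :: "tensor_field \<Rightarrow> bool" where
  "sym_field S \<longleftrightarrow> (\<forall>x \<alpha> \<beta>. S x $ \<alpha> $ \<beta> = S x $ \<beta> $ \<alpha>)"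

definition contraction_free :: "tensor_field \<Rightarrow> bool" where
  "contraction_free S \<longleftrightarrow> (\<forall>x. (\<Sum>\<alpha>\<in>UNIV. \<Sum>\<beta>\<in>UNIV. eta \<alpha> \<beta> * S x $ \<alpha> $ \<beta>) = 0)"

text \<open>\<open>low S\<close> has both indices lowered, \<open>mixed S\<close> only the first one.\<close>

definition low :: "tensor_field \<Rightarrow> tensor_field" where
  "low S x = (\<chi> \<alpha> \<beta>. \<Sum>\<mu>\<in>UNIV. \<Sum>\<nu>\<in>UNIV. eta \<alpha> \<mu> * eta \<beta> \<nu> * S x $ \<mu> $ \<nu>)"

definition mixed :: "tensor_field \<Rightarrow> tensor_field" where
  "mixed S x = (\<chi> \<alpha> \<beta>. \<Sum>\<mu>\<in>UNIV. eta \<alpha> \<mu> * S x $ \<mu> $ \<beta>)"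

definition chiral :: "real \<Rightarrow> ext_op" where
  "chiral \<zeta> = mat (complex_of_real (cos \<zeta>)) + mat (\<i> * complex_of_real (sin \<zeta>)) ** JJ"

definition NN :: "real \<Rightarrow> tensor_field \<Rightarrow> 4 \<Rightarrow> spacetime \<Rightarrow> ext_op" where
  "NN \<zeta> S \<alpha> x =
     (\<Sum>\<beta>\<in>UNIV. \<Sum>\<epsilon>\<in>UNIV. (eta \<alpha> \<beta> * S x $ \<beta> $ \<epsilon>) *\<^sub>R (chiral \<zeta> ** Theta {\<epsilon>}))"

definition total_L ::
  "real \<Rightarrow> real \<Rightarrow> real \<Rightarrow> (spacetime \<Rightarrow> ext) \<Rightarrow> tensor_field \<Rightarrow> spacetime \<Rightarrow> complex" where
  "total_L m \<tau> \<zeta> \<psi> S x = L_K m (NN \<zeta> S) \<psi> x - complex_of_real \<tau> * L_V (NN \<zeta> S) x"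

text \<open>The integral over all of space-time need not converge, so stationarity refers to
  integrals over arbitrary compact sets outside of which the variation vanishes. The admissible
  fields form a linear space, hence the variations are \<open>S + \<epsilon> h\<close>.\<close>

definition stationary :: "(tensor_field \<Rightarrow> spacetime \<Rightarrow> complex) \<Rightarrow> tensor_field \<Rightarrow> bool" where
  "stationary L S \<longleftrightarrow>
     (\<forall>K h. compact K \<and> smooth h \<and> sym_field h \<and> contraction_free h \<and> (\<forall>x. x \<notin> K \<longrightarrow> h x = 0)
        \<longrightarrow> ((\<lambda>\<epsilon>::real. LINT x:K|lborel. L (\<lambda>y. S y + \<epsilon> *\<^sub>R h y) x)
              has_vector_derivative 0) (at 0))"

end

theory Submission
  imports Defs
begin

text \<open>The operators \<open>\<Theta>\<^sub>\<alpha>\<close> anticommute up to \<open>- 2 \<eta>\<^sub>\<alpha>\<^sub>\<beta>\<close> and \<open>J\<close> anticommutes with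
  them and squares to \<open>- 1\<close>, because an operator commuting with all gamma matrices is determined
  by its value on the vacuum. Moving the chiral factors together turns
  \<open>(cos \<zeta> + i sin \<zeta> J) \<Theta>\<^sub>\<alpha>\<close> into generators of a Clifford algebra with metric
  \<open>cos 2\<zeta> \<eta>\<close>, and \<open>L\<^sub>V\<close> follows from the traces of products of two and four of them.
  For the field equation, \<open>L\<close> along \<open>S + \<epsilon> h\<close> is a polynomial in \<open>\<epsilon>\<close> whose linear
  coefficient is integrated by parts; testing with \<open>h = \<phi> M\<close> for smooth bumps \<open>\<phi>\<close> and constant
  symmetric contraction-free \<open>M\<close> localises the result to the symmetric traceless part of the
  Euler-Lagrange expression. The source term is real since the \<open>\<eta>\<close>-adjoints of
  \<open>\<gamma>\<^sub>\<alpha>\<close> and \<open>\<Theta>\<^sub>\<alpha>\<close> are their negatives while \<open>J\<close> is self-adjoint.\<close>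

section \<open>Clifford relations\<close>

text \<open>All computations use the components of S with upper indices. The metric is diagonal with
  entries of square 1, so each contraction is a sum weighted by the signs \<open>eta a a\<close>;
  lowered and mixed components are translated only when the formulas of the statement are matched.
  The constraint shapes the field equation. The components of a variation are not independent, so
  stationarity sees the Euler-Lagrange expression only up to an antisymmetric part and a multiple of
  \<open>eta\<close>. Removing that multiple produces the terms with 1/4 \<open>eta\<close>; the
  wave operator leaves none, because differentiating the constraint shows that its trace vanishes.
  Since the integrand is polynomial in S and its first derivatives, its integral over a compact set
  is itself a polynomial in \<epsilon>, and its derivative at 0 is read off from a
  coefficient.\<close>

lemma eta_sym: "eta a b = eta b a"
  by (simp add: eta_def)

text \<open>Only the diagonal term survives, so raising or lowering an index is multiplication by
  the sign \<open>eta a a\<close>; \<open>eta_sq_left\<close> then cancels a raising against a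
  lowering inside longer products.\<close>

lemma sum_eta: "(\<Sum>b\<in>UNIV. eta a b * f b) = eta a a * f a"
proof -
  have "(\<Sum>b\<in>UNIV. eta a b * f b) = (\<Sum>b\<in>UNIV. if b = a then eta a a * f a else 0)"
    by (rule sum.cong) (auto simp: eta_def)
  then show ?thesis by simp
qed

lemma sum_eta_scaleR: "(\<Sum>b\<in>UNIV. eta a b *\<^sub>R f b) = eta a a *\<^sub>R f a"
  for f :: "4 \<Rightarrow> 'a::real_vector"
proof -
  have "(\<Sum>b\<in>UNIV. eta a b *\<^sub>R f b) = (\<Sum>b\<in>UNIV. if b = a then eta a a *\<^sub>R f a else 0)"
    by (rule sum.cong) (auto simp: eta_def)
  then show ?thesis by simp
qed

lemma eta_sq: "eta a a * eta a a = 1"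
  by (simp add: eta_def)

lemma eta_sq_left: "eta a a * (eta a a * z) = z"
  by (simp add: eta_def)

section \<open>Operators commuting with all gamma matrices\<close>

definition gamma_commutant :: "ext_op set" where
  "gamma_commutant = {A. \<forall>\<alpha>. A ** gamma \<alpha> = gamma \<alpha> ** A}"

lemma gamma_commutant_iff: "A \<in> gamma_commutant \<longleftrightarrow> (\<forall>\<alpha> v. A *v (gamma \<alpha> *v v) = gamma \<alpha> *v (A *v v))"
proof -
  have "A ** gamma \<alpha> = gamma \<alpha> ** A \<longleftrightarrow> (\<forall>v. A *v (gamma \<alpha> *v v) = gamma \<alpha> *v (A *v v))" for \<alpha>
  proof
    show "A ** gamma \<alpha> = gamma \<alpha> ** A \<Longrightarrow> \<forall>v. A *v (gamma \<alpha> *v v) = gamma \<alpha> *v (A *v v)"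
      by (metis op_mult_simps(1))
    show "\<forall>v. A *v (gamma \<alpha> *v v) = gamma \<alpha> *v (A *v v) \<Longrightarrow> A ** gamma \<alpha> = gamma \<alpha> ** A"
      by (rule ext_op_eqI) (simp add: op_mult_simps)
  qed
  then show ?thesis by (auto simp: gamma_commutant_def)
qed

lemma mat_mult_vec: "mat c *v v = c *s v" for v :: ext
  by (simp add: matrix_vector_mult_def mat_def vec_eq_iff if_distrib if_distribR cong: if_cong)

lemma gamma_commutant_add: "A \<in> gamma_commutant \<Longrightarrow> B \<in> gamma_commutant \<Longrightarrow> A + B \<in> gamma_commutant"
  and gamma_commutant_uminus: "A \<in> gamma_commutant \<Longrightarrow> - A \<in> gamma_commutant"
  and gamma_commutant_mult: "A \<in> gamma_commutant \<Longrightarrow> B \<in> gamma_commutant \<Longrightarrow> A ** B \<in> gamma_commutant"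
  and gamma_commutant_mat: "mat c \<in> gamma_commutant"
  by (auto simp: gamma_commutant_iff op_mult_simps mat_mult_vec matrix_vector_right_distrib
      vec.neg)

text \<open>Every basis vector arises from the vacuum \<open>eb {}\<close> by applying gamma
  matrices, the largest index first: for b below all of K, \<open>gamma b\<close> just adjoins b.
  Commuting A and B past these matrices reduces everything to the vacuum.\<close>

lemma gamma_commutant_eqI:
  assumes A: "A \<in> gamma_commutant" and B: "B \<in> gamma_commutant" and "A *v eb {} = B *v eb {}"
  shows "A = B"
proof (rule ext_op_eqI)
  fix K :: "4 set"
  show "A *v eb K = B *v eb K"
  proof (induction K rule: finite_linorder_min_induct[OF finite])
    case 1
    then show ?case by (rule assms)
  next
    case (2 b K)
    have "gamma b *v eb K = eb (insert b K)" using gamma_eb_min(1)[of K b] 2 by blast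
    then show ?case using A B 2 unfolding gamma_commutant_iff by metis
  qed
qed

lemma is_Theta_Theta: "is_Theta I (Theta I)"
  unfolding Theta_def by (rule theI'[OF ex1_Theta])

lemma Theta_eqI: "is_Theta I A \<Longrightarrow> Theta I = A"
  using ex1_Theta is_Theta_Theta by blast

lemma Theta_commutant: "Theta I \<in> gamma_commutant"
  using is_Theta_Theta by (simp add: is_Theta_def gamma_commutant_def)

lemma Theta_vacuum: "Theta I *v eb {} = eb I"
  using is_Theta_Theta by (simp add: is_Theta_def)

lemma Theta_single: "Theta {a} = (wedge_op a + iota a) ** parity_op"
  by (rule Theta_eqI) (simp add: is_Theta_def generator_commutes op_mult_simps parity_op_eb
      gamma_eb_min(2)[of "{}", simplified op_mult_simps, simplified])

lemma gamma_vacuum: "gamma a *v eb {} = eb {a}"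
  using gamma_eb_min(1)[of "{}"] by simp

lemma commutant_eb_single: "A \<in> gamma_commutant \<Longrightarrow> A *v eb {b} = gamma b *v (A *v eb {})"
  by (metis gamma_commutant_iff gamma_vacuum)

text \<open>Commuting past gamma matrices reverses the order: on the vacuum,
  \<open>Theta {a} ** Theta {b}\<close> gives \<open>gamma b\<close> applied to
  \<open>eb {a}\<close>. In the symmetrised product the wedge parts cancel, and the two contractions
  contribute - \<open>eta a b\<close> each.\<close>

lemma Theta_anticommute:
  "Theta {a} *v (Theta {b} *v v) = - (Theta {b} *v (Theta {a} *v v)) - complex_of_real (2 * eta a b) *s v"
proof -
  have "Theta {a} ** Theta {b} = - (Theta {b} ** Theta {a}) + - mat (complex_of_real (2 * eta a b))"
  proof (rule gamma_commutant_eqI)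
    have w: "wedge_op a *v eb {b} + wedge_op b *v eb {a} = 0"
      using arg_cong[OF wedge_wedge[of a b], of "\<lambda>A. A *v eb {}"]
      by (simp add: op_mult_simps wedge_op_eb below_def)
    have "gamma b *v eb {a} + gamma a *v eb {b} = - complex_of_real (2 * eta a b) *s eb {}"
      using w by (cases "a = b") (auto simp: gamma_eq op_mult_simps iota_eb eta_def
          vector_ssub_ldistrib algebra_simps vec_eq_iff)
    then show "Theta {a} ** Theta {b} *v eb {}
       = (- (Theta {b} ** Theta {a}) + - mat (complex_of_real (2 * eta a b))) *v eb {}"
      by (simp add: op_mult_simps Theta_vacuum commutant_eb_single[OF Theta_commutant] mat_mult_vec
          algebra_simps)
  qed (intro gamma_commutant_add gamma_commutant_uminus gamma_commutant_mult gamma_commutant_mat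
      Theta_commutant)+
  from arg_cong[OF this, of "\<lambda>A. A *v v"] show ?thesis
    by (simp add: op_mult_simps mat_mult_vec)
qed

lemma index_set: "{0, 1, 2, 3 :: 4} = UNIV"
proof -
  have "x = 0 \<or> x = 1 \<or> x = 2 \<or> x = 3" for x :: 4
    \<comment> \<open>\<open>exhaust_4\<close> lists 1, 2, 3, 4, and 4 = 0 in this numeral
      type.\<close>
    using exhaust_4[of x] by auto
  then show ?thesis by blast
qed

lemma JJ_commutant: "JJ \<in> gamma_commutant"
  and JJ_vacuum: "JJ *v eb {} = eb UNIV"
  by (simp_all only: JJ_def index_set Theta_commutant Theta_vacuum)

text \<open>On the vacuum both products are multiples of \<open>gamma a\<close> applied to the top
  form \<open>eb UNIV\<close>. There the wedge part vanishes and the degree 4 is even, so only the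
  contraction is left, which enters \<open>gamma a\<close> and \<open>Theta {a}\<close> with
  opposite signs.\<close>

lemma JJ_Theta: "JJ *v (Theta {a} *v v) = - (Theta {a} *v (JJ *v v))"
proof -
  have "JJ ** Theta {a} = - (Theta {a} ** JJ)"
  proof (rule gamma_commutant_eqI)
    have "JJ *v eb {a} = gamma a *v eb UNIV"
      by (simp add: commutant_eb_single[OF JJ_commutant] JJ_vacuum)
    moreover have "Theta {a} *v eb UNIV = - (gamma a *v eb UNIV)"
      by (simp add: Theta_single gamma_eq op_mult_simps parity_op_eb wedge_op_eb)
    ultimately show "JJ ** Theta {a} *v eb {} = - (Theta {a} ** JJ) *v eb {}"
      by (simp add: op_mult_simps JJ_vacuum Theta_vacuum)
  qed (intro gamma_commutant_uminus gamma_commutant_mult JJ_commutant Theta_commutant)+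
  from arg_cong[OF this, of "\<lambda>A. A *v v"] show ?thesis
    by (simp add: op_mult_simps)
qed

lemma index_less: "(0::4) < 1" "(0::4) < 2" "(0::4) < 3" "(1::4) < 2" "(1::4) < 3" "(2::4) < 3"
  by (simp_all add: less_bit0_def bit0.Rep_0 bit0.Rep_1 bit0.Rep_numeral)

lemma Theta_eb_min:
  assumes "\<forall>b\<in>I. a < b"
  shows "Theta {a} *v eb I = (- 1) ^ card I *s eb (insert a I)"
  using gamma_eb_min(2)[of I a] assms by (simp add: Theta_single op_mult_simps parity_op_eb flip: vec.scale_right_distrib)

text \<open>The parity factors of the four generators act on degrees 0, 1, 2, 3 and multiply to
  (-1)^6 = 1, so the ordered product carries no sign.\<close>

lemma JJ_eq: "JJ = Theta {0} ** (Theta {1} ** (Theta {2} ** Theta {3}))"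
  unfolding JJ_def
proof (rule Theta_eqI, unfold is_Theta_def, intro conjI)
  show "\<forall>\<alpha>. Theta {0} ** (Theta {1} ** (Theta {2} ** Theta {3})) ** gamma \<alpha>
      = gamma \<alpha> ** (Theta {0} ** (Theta {1} ** (Theta {2} ** Theta {3})))"
    using gamma_commutant_mult Theta_commutant unfolding gamma_commutant_def by blast
  show "Theta {0} ** (Theta {1} ** (Theta {2} ** Theta {3})) *v eb {} = eb {0, 1, 2, 3}"
    using index_less by (simp add: op_mult_simps Theta_vacuum Theta_eb_min vec.neg)
qed

lemma Theta_anticommute_distinct:
  "a \<noteq> b \<Longrightarrow> Theta {a} *v (Theta {b} *v v) = - (Theta {b} *v (Theta {a} *v v))"
  by (subst Theta_anticommute) (simp add: eta_def)

text \<open>Oriented as rewrite rules that sort the indices increasingly, since the general rule has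
  no direction. Together with \<open>Theta_square\<close> they normalise products of
  generators.\<close>

lemma Theta_swap:
  "Theta {1} *v (Theta {0} *v v) = - (Theta {0} *v (Theta {1} *v v))"
  "Theta {2} *v (Theta {0} *v v) = - (Theta {0} *v (Theta {2} *v v))"
  "Theta {3} *v (Theta {0} *v v) = - (Theta {0} *v (Theta {3} *v v))"
  "Theta {2} *v (Theta {1} *v v) = - (Theta {1} *v (Theta {2} *v v))"
  "Theta {3} *v (Theta {1} *v v) = - (Theta {1} *v (Theta {3} *v v))"
  "Theta {3} *v (Theta {2} *v v) = - (Theta {2} *v (Theta {3} *v v))"
  by (intro Theta_anticommute_distinct less_imp_neq[THEN not_sym] index_less)+

text \<open>Serves the two places where exchanging factors returns the same quantity: equal
  generators in \<open>Theta_square\<close>, and cyclicity of the trace in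
  \<open>trace_chiral_Theta2\<close>.\<close>

lemma half_of_reflection:
  fixes x k :: complex
  assumes "x = - x - 2 * k"
  shows "x = - k"
proof -
  have "2 * x = 2 * - k" using assms by algebra
  then show ?thesis by simp
qed

lemma Theta_square: "Theta {a} *v (Theta {a} *v v) = - complex_of_real (eta a a) *s v"
proof -
  have "(Theta {a} *v (Theta {a} *v v)) $ i = - (complex_of_real (eta a a) * v $ i)" for i
  proof (rule half_of_reflection)
    show "(Theta {a} *v (Theta {a} *v v)) $ i
        = - ((Theta {a} *v (Theta {a} *v v)) $ i) - 2 * (complex_of_real (eta a a) * v $ i)"
      by (subst (1) Theta_anticommute) simp
  qed
  then show ?thesis by (simp add: vec_eq_iff)
qed

lemma JJ_square: "JJ *v (JJ *v v) = - v"
  by (simp add: JJ_eq op_mult_simps Theta_swap Theta_square vec.neg eta_def)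

text \<open>Reversing four distinct anticommuting factors takes six exchanges, an even number. In
  this form the adjoint, which reverses the factors once more, comes out in the order of
  \<open>JJ_eq\<close>.\<close>

lemma JJ_rev: "JJ *v v = Theta {3} *v (Theta {2} *v (Theta {1} *v (Theta {0} *v v)))"
  by (simp add: JJ_eq op_mult_simps Theta_swap Theta_square vec.neg)

section \<open>The chiral generators\<close>

lemma chiral_vec:
  "chiral \<zeta> *v v = complex_of_real (cos \<zeta>) *s v + (\<i> * complex_of_real (sin \<zeta>)) *s (JJ *v v)"
  by (simp add: chiral_def op_mult_simps mat_mult_vec)

definition chiral_Theta :: "real \<Rightarrow> 4 \<Rightarrow> ext_op" where
  "chiral_Theta \<zeta> e = chiral \<zeta> ** Theta {e}"

lemma chiral_Theta_vec: "chiral_Theta \<zeta> e *v v = chiral \<zeta> *v (Theta {e} *v v)"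
  by (simp add: chiral_Theta_def op_mult_simps)

text \<open>Moving the second chiral factor to the left past \<open>Theta {e}\<close> changes the
  sign of J in it, and (a + b J)(a - b J) = a^2 + b^2 because J^2 = -1. With a = cos \<zeta> and b =
  i sin \<zeta> this is cos^2 - sin^2, hence the double angle.\<close>

lemma chiral_Theta_mult_vec: "chiral_Theta \<zeta> e *v (chiral_Theta \<zeta> f *v v) = complex_of_real (cos (2 * \<zeta>)) *s (Theta {e} *v (Theta {f} *v v))"
proof -
  have c: "complex_of_real (cos (2 * \<zeta>)) = complex_of_real (cos \<zeta>) * complex_of_real (cos \<zeta>)
      - complex_of_real (sin \<zeta>) * complex_of_real (sin \<zeta>)"
    by (simp add: cos_double power2_eq_square)
  define a b where "a = complex_of_real (cos \<zeta>)" and "b = \<i> * complex_of_real (sin \<zeta>)"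
  have b: "b * b = - (complex_of_real (sin \<zeta>) * complex_of_real (sin \<zeta>))"
    by (simp add: b_def complex_eq_iff)
  have "chiral \<zeta> *v (Theta {e} *v (chiral \<zeta> *v w)) = (a * a + b * b) *s (Theta {e} *v w)" for w
    unfolding chiral_vec matrix_vector_right_distrib op_mult_simps a_def[symmetric] b_def[symmetric]
    by (simp add: JJ_Theta JJ_square vec.neg vec_eq_iff algebra_simps)
  then show ?thesis by (simp add: chiral_Theta_vec c b a_def)
qed

lemma chiral_Theta_anticommute:
  "chiral_Theta \<zeta> e ** chiral_Theta \<zeta> f = - (chiral_Theta \<zeta> f ** chiral_Theta \<zeta> e) - mat (complex_of_real (2 * cos (2 * \<zeta>) * eta e f))"
  by (rule ext_op_eqI) (simp add: op_mult_simps(1-4) chiral_Theta_mult_vec mat_mult_vec Theta_anticommute[of e f]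
      vec_eq_iff algebra_simps)

lemma JJ_chiral_Theta: "JJ ** chiral_Theta \<zeta> e = - (chiral_Theta \<zeta> e ** JJ)"
  by (rule ext_op_eqI) (simp add: op_mult_simps chiral_Theta_vec chiral_vec JJ_Theta JJ_square vec.neg vec_eq_iff
      matrix_vector_right_distrib algebra_simps)

section \<open>Traces\<close>

lemma op_mult_add_left: "(A + B) ** C = A ** C + B ** C" for A B C :: ext_op
  by (simp add: vec_eq_iff matrix_matrix_mult_def algebra_simps sum.distrib)

interpretation op_mult: bounded_bilinear "(**) :: ext_op \<Rightarrow> ext_op \<Rightarrow> ext_op"
  unfolding bilinear_conv_bounded_bilinear[symmetric] bilinear_def
  by (auto intro!: linearI simp: matrix_add_ldistrib op_mult_add_left scalar_matrix_assoc matrix_scalar_ac)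

lemma linear_trace: "linear (trace :: ext_op \<Rightarrow> complex)"
  by (rule linearI) (simp_all add: trace_def sum.distrib scaleR_sum_right)

lemma trace_mat: "trace (mat k :: ext_op) = 16 * k"
  by (simp add: trace_def mat_def)

lemma trace_mat_mult: "trace (mat k ** A :: ext_op) = k * trace A"
  by (simp add: trace_def mat_def matrix_matrix_mult_def if_distrib if_distribR sum_distrib_left cong: if_cong)

text \<open>The arbitrary factors A and B let one generator be carried step by step through a longer
  product.\<close>

lemma trace_swap:
  fixes A B :: ext_op
  shows "trace (A ** (chiral_Theta \<zeta> e ** chiral_Theta \<zeta> f) ** B)
   = - trace (A ** (chiral_Theta \<zeta> f ** chiral_Theta \<zeta> e) ** B) - complex_of_real (2 * cos (2 * \<zeta>) * eta e f) * trace (A ** B)"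
proof -
  define k where "k = complex_of_real (2 * cos (2 * \<zeta>) * eta e f)"
  have comm: "A ** mat k = mat k ** A" for A :: ext_op
    by (rule ext_op_eqI) (simp add: op_mult_simps mat_mult_vec)
  have "A ** mat k ** B = mat k ** (A ** B)"
    by (subst comm) (rule matrix_mul_assoc[symmetric])
  then have "trace (A ** mat k ** B) = k * trace (A ** B)"
    by (simp only: trace_mat_mult)
  then show ?thesis
    unfolding chiral_Theta_anticommute[of \<zeta> e f] k_def[symmetric]
    by (simp add: op_mult.diff_left op_mult.diff_right op_mult.minus_left op_mult.minus_right
        linear_diff[OF linear_trace] linear_neg[OF linear_trace])
qed

lemma trace_chiral_Theta2: "trace (chiral_Theta \<zeta> e ** chiral_Theta \<zeta> f) = complex_of_real (- 16 * cos (2 * \<zeta>) * eta e f)"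
proof -
  have "trace (chiral_Theta \<zeta> e ** chiral_Theta \<zeta> f) = - trace (chiral_Theta \<zeta> e ** chiral_Theta \<zeta> f)
      - 2 * complex_of_real (16 * cos (2 * \<zeta>) * eta e f)"
    using trace_swap[of "mat 1" \<zeta> e f "mat 1"] trace_mul_sym[of "chiral_Theta \<zeta> f" "chiral_Theta \<zeta> e"]
    by (simp add: trace_mat algebra_simps)
  from half_of_reflection[OF this] show ?thesis by simp
qed

text \<open>By cyclicity J A J and J J A have the same trace; with J^2 = -1 and the anticommutation,
  the former is A and the latter is - A.\<close>

lemma trace_odd:
  assumes "JJ ** A = - (A ** JJ)"
  shows "trace A = 0"
proof -
  have J: "JJ ** JJ = - mat 1"
    by (rule ext_op_eqI) (simp add: op_mult_simps JJ_square)
  have "trace (JJ ** A ** JJ) = trace (JJ ** (JJ ** A))" by (rule trace_mul_sym)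
  moreover have "JJ ** A ** JJ = A"
    unfolding assms op_mult.minus_left matrix_mul_assoc[symmetric] J op_mult.minus_right by simp
  moreover have "JJ ** (JJ ** A) = - A"
    unfolding matrix_mul_assoc J op_mult.minus_left by simp
  ultimately show ?thesis by (simp add: linear_neg[OF linear_trace])
qed

lemma trace_chiral_Theta3: "trace (chiral_Theta \<zeta> e ** (chiral_Theta \<zeta> f ** chiral_Theta \<zeta> g)) = 0"
proof (rule trace_odd)
  have J: "JJ ** (chiral_Theta \<zeta> e ** A) = - (chiral_Theta \<zeta> e ** (JJ ** A))" for e and A :: ext_op
    by (simp only: matrix_mul_assoc JJ_chiral_Theta op_mult.minus_left)
  show "JJ ** (chiral_Theta \<zeta> e ** (chiral_Theta \<zeta> f ** chiral_Theta \<zeta> g)) = - (chiral_Theta \<zeta> e ** (chiral_Theta \<zeta> f ** chiral_Theta \<zeta> g) ** JJ)"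
    by (simp only: J JJ_chiral_Theta op_mult.minus_right minus_minus) (simp only: matrix_mul_assoc)
qed

text \<open>Anticommuting the first factor past the other three and using cyclicity of the trace returns
  the original trace with the opposite sign.\<close>

lemma trace_chiral_Theta4:
  "trace (chiral_Theta \<zeta> e ** chiral_Theta \<zeta> f ** (chiral_Theta \<zeta> g ** chiral_Theta \<zeta> h))
   = complex_of_real (16 * (cos (2 * \<zeta>))\<^sup>2 * (eta e f * eta g h - eta e g * eta f h + eta e h * eta f g))"
proof -
  let ?k = "\<lambda>a b. complex_of_real (2 * cos (2 * \<zeta>) * eta a b)"
  let ?V = "chiral_Theta \<zeta>"
  have 1: "trace (?V e ** ?V f ** (?V g ** ?V h)) = - trace (?V f ** ?V e ** (?V g ** ?V h)) - ?k e f * trace (?V g ** ?V h)"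
    using trace_swap[of "mat 1" \<zeta> e f "?V g ** ?V h"] by simp
  have 2: "trace (?V f ** ?V e ** (?V g ** ?V h)) = - trace (?V f ** ?V g ** (?V e ** ?V h)) - ?k e g * trace (?V f ** ?V h)"
    using trace_swap[of "?V f" \<zeta> e g "?V h"] by (simp only: matrix_mul_assoc)
  have 3: "trace (?V f ** ?V g ** (?V e ** ?V h)) = - trace (?V f ** ?V g ** (?V h ** ?V e)) - ?k e h * trace (?V f ** ?V g)"
    using trace_swap[of "?V f ** ?V g" \<zeta> e h "mat 1"] by simp
  have 4: "trace (?V f ** ?V g ** (?V h ** ?V e)) = trace (?V e ** ?V f ** (?V g ** ?V h))"
    using trace_mul_sym[of "?V e" "?V f ** ?V g ** ?V h"] by (simp only: matrix_mul_assoc)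
  have 5: "2 * trace (?V e ** ?V f ** (?V g ** ?V h))
      = 2 * complex_of_real (16 * (cos (2 * \<zeta>))\<^sup>2 * (eta e f * eta g h - eta e g * eta f h + eta e h * eta f g))"
    using 1 unfolding 2 3 4 trace_chiral_Theta2 by (simp add: algebra_simps power2_eq_square)
  then show ?thesis by simp
qed

definition chiral_Theta_comm :: "real \<Rightarrow> 4 \<Rightarrow> 4 \<Rightarrow> ext_op" where
  "chiral_Theta_comm \<zeta> e f = chiral_Theta \<zeta> e ** chiral_Theta \<zeta> f - chiral_Theta \<zeta> f ** chiral_Theta \<zeta> e"

lemma trace_chiral_Theta_comm: "trace (chiral_Theta \<zeta> e ** chiral_Theta_comm \<zeta> f g) = 0" "trace (chiral_Theta_comm \<zeta> f g ** chiral_Theta \<zeta> e) = 0"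
  by (simp_all add: chiral_Theta_comm_def op_mult.diff_right op_mult.diff_left linear_diff[OF linear_trace] trace_chiral_Theta3
     flip: matrix_mul_assoc)

lemma trace_comm_comm:
  "trace (chiral_Theta_comm \<zeta> e f ** chiral_Theta_comm \<zeta> g h) = complex_of_real (64 * (cos (2 * \<zeta>))\<^sup>2 * (eta e h * eta f g - eta e g * eta f h))"
  unfolding chiral_Theta_comm_def op_mult.diff_right op_mult.diff_left linear_diff[OF linear_trace] trace_chiral_Theta4
  by (simp add: algebra_simps eta_sym)

lemma bounded_bilinear_trace: "bounded_bilinear (\<lambda>A B :: ext_op. trace (A ** B))"
  unfolding bilinear_conv_bounded_bilinear[symmetric] bilinear_def
  by (auto intro!: linearI simp: op_mult.add_left op_mult.add_right op_mult.scaleR_left op_mult.scaleR_right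
       linear_add[OF linear_trace] linear_scale[OF linear_trace])

interpretation trace2: bounded_bilinear "\<lambda>A B :: ext_op. trace (A ** B)"
  by (rule bounded_bilinear_trace)

text \<open>A curvature component has this shape: the derivatives of S contribute single generators,
  the commutator of two potentials contributes \<open>chiral_Theta_comm\<close>. Mixed traces
  contain three generators and vanish, so the kinetic and the quartic part of the Lagrangian
  decouple.\<close>

lemma trace_curvature:
  fixes D :: "4 \<Rightarrow> real" and q :: "4 \<Rightarrow> 4 \<Rightarrow> real"
  defines "W \<equiv> \<lambda>\<zeta>. (\<Sum>e\<in>UNIV. D e *\<^sub>R chiral_Theta \<zeta> e) + (\<Sum>e\<in>UNIV. \<Sum>f\<in>UNIV. q e f *\<^sub>R chiral_Theta_comm \<zeta> e f)"
  shows "trace (W \<zeta> ** W \<zeta>) = complex_of_real (- 16 * cos (2 * \<zeta>) * (\<Sum>e\<in>UNIV. eta e e * (D e)\<^sup>2)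
     + 64 * (cos (2 * \<zeta>))\<^sup>2 * (\<Sum>e\<in>UNIV. \<Sum>f\<in>UNIV. eta e e * eta f f * (q e f * q f e - (q e f)\<^sup>2)))"
proof -
  let ?A = "\<Sum>e\<in>UNIV. D e *\<^sub>R chiral_Theta \<zeta> e" and ?B = "\<Sum>e\<in>UNIV. \<Sum>f\<in>UNIV. q e f *\<^sub>R chiral_Theta_comm \<zeta> e f"
  have AB: "trace (?A ** ?B) = 0" "trace (?B ** ?A) = 0"
    by (simp_all add: trace2.sum_left trace2.sum_right trace2.scaleR_left trace2.scaleR_right trace_chiral_Theta_comm)
  have "trace (?A ** ?A) = complex_of_real (\<Sum>e\<in>UNIV. \<Sum>f\<in>UNIV. eta e f * (- 16 * cos (2 * \<zeta>) * D e * D f))"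
    unfolding trace2.sum_left trace2.sum_right trace2.scaleR_left trace2.scaleR_right trace_chiral_Theta2 of_real_sum
      scaleR_sum_right
    by (intro sum.cong refl) (simp add: scaleR_conv_of_real eta_sym)
  also have "(\<Sum>e\<in>UNIV. \<Sum>f\<in>UNIV. eta e f * (- 16 * cos (2 * \<zeta>) * D e * D f))
      = - 16 * cos (2 * \<zeta>) * (\<Sum>e\<in>UNIV. eta e e * (D e)\<^sup>2)"
    unfolding sum_eta sum_distrib_left by (intro sum.cong refl) (simp add: power2_eq_square)
  finally have AA: "trace (?A ** ?A) = complex_of_real (- 16 * cos (2 * \<zeta>) * (\<Sum>e\<in>UNIV. eta e e * (D e)\<^sup>2))" .
  have "trace (?B ** ?B) = complex_of_real (\<Sum>e\<in>UNIV. \<Sum>f\<in>UNIV. \<Sum>g\<in>UNIV. \<Sum>h\<in>UNIV.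
      q e f * q g h * (64 * (cos (2 * \<zeta>))\<^sup>2 * (eta e h * eta f g - eta e g * eta f h)))"
    unfolding trace2.sum_left trace2.sum_right trace2.scaleR_left trace2.scaleR_right trace_comm_comm of_real_sum
      scaleR_sum_right
    by (intro sum.cong refl) (simp add: scaleR_conv_of_real eta_sym)
  also have "(\<Sum>e\<in>UNIV. \<Sum>f\<in>UNIV. \<Sum>g\<in>UNIV. \<Sum>h\<in>UNIV.
      q e f * q g h * (64 * (cos (2 * \<zeta>))\<^sup>2 * (eta e h * eta f g - eta e g * eta f h)))
    = (\<Sum>e\<in>UNIV. \<Sum>f\<in>UNIV. 64 * (cos (2 * \<zeta>))\<^sup>2 * (q e f *
         ((\<Sum>g\<in>UNIV. eta f g * (\<Sum>h\<in>UNIV. eta e h * q g h)) - (\<Sum>g\<in>UNIV. eta e g * (\<Sum>h\<in>UNIV. eta f h * q g h)))))"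
    by (intro sum.cong refl) (simp add: sum_distrib_left sum_subtractf algebra_simps)
  also have "\<dots> = 64 * (cos (2 * \<zeta>))\<^sup>2 * (\<Sum>e\<in>UNIV. \<Sum>f\<in>UNIV. eta e e * eta f f * (q e f * q f e - (q e f)\<^sup>2))"
    unfolding sum_eta sum_distrib_left
    by (intro sum.cong refl) (simp add: power2_eq_square algebra_simps)
  finally have BB: "trace (?B ** ?B) = \<dots>" .
  show ?thesis
    unfolding W_def by (simp add: trace2.add_left trace2.add_right AB AA BB del: of_real_mult)
qed

section \<open>Partial derivatives and smooth fields\<close>

lemma line_has_derivative:
  fixes f :: "spacetime \<Rightarrow> 'a::real_normed_vector"
  assumes "(f has_derivative D) (at (x + s *\<^sub>R axis \<alpha> 1))"
  shows "((\<lambda>t. f (x + t *\<^sub>R axis \<alpha> 1)) has_vector_derivative D (axis \<alpha> 1)) (at s)"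
proof -
  have "((\<lambda>t. x + t *\<^sub>R axis \<alpha> 1) has_derivative (\<lambda>t. t *\<^sub>R axis \<alpha> 1)) (at s)"
    by (auto intro!: derivative_eq_intros)
  from diff_chain_at[OF this assms]
  have "((\<lambda>t. f (x + t *\<^sub>R axis \<alpha> 1)) has_derivative (\<lambda>t. D (t *\<^sub>R axis \<alpha> 1))) (at s)"
    by (simp add: o_def)
  moreover have "D (t *\<^sub>R axis \<alpha> 1) = t *\<^sub>R D (axis \<alpha> 1)" for t
    using has_derivative_linear[OF assms] by (rule linear_scale)
  ultimately show ?thesis by (simp add: has_vector_derivative_def)
qed

lemma partial_has_derivative:
  "(f has_derivative D) (at x) \<Longrightarrow> partial \<alpha> f x = D (axis \<alpha> 1)"
  using line_has_derivative[of f D x 0 \<alpha>] by (simp add: partial_def vector_derivative_at)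

lemma has_vector_derivative_partial:
  assumes "f differentiable (at x)"
  shows "((\<lambda>t. f (x + t *\<^sub>R axis \<alpha> 1)) has_vector_derivative partial \<alpha> f x) (at 0)"
proof -
  from assms obtain D where D: "(f has_derivative D) (at x)"
    by (auto simp: differentiable_def)
  show ?thesis
    using line_has_derivative[of f D x 0 \<alpha>] D by (simp add: partial_has_derivative[OF D])
qed

lemma partialI:
  "((\<lambda>t. f (x + t *\<^sub>R axis \<alpha> 1)) has_vector_derivative D) (at 0) \<Longrightarrow> partial \<alpha> f x = D"
  by (simp add: partial_def vector_derivative_at)

lemma partial_add:
  "f differentiable (at x) \<Longrightarrow> g differentiable (at x) \<Longrightarrow>
    partial \<alpha> (\<lambda>y. f y + g y) x = partial \<alpha> f x + partial \<alpha> g x"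
  by (rule partialI[OF has_vector_derivative_add[OF has_vector_derivative_partial has_vector_derivative_partial]])

lemma partial_sum:
  "(\<And>i. i \<in> I \<Longrightarrow> f i differentiable (at x)) \<Longrightarrow>
    partial \<alpha> (\<lambda>y. \<Sum>i\<in>I. f i y) x = (\<Sum>i\<in>I. partial \<alpha> (f i) x)"
  by (rule partialI[OF has_vector_derivative_sum[OF has_vector_derivative_partial]])

lemma partial_bounded_linear:
  assumes "bounded_linear L" and "f differentiable (at x)"
  shows "partial \<alpha> (\<lambda>y. L (f y)) x = L (partial \<alpha> f x)"
  by (rule partialI[OF bounded_linear.has_vector_derivative[OF assms(1) has_vector_derivative_partial[OF assms(2)]]])

lemma partial_mult:
  fixes f g :: "spacetime \<Rightarrow> real"
  assumes "f differentiable (at x)" and "g differentiable (at x)"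
  shows "partial \<alpha> (\<lambda>y. f y * g y) x = partial \<alpha> f x * g x + f x * partial \<alpha> g x"
  by (rule partialI)
    (use has_vector_derivative_mult[OF has_vector_derivative_partial[OF assms(1)]
          has_vector_derivative_partial[OF assms(2)], of \<alpha> \<alpha>] in \<open>simp add: add.commute\<close>)

lemma partial_cmult:
  fixes f :: "spacetime \<Rightarrow> real"
  shows "f differentiable (at x) \<Longrightarrow> partial \<alpha> (\<lambda>y. c * f y) x = c * partial \<alpha> f x"
  by (rule partial_bounded_linear) (simp_all add: bounded_linear_mult_right)

text \<open>For small parameters the line through x stays in U, so only the germ at x matters. This
  makes derivatives vanish off a compact support.\<close>

lemma partial_local:
  assumes "open U" and "x \<in> U" and "\<And>y. y \<in> U \<Longrightarrow> f y = g y"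
  shows "partial \<alpha> f x = partial \<alpha> g x"
proof -
  have "open ((\<lambda>t::real. x + t *\<^sub>R axis \<alpha> 1) -` U)"
    by (intro open_vimage continuous_intros assms)
  from eventually_nhds_in_open[OF this, of 0]
  have "\<forall>\<^sub>F t::real in nhds 0. x + t *\<^sub>R axis \<alpha> 1 \<in> U"
    using assms(2) by simp
  then have "\<forall>\<^sub>F t::real in nhds 0. f (x + t *\<^sub>R axis \<alpha> 1) = g (x + t *\<^sub>R axis \<alpha> 1)"
    by (rule eventually_mono) (rule assms(3))
  then have "((\<lambda>t. f (x + t *\<^sub>R axis \<alpha> 1)) has_vector_derivative D) (at (0::real))
      \<longleftrightarrow> ((\<lambda>t. g (x + t *\<^sub>R axis \<alpha> 1)) has_vector_derivative D) (at 0)" for D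
    by (intro has_vector_derivative_cong_ev refl)
      (auto elim!: eventually_mono dest: eventually_nhds_x_imp_x)
  then show ?thesis by (simp add: partial_def vector_derivative_def)
qed

section \<open>Closure properties of smooth fields\<close>

lemma smooth_differentiable: "smooth f \<Longrightarrow> f differentiable (at x)"
  unfolding smooth_def using differentiable_on_def by (metis UNIV_I foldr.simps(1) id_apply)

lemma smooth_partial:
  assumes "smooth f"
  shows "smooth (partial \<alpha> f)"
  unfolding smooth_def
proof
  fix \<alpha>s
  have "foldr partial (\<alpha>s @ [\<alpha>]) f differentiable_on UNIV"
    using assms unfolding smooth_def by blast
  then show "foldr partial \<alpha>s (partial \<alpha> f) differentiable_on UNIV" by simp
qed

lemma smooth_continuous: "smooth f \<Longrightarrow> continuous_on A f"
  using differentiable_imp_continuous_within smooth_differentiable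
  by (metis continuous_at_imp_continuous_on)

text \<open>\<open>smooth\<close> quantifies over all lists of directions. A set of differentiable
  functions that is closed under \<open>partial\<close> contains every iterated derivative of its
  members, so exhibiting such a set replaces an induction on lists.\<close>

lemma smooth_coinduct:
  assumes "f \<in> C" and "\<And>g x. g \<in> C \<Longrightarrow> g differentiable (at x)"
    and "\<And>g \<alpha>. g \<in> C \<Longrightarrow> partial \<alpha> g \<in> C"
  shows "smooth f"
proof -
  have "foldr partial \<alpha>s f \<in> C" for \<alpha>s
    by (induction \<alpha>s) (auto intro: assms)
  then show ?thesis
    using assms(2) by (auto simp: smooth_def differentiable_on_def)
qed

lemma smooth_add:
  fixes f g :: "spacetime \<Rightarrow> 'a::real_normed_vector"
  assumes "smooth f" and "smooth g"
  shows "smooth (\<lambda>x. f x + g x)"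
proof (rule smooth_coinduct)
  show "(\<lambda>x. f x + g x) \<in> {\<lambda>x. f x + g x | f g. smooth f \<and> smooth g}" using assms by blast
next
  fix h :: "spacetime \<Rightarrow> 'a" and \<alpha> assume "h \<in> {\<lambda>x. f x + g x | f g. smooth f \<and> smooth g}"
  then obtain f g where h: "h = (\<lambda>x. f x + g x)" "smooth f" "smooth g" by blast
  then have "partial \<alpha> h = (\<lambda>x. partial \<alpha> f x + partial \<alpha> g x)"
    by (auto simp: partial_add smooth_differentiable)
  then show "partial \<alpha> h \<in> {\<lambda>x. f x + g x | f g. smooth f \<and> smooth g}"
    using h smooth_partial by blast
next
  fix h :: "spacetime \<Rightarrow> 'a" and x assume "h \<in> {\<lambda>x. f x + g x | f g. smooth f \<and> smooth g}"
  then show "h differentiable (at x)"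
    using smooth_differentiable by (auto intro: differentiable_add)
qed

lemma smooth_bounded_linear:
  fixes L :: "'a::real_normed_vector \<Rightarrow> 'b::real_normed_vector"
  assumes "bounded_linear L" and "smooth f"
  shows "smooth (\<lambda>x. L (f x))"
proof (rule smooth_coinduct)
  show "(\<lambda>x. L (f x)) \<in> {\<lambda>x. L (f x) | f. smooth f}" using assms by blast
next
  fix h :: "spacetime \<Rightarrow> 'b" and \<alpha> assume "h \<in> {\<lambda>x. L (f x) | f. smooth f}"
  then obtain f where h: "h = (\<lambda>x. L (f x))" "smooth f" by blast
  then have "partial \<alpha> h = (\<lambda>x. L (partial \<alpha> f x))"
    by (auto simp: partial_bounded_linear[OF assms(1)] smooth_differentiable)
  then show "partial \<alpha> h \<in> {\<lambda>x. L (f x) | f. smooth f}"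
    using h smooth_partial by blast
next
  fix h :: "spacetime \<Rightarrow> 'b" and x assume "h \<in> {\<lambda>x. L (f x) | f. smooth f}"
  then show "h differentiable (at x)"
    using bounded_linear.has_derivative[OF assms(1)] smooth_differentiable
    unfolding differentiable_def by blast
qed

lemma bounded_linear_component2: "bounded_linear (\<lambda>A :: real ^ 4 ^ 4. A $ a $ b)"
  by (rule bounded_linear_compose[OF bounded_linear_vec_nth bounded_linear_vec_nth])

lemma smooth_component: "smooth S \<Longrightarrow> smooth (\<lambda>x. S x $ a $ b)"
  for S :: tensor_field
  by (rule smooth_bounded_linear[OF bounded_linear_component2])

lemma low_component: "low S x $ a $ b = eta a a * eta b b * S x $ a $ b"
  by (simp add: low_def sum_eta sum_distrib_left[symmetric] mult.assoc)

lemma mixed_component: "mixed S x $ a $ b = eta a a * S x $ a $ b"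
  by (simp add: mixed_def sum_eta)

lemma partial_up_eq: "partial_up a f x = eta a a *\<^sub>R partial a f x"
  by (simp add: partial_up_def sum_eta_scaleR)


lemma partial_low:
  assumes "smooth S"
  shows "partial m (\<lambda>y. low S y $ a $ b) x = eta a a * eta b b * partial m (\<lambda>y. S y $ a $ b) x"
  unfolding low_component
  by (rule partial_cmult) (rule smooth_differentiable[OF smooth_component[OF assms]])

section \<open>The Lagrangian of the gauge field\<close>

lemma NN_eq: "NN \<zeta> S a x = (\<Sum>e\<in>UNIV. (eta a a * S x $ a $ e) *\<^sub>R chiral_Theta \<zeta> e)"
  unfolding NN_def
  by (subst sum.swap) (simp add: sum_eta_scaleR chiral_Theta_def flip: scaleR_scaleR)

lemma partial_NN:
  assumes "smooth S"
  shows "partial m (NN \<zeta> S a) x = (\<Sum>e\<in>UNIV. (eta a a * partial m (\<lambda>y. S y $ a $ e) x) *\<^sub>R chiral_Theta \<zeta> e)"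
proof (rule partialI)
  note d = has_vector_derivative_partial[OF smooth_differentiable[OF smooth_component[OF assms]]]
  show "((\<lambda>t. NN \<zeta> S a (x + t *\<^sub>R axis m 1)) has_vector_derivative
      (\<Sum>e\<in>UNIV. (eta a a * partial m (\<lambda>y. S y $ a $ e) x) *\<^sub>R chiral_Theta \<zeta> e)) (at 0)"
    unfolding NN_eq
    by (intro has_vector_derivative_sum bounded_linear.has_vector_derivative[OF bounded_linear_scaleR_left] has_vector_derivative_mult_right d)
qed

lemma Omega_NN:
  assumes "smooth S"
  shows "Omega (NN \<zeta> S) a b x =
     (\<Sum>e\<in>UNIV. (eta b b * partial a (\<lambda>y. S y $ b $ e) x - eta a a * partial b (\<lambda>y. S y $ a $ e) x) *\<^sub>R chiral_Theta \<zeta> e)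
   + (\<Sum>e\<in>UNIV. \<Sum>f\<in>UNIV. (eta a a * eta b b * S x $ a $ e * S x $ b $ f) *\<^sub>R chiral_Theta_comm \<zeta> e f)"
proof -
  have m: "NN \<zeta> S a x ** NN \<zeta> S b x = (\<Sum>e\<in>UNIV. \<Sum>f\<in>UNIV. (eta a a * eta b b * S x $ a $ e * S x $ b $ f) *\<^sub>R
      (chiral_Theta \<zeta> e ** chiral_Theta \<zeta> f))" for a b
    unfolding NN_eq op_mult.sum_left op_mult.sum_right op_mult.scaleR_left op_mult.scaleR_right scaleR_sum_right scaleR_scaleR
    by (subst sum.swap) (simp add: mult_ac)
  \<comment> \<open>Renaming the summation indices gives both products the same coefficients, so
    that their difference is a combination of commutators.\<close>
  have "NN \<zeta> S b x ** NN \<zeta> S a x = (\<Sum>e\<in>UNIV. \<Sum>f\<in>UNIV. (eta a a * eta b b * S x $ a $ e * S x $ b $ f) *\<^sub>R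
      (chiral_Theta \<zeta> f ** chiral_Theta \<zeta> e))"
    unfolding m by (subst sum.swap) (simp add: mult_ac)
  then show ?thesis
    unfolding Omega_def partial_NN[OF assms] m
    by (simp add: chiral_Theta_comm_def scaleR_diff_left scaleR_diff_right sum_subtractf)
qed

lemma Omega_up_eq: "Omega_up \<theta> a b x = (eta a a * eta b b) *\<^sub>R Omega \<theta> a b x"
  unfolding Omega_up_def
  by (simp add: sum_eta_scaleR flip: scaleR_scaleR scaleR_sum_right)

text \<open>The density of the statement as an explicit polynomial in the upper components and their
  first derivatives, the form in which it is varied.\<close>

definition vector_lagrangian :: "real \<Rightarrow> tensor_field \<Rightarrow> spacetime \<Rightarrow> real" where
  "vector_lagrangian \<zeta> S x =
     64 * (cos (2 * \<zeta>))\<^sup>2 *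
       ((\<Sum>a\<in>UNIV. \<Sum>b\<in>UNIV. \<Sum>c\<in>UNIV. \<Sum>d\<in>UNIV. eta a a * eta b b * eta c c * eta d d *
           (S x $ a $ b * S x $ b $ c * S x $ c $ d * S x $ d $ a))
        - (\<Sum>a\<in>UNIV. \<Sum>b\<in>UNIV. eta a a * eta b b * (S x $ a $ b)\<^sup>2)\<^sup>2)
     - 32 * cos (2 * \<zeta>) *
       ((\<Sum>a\<in>UNIV. \<Sum>b\<in>UNIV. \<Sum>r\<in>UNIV. eta a a * eta b b * eta r r * (partial a (\<lambda>y. S y $ b $ r) x)\<^sup>2)
        - (\<Sum>a\<in>UNIV. \<Sum>b\<in>UNIV. \<Sum>r\<in>UNIV. eta r r * (partial a (\<lambda>y. S y $ b $ r) x * partial b (\<lambda>y. S y $ a $ r) x)))"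

lemma plus_cc_half: "plus_cc (1 / 2 * complex_of_real r) = complex_of_real r"
  by (simp add: plus_cc_def complex_eq_iff)

lemma L_V_NN:
  assumes "smooth S" and "sym_field S"
  shows "L_V (NN \<zeta> S) x = complex_of_real (vector_lagrangian \<zeta> S x)"
proof -
  define U where "U = (\<lambda>a b. S x $ a $ b)"
  define d where "d = (\<lambda>m a b. partial m (\<lambda>y. S y $ a $ b) x)"
  have U: "U a b = U b a" for a b using assms(2) by (simp add: U_def sym_field_def)
  define g where "g = (\<lambda>a. eta a a)"
  have g: "g a * g a = 1" "g a * (g a * z) = z" for a z by (simp_all add: g_def eta_sq eta_sq_left)
  define c where "c = cos (2 * \<zeta>)"
  let ?K = "\<Sum>a\<in>UNIV. \<Sum>b\<in>UNIV. \<Sum>e\<in>UNIV. g a * g b * g e * (g b * d a b e - g a * d b a e)\<^sup>2"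
  let ?Q = "\<Sum>a\<in>UNIV. \<Sum>b\<in>UNIV. \<Sum>e\<in>UNIV. \<Sum>f\<in>UNIV. g a * g b * g e * g f *
      ((U a e * U e b * U b f * U f a) - (U a e)\<^sup>2 * (U b f)\<^sup>2)"
  have "trace (Omega (NN \<zeta> S) a b x ** Omega_up (NN \<zeta> S) a b x) = complex_of_real (
      - 16 * c * (\<Sum>e\<in>UNIV. g a * g b * g e * (g b * d a b e - g a * d b a e)\<^sup>2)
      + 64 * c\<^sup>2 * (\<Sum>e\<in>UNIV. \<Sum>f\<in>UNIV. g a * g b * g e * g f *
         ((U a e * U e b * U b f * U f a) - (U a e)\<^sup>2 * (U b f)\<^sup>2)))" for a b
  proof -
    have "trace (Omega (NN \<zeta> S) a b x ** Omega_up (NN \<zeta> S) a b x) = complex_of_real (g a * g b *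
      (- 16 * c * (\<Sum>e\<in>UNIV. g e * (g b * d a b e - g a * d b a e)\<^sup>2)
       + 64 * c\<^sup>2 * (\<Sum>e\<in>UNIV. \<Sum>f\<in>UNIV. g e * g f *
          ((g a * g b * U a e * U b f) * (g a * g b * U a f * U b e) - (g a * g b * U a e * U b f)\<^sup>2))))"
      unfolding Omega_up_eq trace2.scaleR_right Omega_NN[OF assms(1)] trace_curvature
      by (simp only: g_def d_def c_def U_def scaleR_conv_of_real[where 'a=complex] of_real_mult)
    also have "g a * g b *
      (- 16 * c * (\<Sum>e\<in>UNIV. g e * (g b * d a b e - g a * d b a e)\<^sup>2)
       + 64 * c\<^sup>2 * (\<Sum>e\<in>UNIV. \<Sum>f\<in>UNIV. g e * g f *
          ((g a * g b * U a e * U b f) * (g a * g b * U a f * U b e) - (g a * g b * U a e * U b f)\<^sup>2)))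
      = - 16 * c * (\<Sum>e\<in>UNIV. g a * g b * g e * (g b * d a b e - g a * d b a e)\<^sup>2)
      + 64 * c\<^sup>2 * (\<Sum>e\<in>UNIV. \<Sum>f\<in>UNIV. g a * g b * g e * g f *
         ((U a e * U e b * U b f * U f a) - (U a e)\<^sup>2 * (U b f)\<^sup>2))"
    proof -
      \<comment> \<open>Symmetry of S turns the first product into the closed chain a, e, b, f, a,
        and the repeated signs square to 1.\<close>
      have "(g a * g b * U a e * U b f) * (g a * g b * U a f * U b e) - (g a * g b * U a e * U b f)\<^sup>2
        = (U a e * U e b * U b f * U f a) - (U a e)\<^sup>2 * (U b f)\<^sup>2" for e f
        by (simp add: U[of e b] U[of f a] power2_eq_square mult_ac g)
      then show ?thesis
        by (simp add: distrib_left sum_distrib_left mult_ac)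
    qed
    finally show ?thesis .
  qed
  then have "L_V (NN \<zeta> S) x = complex_of_real (- 16 * c * ?K + 64 * c\<^sup>2 * ?Q)"
    unfolding L_V_def linear_sum[OF linear_trace]
    by (simp only: of_real_sum[symmetric] plus_cc_half sum.distrib sum_distrib_left)
  also have "?Q = (\<Sum>a\<in>UNIV. \<Sum>b\<in>UNIV. \<Sum>c\<in>UNIV. \<Sum>d\<in>UNIV. g a * g b * g c * g d * (U a b * U b c * U c d * U d a))
     - (\<Sum>a\<in>UNIV. \<Sum>b\<in>UNIV. g a * g b * (U a b)\<^sup>2)\<^sup>2"
  proof -
    have "?Q = (\<Sum>a\<in>UNIV. \<Sum>b\<in>UNIV. \<Sum>e\<in>UNIV. \<Sum>f\<in>UNIV. g a * g b * g e * g f * (U a e * U e b * U b f * U f a))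
       - (\<Sum>a\<in>UNIV. \<Sum>b\<in>UNIV. \<Sum>e\<in>UNIV. \<Sum>f\<in>UNIV. (g a * g e * (U a e)\<^sup>2) * (g b * g f * (U b f)\<^sup>2))"
      by (simp add: right_diff_distrib sum_subtractf mult_ac)
    \<comment> \<open>The chain visits e before b, so exchanging these two sums puts the indices in
      cyclic order.\<close>
    also have "(\<Sum>a\<in>UNIV. \<Sum>b\<in>UNIV. \<Sum>e\<in>UNIV. \<Sum>f\<in>UNIV. g a * g b * g e * g f * (U a e * U e b * U b f * U f a))
       = (\<Sum>a\<in>UNIV. \<Sum>b\<in>UNIV. \<Sum>c\<in>UNIV. \<Sum>d\<in>UNIV. g a * g b * g c * g d * (U a b * U b c * U c d * U d a))"
      by (rule sum.cong[OF refl], subst sum.swap) (simp add: mult_ac)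
    also have "(\<Sum>a\<in>UNIV. \<Sum>b\<in>UNIV. \<Sum>e\<in>UNIV. \<Sum>f\<in>UNIV. (g a * g e * (U a e)\<^sup>2) * (g b * g f * (U b f)\<^sup>2))
       = (\<Sum>a\<in>UNIV. \<Sum>b\<in>UNIV. g a * g b * (U a b)\<^sup>2)\<^sup>2"
      unfolding power2_eq_square[of "sum _ _"] by (simp only: sum_product)
    finally show ?thesis .
  qed
  \<comment> \<open>The two pure squares agree after exchanging a and b; the resulting factor 2
    turns the -16 of the trace into the -32 of the statement.\<close>
  also have "?K = 2 * ((\<Sum>a\<in>UNIV. \<Sum>b\<in>UNIV. \<Sum>r\<in>UNIV. g a * g b * g r * (d a b r)\<^sup>2)
        - (\<Sum>a\<in>UNIV. \<Sum>b\<in>UNIV. \<Sum>r\<in>UNIV. g r * (d a b r * d b a r)))"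
  proof -
    have "g a * g b * g e * (g b * d a b e - g a * d b a e)\<^sup>2 =
       g a * g b * g e * (d a b e)\<^sup>2 + g b * g a * g e * (d b a e)\<^sup>2 - 2 * (g e * (d a b e * d b a e))" for a b e
      by (simp add: power2_eq_square algebra_simps g)
    then have "?K = (\<Sum>a\<in>UNIV. \<Sum>b\<in>UNIV. \<Sum>r\<in>UNIV. g a * g b * g r * (d a b r)\<^sup>2)
        + (\<Sum>a\<in>UNIV. \<Sum>b\<in>UNIV. \<Sum>r\<in>UNIV. g b * g a * g r * (d b a r)\<^sup>2)
        - 2 * (\<Sum>a\<in>UNIV. \<Sum>b\<in>UNIV. \<Sum>r\<in>UNIV. g r * (d a b r * d b a r))"
      by (simp only: sum.distrib sum_subtractf sum_distrib_left)
    also have "(\<Sum>a\<in>UNIV. \<Sum>b\<in>UNIV. \<Sum>r\<in>UNIV. g b * g a * g r * (d b a r)\<^sup>2)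
       = (\<Sum>a\<in>UNIV. \<Sum>b\<in>UNIV. \<Sum>r\<in>UNIV. g a * g b * g r * (d a b r)\<^sup>2)"
      by (rule sum.swap)
    finally show ?thesis by simp
  qed
  finally show ?thesis
    by (simp add: vector_lagrangian_def U_def d_def g_def c_def)
qed

lemma vector_lagrangian_eq:
  assumes "smooth S"
  shows "vector_lagrangian \<zeta> S x =
    64 * (cos (2 * \<zeta>))\<^sup>2 *
          ((\<Sum>\<alpha>\<in>UNIV. \<Sum>\<beta>\<in>UNIV. \<Sum>\<rho>\<in>UNIV. \<Sum>\<sigma>\<in>UNIV.
              S x $ \<alpha> $ \<beta> * low S x $ \<beta> $ \<rho> * S x $ \<rho> $ \<sigma> * low S x $ \<sigma> $ \<alpha>)
           - (\<Sum>\<alpha>\<in>UNIV. \<Sum>\<beta>\<in>UNIV. S x $ \<alpha> $ \<beta> * low S x $ \<alpha> $ \<beta>)\<^sup>2)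
        - 32 * cos (2 * \<zeta>) *
          ((\<Sum>\<alpha>\<in>UNIV. \<Sum>\<beta>\<in>UNIV. \<Sum>\<rho>\<in>UNIV.
              partial \<alpha> (\<lambda>y. S y $ \<beta> $ \<rho>) x * partial_up \<alpha> (\<lambda>y. low S y $ \<beta> $ \<rho>) x)
           - (\<Sum>\<alpha>\<in>UNIV. \<Sum>\<beta>\<in>UNIV. \<Sum>\<rho>\<in>UNIV.
              partial_up \<alpha> (\<lambda>y. S y $ \<beta> $ \<rho>) x * partial \<beta> (\<lambda>y. low S y $ \<alpha> $ \<rho>) x))"
  unfolding vector_lagrangian_def partial_up_eq partial_low[OF assms] unfolding low_component
  by (simp add: mult_ac power2_eq_square eta_sq_left)

section \<open>The extended metric and the source term\<close>

text \<open>The metric is diagonal, so a permutation contributes to the Leibniz sum only if it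
  matches the two sorted lists entry by entry. For I = J this leaves the identity, for different
  sets nothing.\<close>

lemma hat_eta_entry:
  "hat_eta $ I $ J = (if I = J then complex_of_real (\<Prod>i\<in>I. eta i i) else 0)"
proof (cases "card I = card J")
  case False
  then show ?thesis by (auto simp: hat_eta_def)
next
  case True
  define n where "n = card I"
  define a b where "a = sorted_list_of_set I" and "b = sorted_list_of_set J"
  have a: "set a = I" "distinct a" "length a = n" and b: "set b = J" "distinct b" "length b = n"
    using True by (simp_all add: a_def b_def n_def)
  have entry: "hat_eta $ I $ J = complex_of_real (\<Sum>p | p permutes {..<n}. of_int (sign p) *
      (\<Prod>i<n. eta (a ! i) (b ! p i)))"
    using True by (simp add: hat_eta_def a_def b_def n_def)
  show ?thesis
  proof (cases "I = J")
    case False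
    have "(\<Prod>i<n. eta (a ! i) (b ! p i)) = 0" if p: "p permutes {..<n}" for p
    proof -
      have "\<exists>i<n. a ! i \<noteq> b ! p i"
      proof (rule ccontr)
        assume "\<not> (\<exists>i<n. a ! i \<noteq> b ! p i)"
        then have "I \<subseteq> J"
          using a b permutes_in_image[OF p] by (metis in_set_conv_nth lessThan_iff nth_mem subsetI)
        then show False using True False card_subset_eq[of J I] by simp
      qed
      then obtain i where "i < n" "a ! i \<noteq> b ! p i" by blast
      then show ?thesis by (intro prod_zero bexI[of _ i]) (auto simp: eta_def)
    qed
    then have "(\<Sum>p | p permutes {..<n}. of_int (sign p) * (\<Prod>i<n. eta (a ! i) (b ! p i))) = 0"
      by (intro sum.neutral) (simp del: prod_zero_iff of_real_prod)
    then show ?thesis unfolding entry using False by simp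
  next
    case IJ: True
    have "(\<Prod>i<n. eta (a ! i) (b ! p i)) = (if p = id then \<Prod>i\<in>I. eta i i else 0)"
      if p: "p permutes {..<n}" for p
    proof (cases "p = id")
      case True
      have "(\<Prod>i<n. eta (a ! i) (a ! i)) = (\<Prod>i\<in>I. eta i i)"
        using prod.reindex_bij_betw[OF bij_betw_nth[OF a(2) refl refl], of "\<lambda>i. eta i i"] a by simp
      then show ?thesis using True IJ by (simp add: a_def b_def)
    next
      case False
      then obtain i where i: "p i \<noteq> i" by (auto simp: fun_eq_iff)
      then have "i < n" "p i < n" using p permutes_in_image[OF p, of i] by (auto simp: permutes_def)
      then have "a ! i \<noteq> b ! p i" using i a IJ by (auto simp: a_def b_def nth_eq_iff_index_eq)
      then have "(\<Prod>i<n. eta (a ! i) (b ! p i)) = 0"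
        using \<open>i < n\<close> IJ by (intro prod_zero bexI[of _ i]) (auto simp: eta_def a_def b_def)
      then show ?thesis using False by simp
    qed
    then have "(\<Sum>p | p permutes {..<n}. of_int (sign p) * (\<Prod>i<n. eta (a ! i) (b ! p i)))
        = (\<Sum>p | p permutes {..<n}. if p = id then \<Prod>i\<in>I. eta i i else 0)"
      by (intro sum.cong refl) auto
    also have "\<dots> = (\<Prod>i\<in>I. eta i i)"
      by (subst sum.delta) (auto simp: finite_permutations)
    finally show ?thesis unfolding entry using IJ by simp
  qed
qed

section \<open>The indefinite Hermitian form and adjoints with respect to it\<close>

definition hat_form :: "ext \<Rightarrow> ext \<Rightarrow> complex" where
  "hat_form u v = dagger_dot u (hat_eta *v v)"

lemma hat_form_eq: "hat_form u v = (\<Sum>I\<in>UNIV. cnj (u $ I) * complex_of_real (\<Prod>i\<in>I. eta i i) * v $ I)"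
  by (simp add: hat_form_def dagger_dot_def matrix_vector_mult_def hat_eta_entry if_distrib if_distribR
      mult.assoc cong: if_cong)

lemma hat_form_cnj: "cnj (hat_form u v) = hat_form v u"
  by (simp add: hat_form_eq mult_ac)

lemma hat_form_right:
  "hat_form u (v + w) = hat_form u v + hat_form u w"
  "hat_form u (v - w) = hat_form u v - hat_form u w"
  "hat_form u (c *s v) = c * hat_form u v"
  "hat_form u (r *\<^sub>R v) = complex_of_real r * hat_form u v"
  "hat_form u (- v) = - hat_form u v"
  unfolding hat_form_eq vector_scaleR_component
  by (simp_all add: scaleR_conv_of_real[where 'a=complex] sum_distrib_left mult_ac
      flip: sum.distrib sum_subtractf sum_negf distrib_left right_diff_distrib)
     (simp_all add: algebra_simps)

lemma hat_form_left:
  "hat_form (v + w) u = hat_form v u + hat_form w u"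
  "hat_form (v - w) u = hat_form v u - hat_form w u"
  "hat_form (c *s v) u = cnj c * hat_form v u"
  "hat_form (- v) u = - hat_form v u"
  by (simp_all add: hat_form_cnj[of u, symmetric] hat_form_right)

lemma hat_form_sum: "hat_form u (\<Sum>i\<in>A. f i) = (\<Sum>i\<in>A. hat_form u (f i))"
  unfolding hat_form_eq sum_component sum_distrib_left by (rule sum.swap)

text \<open>The assumption is the entrywise form of: \<open>hat_eta ** A\<close> equals the
  conjugate transpose of B times \<open>hat_eta\<close>.\<close>

lemma hat_form_adjoint:
  assumes "\<And>I J. complex_of_real (\<Prod>i\<in>I. eta i i) * A $ I $ J = cnj (B $ J $ I) * complex_of_real (\<Prod>i\<in>J. eta i i)"
  shows "hat_form u (A *v v) = hat_form (B *v u) v"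
proof -
  have "hat_form u (A *v v) = (\<Sum>I\<in>UNIV. \<Sum>J\<in>UNIV. cnj (u $ I) * (complex_of_real (\<Prod>i\<in>I. eta i i) * A $ I $ J) * v $ J)"
    by (simp add: hat_form_eq matrix_vector_mult_def sum_distrib_left mult.assoc)
  also have "\<dots> = (\<Sum>J\<in>UNIV. \<Sum>I\<in>UNIV. cnj (u $ I) * (complex_of_real (\<Prod>i\<in>I. eta i i) * A $ I $ J) * v $ J)"
    by (rule sum.swap)
  also have "\<dots> = hat_form (B *v u) v"
    unfolding assms by (simp add: hat_form_eq matrix_vector_mult_def sum_distrib_left sum_distrib_right mult_ac)
  finally show ?thesis .
qed

text \<open>Both matrices have nonzero entries only where I is J with a adjoined. The sign
  \<open>eta a a\<close> carried by the contraction is the factor by which the diagonal entries of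
  the form at I and J differ.\<close>

lemma wedge_op_adjoint: "hat_form u (wedge_op a *v v) = hat_form (iota a *v u) v"
proof (rule hat_form_adjoint)
  fix I J
  have w: "wedge_op a $ I $ J = (if a \<notin> J \<and> I = insert a J then (- 1) ^ below a J else 0)"
    unfolding op_eb_nth[symmetric] wedge_op_eb by (simp add: axis_def)
  have i: "iota a $ J $ I = (if a \<in> I \<and> J = I - {a} then complex_of_real (eta a a) * (- 1) ^ below a I else 0)"
    unfolding op_eb_nth[symmetric] iota_eb by (simp add: axis_def)
  have e: "a \<notin> J \<and> I = insert a J \<longleftrightarrow> a \<in> I \<and> J = I - {a}" by auto
  show "complex_of_real (\<Prod>i\<in>I. eta i i) * wedge_op a $ I $ J = cnj (iota a $ J $ I) * complex_of_real (\<Prod>i\<in>J. eta i i)"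
  proof (cases "a \<notin> J \<and> I = insert a J")
    case True
    then have "below a I = below a J" by (simp add: below_insert)
    moreover have "(\<Prod>i\<in>I. eta i i) = eta a a * (\<Prod>i\<in>J. eta i i)" using True by simp
    moreover have "wedge_op a $ I $ J = (- 1) ^ below a J" unfolding w using True by simp
    moreover have "iota a $ J $ I = complex_of_real (eta a a) * (- 1) ^ below a I"
      unfolding i using True by auto
    ultimately show ?thesis by simp
  next
    case False
    then have "wedge_op a $ I $ J = 0" "iota a $ J $ I = 0"
      by (simp_all only: w i e[symmetric] if_False)
    then show ?thesis by simp
  qed
qed

lemma iota_adjoint: "hat_form u (iota a *v v) = hat_form (wedge_op a *v u) v"
  by (metis hat_form_cnj wedge_op_adjoint)

lemma parity_op_adjoint: "hat_form u (parity_op *v v) = hat_form (parity_op *v u) v"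
  by (rule hat_form_adjoint) (auto simp: parity_op_def)

lemma gamma_adjoint: "hat_form u (gamma a *v v) = - hat_form (gamma a *v u) v"
  by (simp add: gamma_eq op_mult_simps hat_form_right hat_form_left wedge_op_adjoint iota_adjoint)

text \<open>The sum of wedge and contraction is self-adjoint, and so is parity; taking the adjoint
  only reverses their order, and moving parity back past an operator of odd degree gives the
  sign.\<close>

lemma Theta_adjoint: "hat_form u (Theta {a} *v v) = - hat_form (Theta {a} *v u) v"
proof -
  have p: "parity_op *v (wedge_op a *v w) = - (wedge_op a *v (parity_op *v w))"
    "parity_op *v (iota a *v w) = - (iota a *v (parity_op *v w))" for w
    using arg_cong[OF parity_ops(1)[of a], of "\<lambda>A. A *v w"] arg_cong[OF parity_ops(2)[of a], of "\<lambda>A. A *v w"]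
    by (simp_all add: op_mult_simps)
  show ?thesis
    by (simp add: Theta_single op_mult_simps hat_form_right hat_form_left wedge_op_adjoint iota_adjoint
        parity_op_adjoint p)
qed

lemma JJ_adjoint: "hat_form u (JJ *v v) = hat_form (JJ *v u) v"
  by (subst JJ_rev) (simp add: JJ_eq op_mult_simps Theta_adjoint)

lemma gamma_chiral: "gamma a *v (chiral \<zeta> *v v) = chiral \<zeta> *v (gamma a *v v)"
  using JJ_commutant by (simp add: chiral_vec matrix_vector_right_distrib op_mult_simps gamma_commutant_iff)

lemma gamma_Theta: "gamma a *v (Theta I *v v) = Theta I *v (gamma a *v v)"
  using Theta_commutant by (simp add: gamma_commutant_iff)

text \<open>The operator is self-adjoint: taking adjoints conjugates i sin \<zeta>, which is undone
  by the sign of J passing \<open>Theta {b}\<close> when the order of the factors is restored, while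
  the signs of \<open>gamma a\<close> and \<open>Theta {b}\<close> cancel each other.\<close>

lemma source_real:
  "hat_form u (chiral \<zeta> *v (gamma a *v (Theta {b} *v u))) \<in> \<real>"
proof -
  have "hat_form u (chiral \<zeta> *v (gamma a *v (Theta {b} *v u))) = hat_form (chiral \<zeta> *v (gamma a *v (Theta {b} *v u))) u"
    using JJ_commutant unfolding gamma_commutant_iff
    by (simp add: chiral_vec hat_form_right hat_form_left JJ_adjoint gamma_adjoint Theta_adjoint gamma_Theta
        JJ_Theta vec.neg)
  then have "cnj (hat_form u (chiral \<zeta> *v (gamma a *v (Theta {b} *v u)))) = hat_form u (chiral \<zeta> *v (gamma a *v (Theta {b} *v u)))"
    by (metis hat_form_cnj)
  then show ?thesis by (simp add: Reals_cnj_iff)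
qed

section \<open>The spinor Lagrangian as an affine function of S\<close>

definition source :: "real \<Rightarrow> (spacetime \<Rightarrow> ext) \<Rightarrow> 4 \<Rightarrow> 4 \<Rightarrow> spacetime \<Rightarrow> real" where
  "source \<zeta> \<psi> a b x = Re (hat_form (\<psi> x) (chiral \<zeta> *v (gamma a *v (Theta {b} *v \<psi> x))))"

lemma source_eq:
  "complex_of_real (source \<zeta> \<psi> a b x) = hat_form (\<psi> x) (chiral \<zeta> *v (gamma a *v (Theta {b} *v \<psi> x)))"
  using source_real by (simp add: source_def)

definition free_lagrangian :: "real \<Rightarrow> (spacetime \<Rightarrow> ext) \<Rightarrow> spacetime \<Rightarrow> real" where
  "free_lagrangian m \<psi> x =
     Re (hat_form (\<psi> x) (\<Sum>a\<in>UNIV. gamma_up a *v partial a \<psi> x)) - m * Re (hat_form (\<psi> x) (\<psi> x))"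

lemma bounded_linear_op: "bounded_linear ((*v) (A :: ext_op))"
  unfolding linear_conv_bounded_linear[symmetric]
  by (rule linearI) (simp_all add: vec_eq_iff matrix_vector_mult_def scaleR_sum_right algebra_simps sum.distrib)

lemma op_vec_scaleR_left: "(r *\<^sub>R A) *v v = r *\<^sub>R (A *v v)" for A :: ext_op
  by (simp add: vec_eq_iff matrix_vector_mult_def scaleR_sum_right)

lemma op_vec_sum_left: "(\<Sum>i\<in>I. f i) *v v = (\<Sum>i\<in>I. f i *v v)" for f :: "'i \<Rightarrow> ext_op"
  unfolding vec_eq_iff matrix_vector_mult_def vec_lambda_beta sum_component sum_distrib_right
  by (intro allI sum.swap)

lemma gamma_up_vec: "gamma_up a *v v = eta a a *\<^sub>R (gamma a *v v)"
  by (simp add: gamma_up_def sum_eta_scaleR op_vec_scaleR_left)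

text \<open>The sign from \<open>gamma_up\<close> cancels the one that lowers the first index of S
  in \<open>NN\<close>, and the chiral factor moves to the front because it commutes with the gamma
  matrices.\<close>

lemma Dirac_NN:
  "Dirac (NN \<zeta> S) \<psi> x = (\<Sum>a\<in>UNIV. gamma_up a *v partial a \<psi> x) +
     (\<Sum>a\<in>UNIV. \<Sum>b\<in>UNIV. S x $ a $ b *\<^sub>R (chiral \<zeta> *v (gamma a *v (Theta {b} *v \<psi> x))))"
proof -
  have "gamma_up a *v (NN \<zeta> S a x *v v) = (\<Sum>b\<in>UNIV. S x $ a $ b *\<^sub>R (chiral \<zeta> *v (gamma a *v (Theta {b} *v v))))" for a v
    by (simp add: gamma_up_vec NN_eq op_vec_sum_left op_vec_scaleR_left chiral_Theta_vec gamma_chiral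
        linear_sum[OF bounded_linear.linear[OF bounded_linear_op]]
        linear_scale[OF bounded_linear.linear[OF bounded_linear_op]]
        scaleR_sum_right eta_sq_left mult.commute[of _ "eta a a"])
  then show ?thesis
    by (simp add: Dirac_def matrix_vector_right_distrib sum.distrib)
qed

lemma plus_cc_half_Re: "plus_cc (1 / 2 * z) = complex_of_real (Re z)"
  by (simp add: plus_cc_def complex_eq_iff)

lemma L_K_NN:
  "L_K m (NN \<zeta> S) \<psi> x = complex_of_real (free_lagrangian m \<psi> x + (\<Sum>a\<in>UNIV. \<Sum>b\<in>UNIV. S x $ a $ b * source \<zeta> \<psi> a b x))"
proof -
  have "hat_form (\<psi> x) (\<psi> x) = complex_of_real (Re (hat_form (\<psi> x) (\<psi> x)))"
    using hat_form_cnj[of "\<psi> x" "\<psi> x"] by (simp add: Reals_cnj_iff flip: Reals_cnj_iff)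
  then have "L_K m (NN \<zeta> S) \<psi> x = complex_of_real (Re (hat_form (\<psi> x) (Dirac (NN \<zeta> S) \<psi> x)) - m * Re (hat_form (\<psi> x) (\<psi> x)))"
    unfolding L_K_def plus_cc_half_Re hat_form_def[symmetric] by simp
  also have "Re (hat_form (\<psi> x) (Dirac (NN \<zeta> S) \<psi> x)) = Re (hat_form (\<psi> x) (\<Sum>a\<in>UNIV. gamma_up a *v partial a \<psi> x))
      + (\<Sum>a\<in>UNIV. \<Sum>b\<in>UNIV. S x $ a $ b * source \<zeta> \<psi> a b x)"
    by (simp add: Dirac_NN hat_form_right hat_form_sum source_def)
  finally show ?thesis by (simp add: free_lagrangian_def)
qed

lemma total_L_eq:
  assumes "smooth S" and "sym_field S"
  shows "total_L m \<tau> \<zeta> \<psi> S x = complex_of_real (free_lagrangian m \<psi> x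
     + (\<Sum>a\<in>UNIV. \<Sum>b\<in>UNIV. S x $ a $ b * source \<zeta> \<psi> a b x) - \<tau> * vector_lagrangian \<zeta> S x)"
  by (simp add: total_L_def L_K_NN L_V_NN[OF assms])

lemma continuous_hat_form:
  "continuous_on A u \<Longrightarrow> continuous_on A v \<Longrightarrow> continuous_on A (\<lambda>x. hat_form (u x) (v x))"
  unfolding hat_form_eq by (intro continuous_intros)

lemma continuous_op_vec: "continuous_on A v \<Longrightarrow> continuous_on A (\<lambda>x. (M :: ext_op) *v v x)"
  by (rule bounded_linear.continuous_on[OF bounded_linear_op])

lemma continuous_source: "smooth \<psi> \<Longrightarrow> continuous_on A (source \<zeta> \<psi> a b)"
  unfolding source_def
  by (intro continuous_intros continuous_hat_form continuous_op_vec smooth_continuous)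

lemma continuous_free_lagrangian: "smooth \<psi> \<Longrightarrow> continuous_on A (free_lagrangian m \<psi>)"
  unfolding free_lagrangian_def
  by (intro continuous_intros continuous_hat_form continuous_op_vec smooth_continuous smooth_partial)

section \<open>Commuting partial derivatives and integration by parts\<close>

lemma line_has_real_derivative:
  fixes f :: "spacetime \<Rightarrow> real"
  assumes "f differentiable (at (x + s *\<^sub>R axis \<alpha> 1))"
  shows "((\<lambda>t. f (x + t *\<^sub>R axis \<alpha> 1)) has_real_derivative partial \<alpha> f (x + s *\<^sub>R axis \<alpha> 1)) (at s)"
  using assms line_has_derivative partial_has_derivative
  unfolding differentiable_def has_real_derivative_iff_has_vector_derivative by metis

lemma partial_mean_value:
  fixes f :: "spacetime \<Rightarrow> real"
  assumes "\<And>y. f differentiable (at y)" and "0 < h"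
  obtains s where "0 < s" "s < h" "f (x + h *\<^sub>R axis \<alpha> 1) - f x = h * partial \<alpha> f (x + s *\<^sub>R axis \<alpha> 1)"
  using MVT2[OF assms(2) line_has_real_derivative[OF assms(1)], of x \<alpha>] by auto

lemma tendsto_seq_of_norm_le:
  fixes p :: "nat \<Rightarrow> 'a::real_normed_vector"
  assumes "\<And>n. norm (p n - x) \<le> C / real (Suc n)"
  shows "p \<longlonglongrightarrow> x"
proof -
  have "(\<lambda>n. C / real (Suc n)) \<longlonglongrightarrow> 0"
    using tendsto_mult[OF tendsto_const LIMSEQ_inverse_real_of_nat, of C] by (simp add: divide_inverse)
  then have "(\<lambda>n. p n - x) \<longlonglongrightarrow> 0"
    by (rule Lim_null_comparison[rotated]) (use assms in auto)
  then show ?thesis by (simp add: LIM_zero_iff)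
qed

text \<open>The second difference is symmetric in the two directions, so this yields both orders of
  differentiation near \<open>x\<close>.\<close>

lemma second_difference:
  fixes f :: "spacetime \<Rightarrow> real"
  assumes "smooth f" and "0 < h"
  obtains p where "norm (p - x) \<le> 2 * h"
    "f (x + h *\<^sub>R axis \<alpha> 1 + h *\<^sub>R axis \<beta> 1) - f (x + h *\<^sub>R axis \<alpha> 1) - f (x + h *\<^sub>R axis \<beta> 1) + f x
     = h * h * partial \<beta> (partial \<alpha> f) p"
proof -
  \<comment> \<open>The first difference in direction \<beta>, written with a factor -1 so that
    \<open>partial_add\<close> and \<open>partial_cmult\<close> apply. The mean value theorem is
    used along \<alpha> for it, then along \<beta> for \<open>partial \<alpha> f\<close>.\<close>
  let ?g = "\<lambda>y. f (y + h *\<^sub>R axis \<beta> 1) + (- 1) * f y"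
  have sh: "(\<lambda>y. f (y + h *\<^sub>R axis \<beta> 1)) differentiable (at y)" for y
    by (rule differentiable_compose[where g = "\<lambda>y. y + h *\<^sub>R axis \<beta> 1"])
      (auto intro: smooth_differentiable[OF assms(1)] derivative_intros)
  have "partial \<alpha> (\<lambda>y. f (y + h *\<^sub>R axis \<beta> 1)) y = partial \<alpha> f (y + h *\<^sub>R axis \<beta> 1)" for y
    by (simp add: partial_def add_ac)
  then have pg: "partial \<alpha> ?g y = partial \<alpha> f (y + h *\<^sub>R axis \<beta> 1) - partial \<alpha> f y" for y
    by (subst partial_add) (auto intro!: sh smooth_differentiable[OF assms(1)] derivative_intros
        simp: partial_cmult[of f y \<alpha> "- 1", simplified] smooth_differentiable[OF assms(1)])
  have "?g differentiable (at y)" for y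
    by (intro derivative_intros sh smooth_differentiable[OF assms(1)])
  then obtain s where s: "0 < s" "s < h"
    "?g (x + h *\<^sub>R axis \<alpha> 1) - ?g x = h * partial \<alpha> ?g (x + s *\<^sub>R axis \<alpha> 1)"
    using partial_mean_value[OF _ assms(2), of ?g x \<alpha>] by blast
  obtain t where t: "0 < t" "t < h"
    "partial \<alpha> f ((x + s *\<^sub>R axis \<alpha> 1) + h *\<^sub>R axis \<beta> 1) - partial \<alpha> f (x + s *\<^sub>R axis \<alpha> 1)
     = h * partial \<beta> (partial \<alpha> f) ((x + s *\<^sub>R axis \<alpha> 1) + t *\<^sub>R axis \<beta> 1)"
    using partial_mean_value[OF smooth_differentiable[OF smooth_partial[OF assms(1)]] assms(2)] by blast
  show ?thesis
  proof (rule that[of "(x + s *\<^sub>R axis \<alpha> 1) + t *\<^sub>R axis \<beta> 1"])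
    show "norm (x + s *\<^sub>R axis \<alpha> 1 + t *\<^sub>R axis \<beta> 1 - x) \<le> 2 * h"
      using norm_triangle_ineq[of "s *\<^sub>R axis \<alpha> (1::real)" "t *\<^sub>R axis \<beta> 1"] s t by (simp add: norm_axis_1)
    have "f (x + h *\<^sub>R axis \<alpha> 1 + h *\<^sub>R axis \<beta> 1) - f (x + h *\<^sub>R axis \<alpha> 1) - f (x + h *\<^sub>R axis \<beta> 1) + f x
       = ?g (x + h *\<^sub>R axis \<alpha> 1) - ?g x" by simp
    also have "\<dots> = h * (h * partial \<beta> (partial \<alpha> f) (x + s *\<^sub>R axis \<alpha> 1 + t *\<^sub>R axis \<beta> 1))"
      unfolding s(3) pg t(3) ..
    finally show "f (x + h *\<^sub>R axis \<alpha> 1 + h *\<^sub>R axis \<beta> 1) - f (x + h *\<^sub>R axis \<alpha> 1) - f (x + h *\<^sub>R axis \<beta> 1) + f x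
       = h * h * partial \<beta> (partial \<alpha> f) (x + s *\<^sub>R axis \<alpha> 1 + t *\<^sub>R axis \<beta> 1)" by simp
  qed
qed

text \<open>One second difference, divided by h^2, equals each mixed derivative at some point within
  2 h of x; continuity carries the equality to x as h tends to 0.\<close>

lemma partial_commute:
  fixes f :: "spacetime \<Rightarrow> real"
  assumes "smooth f"
  shows "partial \<alpha> (partial \<beta> f) x = partial \<beta> (partial \<alpha> f) x"
proof -
  define h where "h = (\<lambda>n. 1 / real (Suc n))"
  have h: "0 < h n" for n by (simp add: h_def)
  have "\<exists>p q. norm (p - x) \<le> 2 / real (Suc n) \<and> norm (q - x) \<le> 2 / real (Suc n) \<and>
      partial \<beta> (partial \<alpha> f) p = partial \<alpha> (partial \<beta> f) q" for n
  proof -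
    obtain p where p: "norm (p - x) \<le> 2 * h n"
      "f (x + h n *\<^sub>R axis \<alpha> 1 + h n *\<^sub>R axis \<beta> 1) - f (x + h n *\<^sub>R axis \<alpha> 1) - f (x + h n *\<^sub>R axis \<beta> 1) + f x
       = h n * h n * partial \<beta> (partial \<alpha> f) p"
      using second_difference[OF assms h] .
    obtain q where q: "norm (q - x) \<le> 2 * h n"
      "f (x + h n *\<^sub>R axis \<beta> 1 + h n *\<^sub>R axis \<alpha> 1) - f (x + h n *\<^sub>R axis \<beta> 1) - f (x + h n *\<^sub>R axis \<alpha> 1) + f x
       = h n * h n * partial \<alpha> (partial \<beta> f) q"
      using second_difference[OF assms h] .
    have swap: "x + h n *\<^sub>R axis \<beta> 1 + h n *\<^sub>R axis \<alpha> 1 = x + h n *\<^sub>R axis \<alpha> 1 + h n *\<^sub>R axis \<beta> 1"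
      by (simp add: add_ac)
    have "h n * h n * partial \<beta> (partial \<alpha> f) p = h n * h n * partial \<alpha> (partial \<beta> f) q"
      using p(2) q(2)[unfolded swap] by linarith
    then have "partial \<beta> (partial \<alpha> f) p = partial \<alpha> (partial \<beta> f) q"
      using h[of n] by simp
    then show ?thesis using p(1) q(1) by (auto simp: h_def)
  qed
  then obtain p q where pq: "\<And>n. norm (p n - x) \<le> 2 / real (Suc n)" "\<And>n. norm (q n - x) \<le> 2 / real (Suc n)"
      "\<And>n. partial \<beta> (partial \<alpha> f) (p n) = partial \<alpha> (partial \<beta> f) (q n)"
    by metis
  have c: "isCont (partial a (partial b f)) x" for a b
    using smooth_continuous[OF smooth_partial[OF smooth_partial[OF assms]], of UNIV]
    by (simp add: continuous_on_eq_continuous_at)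
  have "(\<lambda>n. partial \<beta> (partial \<alpha> f) (p n)) \<longlonglongrightarrow> partial \<beta> (partial \<alpha> f) x"
    by (rule isCont_tendsto_compose[OF c tendsto_seq_of_norm_le[OF pq(1)]])
  moreover have "(\<lambda>n. partial \<alpha> (partial \<beta> f) (q n)) \<longlonglongrightarrow> partial \<alpha> (partial \<beta> f) x"
    by (rule isCont_tendsto_compose[OF c tendsto_seq_of_norm_le[OF pq(2)]])
  ultimately show ?thesis unfolding pq(3) by (rule LIMSEQ_unique[symmetric])
qed

lemma partial_const: "partial \<alpha> (\<lambda>y. c) x = 0"
  by (rule partialI) simp

lemma partial_outside_support:
  assumes "compact K" and "\<And>y. y \<notin> K \<Longrightarrow> f y = 0" and "x \<notin> K"
  shows "partial \<alpha> f x = 0"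
proof -
  have "partial \<alpha> f x = partial \<alpha> (\<lambda>y. 0) x"
    by (rule partial_local[of "- K"]) (use assms compact_imp_closed in auto)
  then show ?thesis by (simp add: partial_const)
qed

lemma compact_support_integrable:
  fixes f :: "spacetime \<Rightarrow> real"
  assumes "continuous_on UNIV f" and "compact K" and "\<And>y. y \<notin> K \<Longrightarrow> f y = 0"
  shows "integrable lborel f"
proof -
  have "integrable lborel (\<lambda>x. indicator K x *\<^sub>R f x)"
    using assms by (intro borel_integrable_compact continuous_on_subset[OF assms(1)]) auto
  also have "(\<lambda>x. indicator K x *\<^sub>R f x) = f"
    using assms(3) by (auto simp: fun_eq_iff indicator_def)
  finally show ?thesis .
qed

lemma integral_translate:
  fixes f :: "spacetime \<Rightarrow> real"
  assumes "f \<in> borel_measurable borel"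
  shows "integral\<^sup>L lborel (\<lambda>x. f (x + c)) = integral\<^sup>L lborel f"
  using integral_distr[of "(+) c" lborel borel f] assms
  by (simp add: lborel_distr_plus add.commute)

text \<open>The integral of the difference quotients vanishes by translation invariance, and they
  converge dominatedly to the partial derivative.\<close>

lemma integral_partial_compact_support:
  fixes V :: "spacetime \<Rightarrow> real"
  assumes V: "\<And>x. V differentiable (at x)" and cont: "continuous_on UNIV (partial \<alpha> V)"
    and K: "compact K" "\<And>x. x \<notin> K \<Longrightarrow> V x = 0"
  shows "integral\<^sup>L lborel (partial \<alpha> V) = 0"
proof -
  let ?e = "axis \<alpha> 1 :: spacetime"
  define h where "h = (\<lambda>n. 1 / real (Suc n))"
  have h: "0 < h n" "h n \<le> 1" for n by (simp_all add: h_def)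
  define s where "s = (\<lambda>n x. (V (x + h n *\<^sub>R ?e) - V x) / h n)"
  \<comment> \<open>K swept backwards by steps of length up to 1. Since \<open>h n \<le> 1\<close>,
    every quotient \<open>s n\<close> vanishes off this compact set, which carries the dominating
    function.\<close>
  define K' where "K' = (\<lambda>(x, t). x - t *\<^sub>R ?e) ` (K \<times> {0..1::real})"
  have "compact K'"
    unfolding K'_def case_prod_beta using K(1)
    by (intro compact_continuous_image compact_Times continuous_intros) auto
  have Vc: "continuous_on UNIV V"
    using V by (simp add: continuous_at_imp_continuous_on differentiable_imp_continuous_within)
  have Vb: "V \<in> borel_measurable borel" by (rule borel_measurable_continuous_onI[OF Vc])
  have Vi: "integrable lborel V" by (rule compact_support_integrable[OF Vc K])
  have "bounded (partial \<alpha> V ` K)"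
    using K(1) by (intro compact_imp_bounded compact_continuous_image continuous_on_subset[OF cont]) auto
  then obtain M where M: "0 < M" "\<And>x. x \<in> K \<Longrightarrow> \<bar>partial \<alpha> V x\<bar> \<le> M"
    by (auto simp: bounded_pos)
  have M': "\<bar>partial \<alpha> V x\<bar> \<le> M" for x
    using M partial_outside_support[OF K] by (cases "x \<in> K") auto
  have "(\<lambda>n. integral\<^sup>L lborel (s n)) \<longlonglongrightarrow> integral\<^sup>L lborel (partial \<alpha> V)"
  proof (rule integral_dominated_convergence[where w = "\<lambda>x. indicator K' x *\<^sub>R M"])
    show "partial \<alpha> V \<in> borel_measurable lborel"
      using borel_measurable_continuous_onI[OF cont] by simp
    show "s n \<in> borel_measurable lborel" for n
      unfolding s_def using Vb by measurable
    show "integrable lborel (\<lambda>x. indicator K' x *\<^sub>R M)"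
      using \<open>compact K'\<close> by (intro borel_integrable_compact) auto
    show "AE x in lborel. (\<lambda>n. s n x) \<longlonglongrightarrow> partial \<alpha> V x"
    proof (rule AE_I2)
      fix x
      have "((\<lambda>t. (V (x + t *\<^sub>R ?e) - V x) / t) \<longlongrightarrow> partial \<alpha> V x) (at 0)"
        using line_has_real_derivative[of V x 0 \<alpha>] V by (simp add: has_field_derivative_iff)
      moreover have "filterlim h (at 0) sequentially"
        unfolding h_def filterlim_at using LIMSEQ_inverse_real_of_nat by (simp add: divide_inverse)
      ultimately show "(\<lambda>n. s n x) \<longlonglongrightarrow> partial \<alpha> V x"
        unfolding s_def by (rule filterlim_compose)
    qed
    show "AE x in lborel. norm (s n x) \<le> indicator K' x *\<^sub>R M" for n
    proof (rule AE_I2)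
      fix x
      obtain t where t: "V (x + h n *\<^sub>R ?e) - V x = h n * partial \<alpha> V (x + t *\<^sub>R ?e)"
        using partial_mean_value[OF V h(1)] by metis
      show "norm (s n x) \<le> indicator K' x *\<^sub>R M"
      proof (cases "x \<in> K'")
        case True
        then show ?thesis using t h[of n] M' by (simp add: s_def)
      next
        case False
        have "x \<notin> K"
        proof
          assume "x \<in> K"
          then have "x \<in> K'" unfolding K'_def by (intro image_eqI[of _ _ "(x, 0)"]) auto
          then show False using False by blast
        qed
        moreover have "x + h n *\<^sub>R ?e \<notin> K"
        proof
          assume "x + h n *\<^sub>R ?e \<in> K"
          then have "x \<in> K'" unfolding K'_def
            using h[of n] by (intro image_eqI[of _ _ "(x + h n *\<^sub>R ?e, h n)"]) auto
          then show False using False by blast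
        qed
        ultimately show ?thesis by (simp add: s_def K(2) M less_imp_le)
      qed
    qed
  qed
  moreover have "integral\<^sup>L lborel (s n) = 0" for n
  proof -
    have "integrable lborel (\<lambda>x. V (x + h n *\<^sub>R ?e))"
      using integrable_distr_eq[of "(+) (h n *\<^sub>R ?e)" lborel borel V] Vi Vb
      by (simp add: lborel_distr_plus add.commute)
    then show ?thesis unfolding s_def using Vi by (simp add: integral_translate[OF Vb])
  qed
  ultimately have "(\<lambda>n. 0) \<longlonglongrightarrow> integral\<^sup>L lborel (partial \<alpha> V)" by simp
  then show ?thesis by (rule LIMSEQ_unique[OF _ tendsto_const])
qed

section \<open>Bump functions\<close>

text \<open>The index k makes the family closed under differentiation up to linear combinations:
  dividing by powers of t is all that differentiating exp (-1/t) does.\<close>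

definition mollifier :: "nat \<Rightarrow> real \<Rightarrow> real" where
  "mollifier k t = (if t > 0 then exp (- 1 / t) / t ^ k else 0)"

text \<open>With s = 1/t the limit from the right is that of s^k / exp s at infinity.\<close>

lemma mollifier_tendsto_0: "(mollifier k \<longlongrightarrow> 0) (at 0)"
proof (rule filterlim_split_at)
  show "(mollifier k \<longlongrightarrow> 0) (at_left 0)"
    by (rule tendsto_eventually) (auto simp: eventually_at_filter mollifier_def)
  have "((\<lambda>t. inverse t ^ k / exp (inverse t)) \<longlongrightarrow> (0::real)) (at_right 0)"
    by (rule filterlim_compose[OF tendsto_power_div_exp_0 filterlim_inverse_at_top_right])
  moreover have "\<forall>\<^sub>F t in at_right 0. inverse t ^ k / exp (inverse t) = mollifier k t"
    by (auto simp: eventually_at_filter mollifier_def exp_minus divide_inverse power_inverse)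
  ultimately show "(mollifier k \<longlongrightarrow> 0) (at_right 0)"
    by (rule Lim_transform_eventually)
qed

lemma mollifier_deriv:
  "(mollifier k has_real_derivative - real k * mollifier (Suc k) t + mollifier (k + 2) t) (at t)"
proof (cases t "0 :: real" rule: linorder_cases)
  case less
  have "((\<lambda>_. 0) has_real_derivative 0) (at t)" by simp
  then have "(mollifier k has_real_derivative 0) (at t)"
    by (rule DERIV_cong_ev[THEN iffD1, OF refl _ refl, rotated])
      (use eventually_nhds_in_open[of "{..<0}" t] less in \<open>auto elim!: eventually_mono simp: mollifier_def\<close>)
  then show ?thesis using less by (simp add: mollifier_def)
next
  case equal
  \<comment> \<open>At 0 the difference quotient of \<open>mollifier k\<close> is
    \<open>mollifier (Suc k)\<close>, so the limit already known gives derivative 0, which is also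
    the value of the claimed formula there.\<close>
  have "((\<lambda>h. (mollifier k h - mollifier k 0) / (h - 0)) \<longlongrightarrow> 0) (at 0)"
  proof (rule Lim_transform_eventually[OF mollifier_tendsto_0[of "Suc k"]])
    show "\<forall>\<^sub>F h in at 0. mollifier (Suc k) h = (mollifier k h - mollifier k 0) / (h - 0)"
      by (auto simp: eventually_at_filter mollifier_def)
  qed
  then show ?thesis using equal by (simp add: has_field_derivative_iff mollifier_def)
next
  case greater
  have "((\<lambda>t. exp (- 1 / t) / t ^ k) has_real_derivative
      - real k * (exp (- 1 / t) / t ^ Suc k) + exp (- 1 / t) / t ^ (k + 2)) (at t)"
  proof (cases k)
    case 0
    then show ?thesis using greater
      by (auto intro!: derivative_eq_intros simp: field_simps power2_eq_square)
  next
    case (Suc j)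
    have E: "((\<lambda>t. exp (- 1 / t)) has_real_derivative exp (- 1 / t) / (t * t)) (at t)"
      using greater by (auto intro!: derivative_eq_intros simp: field_simps)
    have P: "((\<lambda>t. t ^ Suc j) has_real_derivative (1 + real j) * t ^ j) (at t)"
      using DERIV_pow[of "Suc j" t] by simp
    show ?thesis unfolding Suc
      by (rule DERIV_cong[OF DERIV_divide[OF E P]]) (use greater in \<open>simp_all add: field_simps\<close>)
  qed
  then have "(mollifier k has_real_derivative
      - real k * (exp (- 1 / t) / t ^ Suc k) + exp (- 1 / t) / t ^ (k + 2)) (at t)"
    by (rule DERIV_cong_ev[THEN iffD1, OF refl _ refl, rotated])
      (use eventually_nhds_in_open[of "{0<..}" t] greater in \<open>auto elim!: eventually_mono simp: mollifier_def\<close>)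
  then show ?thesis using greater by (simp add: mollifier_def)
qed

text \<open>Closed under partial derivatives, hence all its members are smooth.\<close>

inductive_set bump_algebra :: "spacetime \<Rightarrow> real \<Rightarrow> (spacetime \<Rightarrow> real) set" for a r where
  const: "(\<lambda>x. c) \<in> bump_algebra a r"
| coord: "(\<lambda>x. x $ i) \<in> bump_algebra a r"
| bump: "(\<lambda>x. mollifier k (r\<^sup>2 - (x - a) \<bullet> (x - a))) \<in> bump_algebra a r"
| add: "f \<in> bump_algebra a r \<Longrightarrow> g \<in> bump_algebra a r \<Longrightarrow> (\<lambda>x. f x + g x) \<in> bump_algebra a r"
| mult: "f \<in> bump_algebra a r \<Longrightarrow> g \<in> bump_algebra a r \<Longrightarrow> (\<lambda>x. f x * g x) \<in> bump_algebra a r"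

lemma bump_algebra_partial:
  assumes "f \<in> bump_algebra a r"
  shows "(\<forall>x. f differentiable (at x)) \<and> (\<forall>\<alpha>. partial \<alpha> f \<in> bump_algebra a r)"
  using assms
proof induction
  case (const c)
  have "partial \<alpha> (\<lambda>x. c) = (\<lambda>x. 0)" for \<alpha> by (simp add: fun_eq_iff partial_const)
  then show ?case by (auto intro: bump_algebra.const)
next
  case (coord i)
  have d: "((\<lambda>x::spacetime. x $ i) has_derivative (\<lambda>h. h $ i)) (at x)" for x
    by (rule bounded_linear.has_derivative[OF bounded_linear_vec_nth]) simp
  have "partial \<alpha> (\<lambda>x. x $ i) = (\<lambda>x. axis \<alpha> 1 $ i)" for \<alpha>
    by (simp add: fun_eq_iff partial_has_derivative[OF d])
  then show ?case using d by (auto simp: differentiable_def intro: bump_algebra.const)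
next
  case (bump k)
  define q where "q = (\<lambda>x::spacetime. r\<^sup>2 - (x - a) \<bullet> (x - a))"
  have "((\<lambda>x. mollifier k (q x)) has_derivative
      (\<lambda>h. (- 2 * ((x - a) \<bullet> h)) * (- real k * mollifier (Suc k) (q x) + mollifier (k + 2) (q x)))) (at x)" for x
  proof -
    have "(q has_derivative (\<lambda>h. - 2 * ((x - a) \<bullet> h))) (at x)"
      unfolding q_def by (auto intro!: derivative_eq_intros simp: inner_commute)
    from DERIV_compose_FDERIV[OF mollifier_deriv this] show ?thesis by simp
  qed
  note d = this
  \<comment> \<open>Differences are spelled with negated constants because
    \<open>bump_algebra\<close> has closure rules for sums and products only.\<close>
  have p: "partial \<alpha> (\<lambda>x. mollifier k (q x)) =
      (\<lambda>x. (- 2 * (x $ \<alpha> + - (a $ \<alpha>))) * (- real k * mollifier (Suc k) (q x) + mollifier (k + 2) (q x)))" for \<alpha>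
    by (simp add: fun_eq_iff partial_has_derivative[OF d] inner_axis)
  have "(\<lambda>x. (- 2 * (x $ \<alpha> + - (a $ \<alpha>))) * (- real k * mollifier (Suc k) (q x) + mollifier (k + 2) (q x)))
      \<in> bump_algebra a r" for \<alpha>
    unfolding q_def by (intro bump_algebra.intros)
  then show ?case
    using d unfolding p[unfolded q_def] q_def differentiable_def by blast
next
  case (add f g)
  then have "partial \<alpha> (\<lambda>x. f x + g x) = (\<lambda>x. partial \<alpha> f x + partial \<alpha> g x)" for \<alpha>
    by (simp add: fun_eq_iff partial_add)
  then show ?case using add by (auto intro: bump_algebra.add)
next
  case (mult f g)
  then have "partial \<alpha> (\<lambda>x. f x * g x) = (\<lambda>x. partial \<alpha> f x * g x + f x * partial \<alpha> g x)" for \<alpha>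
    by (simp add: fun_eq_iff partial_mult)
  moreover have "(\<lambda>x. partial \<alpha> f x * g x + f x * partial \<alpha> g x) \<in> bump_algebra a r" for \<alpha>
    using mult by (intro bump_algebra.add bump_algebra.mult) auto
  ultimately show ?case using mult by auto
qed

lemma bump_exists:
  assumes "0 < r"
  shows "\<exists>\<phi>. smooth \<phi> \<and> (\<forall>x. 0 \<le> \<phi> x) \<and> 0 < \<phi> a \<and> (\<forall>x. x \<notin> cball a r \<longrightarrow> \<phi> x = (0::real))"
proof (intro exI[of _ "\<lambda>x. mollifier 0 (r\<^sup>2 - (x - a) \<bullet> (x - a))"] conjI allI impI)
  show "smooth (\<lambda>x. mollifier 0 (r\<^sup>2 - (x - a) \<bullet> (x - a)))"
    by (rule smooth_coinduct[OF bump_algebra.bump[of 0 r a]]) (simp_all add: bump_algebra_partial)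
  fix x assume "x \<notin> cball a r"
  then have "r\<^sup>2 < (norm (x - a))\<^sup>2"
    using assms by (auto simp: dist_norm norm_minus_commute intro!: power_strict_mono)
  then show "mollifier 0 (r\<^sup>2 - (x - a) \<bullet> (x - a)) = 0"
    by (simp add: mollifier_def power2_norm_eq_inner)
qed (use assms in \<open>auto simp: mollifier_def\<close>)

lemma fundamental_lemma:
  fixes G :: "spacetime \<Rightarrow> real"
  assumes G: "continuous_on UNIV G"
    and int: "\<And>K \<phi>. compact K \<Longrightarrow> smooth \<phi> \<Longrightarrow> (\<And>x. x \<notin> K \<Longrightarrow> \<phi> x = 0)
      \<Longrightarrow> integral\<^sup>L lborel (\<lambda>x. \<phi> x * G x) = 0"
  shows "G a = 0"
proof (rule ccontr)
  assume "G a \<noteq> 0"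
  \<comment> \<open>This factor makes \<open>c * G x\<close> positive near a, so one argument covers
    both signs of \<open>G a\<close>.\<close>
  define c where "c = sgn (G a)"
  have "0 < c * G a" using \<open>G a \<noteq> 0\<close> by (auto simp: c_def sgn_if)
  have "open ((\<lambda>x. c * G x) -` {0<..})"
    by (intro open_vimage continuous_intros G)
  then have "\<exists>r>0. cball a r \<subseteq> (\<lambda>x. c * G x) -` {0<..}"
    using \<open>0 < c * G a\<close> unfolding open_contains_cball vimage_eq greaterThan_iff by blast
  then obtain r where "0 < r" and sub: "cball a r \<subseteq> (\<lambda>x. c * G x) -` {0<..}" by blast
  have r: "0 < c * G x" if "x \<in> cball a r" for x
    using subsetD[OF sub that] by (simp only: vimage_eq greaterThan_iff)
  obtain \<phi> :: "spacetime \<Rightarrow> real" where \<phi>: "smooth \<phi>" "\<And>x. 0 \<le> \<phi> x" "0 < \<phi> a" "\<And>x. x \<notin> cball a r \<Longrightarrow> \<phi> x = 0"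
    using bump_exists[OF \<open>0 < r\<close>, of a] by blast
  define f where "f = (\<lambda>x. c * (\<phi> x * G x))"
  have f: "continuous_on A f" for A
    unfolding f_def by (intro continuous_intros smooth_continuous[OF \<phi>(1)] continuous_on_subset[OF G]) auto
  have "integrable lborel f"
    by (rule compact_support_integrable[OF f compact_cball[of a r]]) (simp add: f_def \<phi>(4))
  then have "(f has_integral 0) UNIV"
    using has_integral_integral_lborel[of f] int[OF compact_cball \<phi>(1,4)] by (simp add: f_def)
  \<comment> \<open>The contradiction comes from the fact that a nonnegative continuous function
    with integral 0 over a box vanishes there; the integral over the whole space is therefore
    restricted to a box around the support.\<close>
  moreover obtain l u where lu: "cball a r \<subseteq> cbox l u"
    using bounded_subset_cbox_symmetric[OF bounded_cball] by blast
  have "f x = 0" if "x \<notin> cbox l u" for x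
    using \<phi>(4)[of x] subsetD[OF lu, of x] that by (auto simp: f_def simp del: mem_cball)
  then have "f = (\<lambda>x. if x \<in> cbox l u then f x else 0)"
    by (simp add: fun_eq_iff)
  ultimately have "(f has_integral 0) (cbox l u)"
    using has_integral_restrict_UNIV[of "cbox l u" f 0] by simp
  moreover have "0 \<le> f x" for x
  proof (cases "x \<in> cball a r")
    case True
    then have "0 \<le> \<phi> x * (c * G x)" using r[OF True] \<phi>(2)[of x] by simp
    then show ?thesis by (simp add: f_def mult_ac)
  qed (simp add: f_def \<phi>(4))
  moreover have "a \<in> ball a r" using \<open>0 < r\<close> by simp
  moreover have "ball a r \<subseteq> box l u"
    using lu interior_mono[OF lu] by (simp add: interior_cball interior_cbox)
  ultimately have "f a = 0"
    using has_integral_0_cbox_imp_0[OF f] box_subset_cbox by blast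
  then show False using \<open>0 < c * G a\<close> \<phi>(3) by (auto simp: f_def)
qed

section \<open>Families polynomial in a parameter\<close>

text \<open>The degree bound is uniform in x and the coefficients are continuous, so integration
  over a compact set acts on finitely many coefficients. This takes the place of a dominated
  differentiation under the integral.\<close>

definition polynomial_family :: "(real \<Rightarrow> spacetime \<Rightarrow> real) \<Rightarrow> bool" where
  "polynomial_family f \<longleftrightarrow> (\<exists>p n. (\<forall>x. degree (p x) \<le> n) \<and>
     (\<forall>i. continuous_on UNIV (\<lambda>x. coeff (p x) i)) \<and> (\<forall>\<epsilon> x. f \<epsilon> x = poly (p x) \<epsilon>))"

lemma polynomial_family_const:
  assumes "continuous_on UNIV c"
  shows "polynomial_family (\<lambda>\<epsilon>. c)"
  unfolding polynomial_family_def
proof (intro exI[of _ "\<lambda>x. [:c x:]"] exI[of _ 0] conjI allI)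
  show "continuous_on UNIV (\<lambda>x. coeff [:c x:] i)" for i
    using assms by (cases i) auto
qed auto

lemma polynomial_family_parameter: "polynomial_family (\<lambda>\<epsilon> x. \<epsilon>)"
  unfolding polynomial_family_def
  by (rule exI[of _ "\<lambda>x. [:0, 1:]"], rule exI[of _ 1]) auto

lemma polynomial_family_add:
  assumes "polynomial_family f" and "polynomial_family g"
  shows "polynomial_family (\<lambda>\<epsilon> x. f \<epsilon> x + g \<epsilon> x)"
proof -
  obtain p n where p: "\<forall>x. degree (p x) \<le> n" "\<forall>i. continuous_on UNIV (\<lambda>x. coeff (p x) i)" "\<forall>\<epsilon> x. f \<epsilon> x = poly (p x) \<epsilon>"
    using assms(1) by (auto simp: polynomial_family_def)
  obtain q m where q: "\<forall>x. degree (q x) \<le> m" "\<forall>i. continuous_on UNIV (\<lambda>x. coeff (q x) i)" "\<forall>\<epsilon> x. g \<epsilon> x = poly (q x) \<epsilon>"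
    using assms(2) by (auto simp: polynomial_family_def)
  show ?thesis
    unfolding polynomial_family_def
  proof (intro exI[of _ "\<lambda>x. p x + q x"] exI[of _ "max n m"] conjI allI)
    show "degree (p x + q x) \<le> max n m" for x
      using p(1) q(1) degree_add_le_max[of "p x" "q x"] by (meson le_trans max.mono)
  qed (use p q in \<open>auto intro!: continuous_intros\<close>)
qed

lemma polynomial_family_mult:
  assumes "polynomial_family f" and "polynomial_family g"
  shows "polynomial_family (\<lambda>\<epsilon> x. f \<epsilon> x * g \<epsilon> x)"
proof -
  obtain p n where p: "\<forall>x. degree (p x) \<le> n" "\<forall>i. continuous_on UNIV (\<lambda>x. coeff (p x) i)" "\<forall>\<epsilon> x. f \<epsilon> x = poly (p x) \<epsilon>"
    using assms(1) by (auto simp: polynomial_family_def)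
  obtain q m where q: "\<forall>x. degree (q x) \<le> m" "\<forall>i. continuous_on UNIV (\<lambda>x. coeff (q x) i)" "\<forall>\<epsilon> x. g \<epsilon> x = poly (q x) \<epsilon>"
    using assms(2) by (auto simp: polynomial_family_def)
  show ?thesis
    unfolding polynomial_family_def
  proof (intro exI[of _ "\<lambda>x. p x * q x"] exI[of _ "n + m"] conjI allI)
    show "degree (p x * q x) \<le> n + m" for x
      using p(1) q(1) degree_mult_le[of "p x" "q x"] by (meson le_trans add_mono)
    show "continuous_on UNIV (\<lambda>x. coeff (p x * q x) i)" for i
      unfolding coeff_mult using p(2) q(2) by (intro continuous_intros) auto
  qed (use p q in auto)
qed

lemma polynomial_family_sum:
  "(\<And>i. i \<in> A \<Longrightarrow> polynomial_family (f i)) \<Longrightarrow> polynomial_family (\<lambda>\<epsilon> x. \<Sum>i\<in>A. f i \<epsilon> x)"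
  by (induction A rule: infinite_finite_induct)
    (auto intro: polynomial_family_add polynomial_family_const)

lemma polynomial_family_diff:
  assumes "polynomial_family f" and "polynomial_family g"
  shows "polynomial_family (\<lambda>\<epsilon> x. f \<epsilon> x - g \<epsilon> x)"
  using polynomial_family_add[OF assms(1) polynomial_family_mult[OF polynomial_family_const[of "\<lambda>x. - 1"] assms(2)]]
  by simp

lemma polynomial_family_power: "polynomial_family f \<Longrightarrow> polynomial_family (\<lambda>\<epsilon> x. (f \<epsilon> x) ^ k)"
  by (induction k) (auto intro: polynomial_family_mult polynomial_family_const)

lemma polynomial_family_integral:
  assumes f: "polynomial_family f" and K: "compact K"
    and f': "\<And>x. ((\<lambda>\<epsilon>. f \<epsilon> x) has_real_derivative f' x) (at 0)"
  shows "((\<lambda>\<epsilon>. LINT x:K|lborel. complex_of_real (f \<epsilon> x)) has_vector_derivative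
      complex_of_real (LINT x:K|lborel. f' x)) (at 0)"
proof -
  obtain p n where p: "\<And>x. degree (p x) \<le> n" "\<And>i. continuous_on UNIV (\<lambda>x. coeff (p x) i)"
    "\<And>\<epsilon> x. f \<epsilon> x = poly (p x) \<epsilon>"
    using f unfolding polynomial_family_def by blast
  have pd: "(poly (p x) has_real_derivative coeff (p x) 1) (at 0)" for x
    using poly_DERIV[of "p x" 0] by (simp add: poly_0_coeff_0 coeff_pderiv)
  have f'_eq: "f' x = coeff (p x) 1" for x
  proof -
    have "(\<lambda>\<epsilon>. f \<epsilon> x) = poly (p x)" by (simp add: fun_eq_iff p(3))
    then show ?thesis using DERIV_unique[OF f'[of x]] pd[of x] by simp
  qed
  define C where "C = (\<lambda>i. LINT x:K|lborel. coeff (p x) i)"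
  have int: "set_integrable lborel K (\<lambda>x. coeff (p x) i)" for i
    unfolding set_integrable_def
    by (intro borel_integrable_compact K continuous_on_subset[OF p(2)]) auto
  have "f \<epsilon> x = (\<Sum>i\<le>n. \<epsilon> ^ i * coeff (p x) i)" for \<epsilon> x
    unfolding p(3) poly_altdef using p(1)[of x]
    by (subst sum.mono_neutral_left[of "{..n}" "{..degree (p x)}"]) (auto simp: coeff_eq_0 mult.commute)
  then have "indicator K x *\<^sub>R f \<epsilon> x = (\<Sum>i\<le>n. \<epsilon> ^ i * (indicator K x *\<^sub>R coeff (p x) i))" for \<epsilon> x
    by (simp add: sum_distrib_left mult_ac)
  then have F: "(LINT x:K|lborel. f \<epsilon> x) = (\<Sum>i\<le>n. \<epsilon> ^ i * C i)" for \<epsilon>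
    using int unfolding set_lebesgue_integral_def C_def set_integrable_def
    by (simp only: Bochner_Integration.integral_sum integrable_mult_right integral_mult_right_zero)
  have "((\<lambda>\<epsilon>. \<Sum>i\<le>n. \<epsilon> ^ i * C i) has_real_derivative (\<Sum>i\<le>n. real i * 0 ^ (i - 1) * C i)) (at 0)"
    by (auto intro!: derivative_eq_intros)
  \<comment> \<open>Only i = 1 contributes: for i = 0 the truncated exponent gives 0^0 = 1, but the
    factor \<open>real i\<close> is 0. If n = 0 there is no such term, and \<open>C 1\<close>
    integrates a coefficient above the degree.\<close>
  also have "(\<Sum>i\<le>n. real i * 0 ^ (i - 1) * C i) = C 1"
  proof (cases n)
    case 0
    then have "degree (p x) = 0" for x using p(1)[of x] by simp
    then have "coeff (p x) 1 = 0" for x by (simp add: coeff_eq_0)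
    then show ?thesis using 0 by (simp add: C_def)
  next
    case (Suc k)
    have "(\<Sum>i\<le>n. real i * 0 ^ (i - 1) * C i) = (\<Sum>i\<le>n. if i = 1 then C 1 else 0)"
      by (intro sum.cong refl) (auto simp: power_0_left)
    then show ?thesis using Suc by simp
  qed
  finally have "((\<lambda>\<epsilon>. LINT x:K|lborel. f \<epsilon> x) has_vector_derivative (LINT x:K|lborel. f' x)) (at 0)"
    by (simp add: F f'_eq C_def has_real_derivative_iff_has_vector_derivative)
  from bounded_linear.has_vector_derivative[OF bounded_linear_of_real this]
  show ?thesis by (simp add: set_integral_complex_of_real)
qed

section \<open>The first variation\<close>

lemma deriv_four_factors:
  "((\<lambda>\<epsilon>. k * ((a + \<epsilon> * a') * (b + \<epsilon> * b') * (c + \<epsilon> * c') * (d + \<epsilon> * d'))) has_real_derivative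
     k * (a' * b * c * d + a * b' * c * d + a * b * c' * d + a * b * c * d')) (at 0)"
  by (auto intro!: derivative_eq_intros simp: algebra_simps)

lemma deriv_two_factors:
  "((\<lambda>\<epsilon>. k * ((a + \<epsilon> * a') * (b + \<epsilon> * b'))) has_real_derivative k * (a' * b + a * b')) (at 0)"
  by (auto intro!: derivative_eq_intros simp: algebra_simps)

lemma sum_rotate4:
  "(\<Sum>a\<in>A. \<Sum>b\<in>A. \<Sum>c\<in>A. \<Sum>d\<in>A. f b c d a) = (\<Sum>a\<in>A. \<Sum>b\<in>A. \<Sum>c\<in>A. \<Sum>d\<in>A. f a b c d)"
proof -
  have "(\<Sum>a\<in>A. \<Sum>b\<in>A. \<Sum>c\<in>A. \<Sum>d\<in>A. f b c d a) = (\<Sum>b\<in>A. \<Sum>a\<in>A. \<Sum>c\<in>A. \<Sum>d\<in>A. f b c d a)"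
    by (rule sum.swap)
  also have "\<dots> = (\<Sum>b\<in>A. \<Sum>c\<in>A. \<Sum>a\<in>A. \<Sum>d\<in>A. f b c d a)"
    by (intro sum.cong refl sum.swap)
  also have "\<dots> = (\<Sum>b\<in>A. \<Sum>c\<in>A. \<Sum>d\<in>A. \<Sum>a\<in>A. f b c d a)"
    by (intro sum.cong refl sum.swap)
  finally show ?thesis .
qed

text \<open>The product rule gives one term for each varied factor. Cyclic relabelling of a, b, c, d
  maps these terms onto each other, and symmetry of U lets the remaining chain be read from a to
  b.\<close>

lemma quartic_variation:
  fixes U H :: "'i \<Rightarrow> 'i \<Rightarrow> real" and g :: "'i \<Rightarrow> real"
  assumes "\<And>a b. U a b = U b a"
  shows "((\<lambda>\<epsilon>. \<Sum>a\<in>I. \<Sum>b\<in>I. \<Sum>c\<in>I. \<Sum>d\<in>I. g a * g b * g c * g d *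
      ((U a b + \<epsilon> * H a b) * (U b c + \<epsilon> * H b c) * (U c d + \<epsilon> * H c d) * (U d a + \<epsilon> * H d a)))
    has_real_derivative 4 * (\<Sum>a\<in>I. \<Sum>b\<in>I. H a b * (\<Sum>c\<in>I. \<Sum>d\<in>I. g a * g b * g c * g d * (U a c * U c d * U d b)))) (at 0)"
proof -
  let ?f = "\<lambda>a b c d. g a * g b * g c * g d * (H a b * U b c * U c d * U d a)"
  let ?S = "\<lambda>f. \<Sum>a\<in>I. \<Sum>b\<in>I. \<Sum>c\<in>I. \<Sum>d\<in>I. (f a b c d :: real)"
  have "?S (\<lambda>a b c d. g a * g b * g c * g d * (H a b * U b c * U c d * U d a + U a b * H b c * U c d * U d a
       + U a b * U b c * H c d * U d a + U a b * U b c * U c d * H d a))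
    = ?S ?f + ?S (\<lambda>a b c d. ?f b c d a) + ?S (\<lambda>a b c d. ?f c d a b) + ?S (\<lambda>a b c d. ?f d a b c)"
    unfolding sum.distrib[symmetric] by (intro sum.cong refl) (simp add: algebra_simps)
  also have "?S (\<lambda>a b c d. ?f d a b c) = ?S (\<lambda>a b c d. ?f c d a b)"
    by (rule sum_rotate4[of "\<lambda>a b c d. ?f c d a b"])
  also have "?S (\<lambda>a b c d. ?f c d a b) = ?S (\<lambda>a b c d. ?f b c d a)"
    by (rule sum_rotate4[of "\<lambda>a b c d. ?f b c d a"])
  also have "?S (\<lambda>a b c d. ?f b c d a) = ?S ?f"
    by (rule sum_rotate4)
  also have "?S ?f = (\<Sum>a\<in>I. \<Sum>b\<in>I. H a b * (\<Sum>c\<in>I. \<Sum>d\<in>I. g a * g b * g c * g d * (U a d * U d c * U c b)))"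
    unfolding sum_distrib_left
    by (intro sum.cong refl) (simp add: assms[of _ b for b] mult_ac)
  also have "\<dots> = (\<Sum>a\<in>I. \<Sum>b\<in>I. H a b * (\<Sum>c\<in>I. \<Sum>d\<in>I. g a * g b * g c * g d * (U a c * U c d * U d b)))"
  proof -
    have "(\<Sum>c\<in>I. \<Sum>d\<in>I. g a * g b * g c * g d * (U a d * U d c * U c b))
        = (\<Sum>c\<in>I. \<Sum>d\<in>I. g a * g b * g c * g d * (U a c * U c d * U d b))" for a b
      by (subst sum.swap) (simp add: mult_ac)
    then show ?thesis by simp
  qed
  finally have eq: "?S (\<lambda>a b c d. g a * g b * g c * g d * (H a b * U b c * U c d * U d a + U a b * H b c * U c d * U d a
       + U a b * U b c * H c d * U d a + U a b * U b c * U c d * H d a))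
    = 4 * (\<Sum>a\<in>I. \<Sum>b\<in>I. H a b * (\<Sum>c\<in>I. \<Sum>d\<in>I. g a * g b * g c * g d * (U a c * U c d * U d b)))"
    by simp
  show ?thesis
    unfolding eq[symmetric] by (intro DERIV_sum deriv_four_factors)
qed

lemma square_variation:
  fixes U H :: "'i \<Rightarrow> 'i \<Rightarrow> real" and g :: "'i \<Rightarrow> real"
  shows "((\<lambda>\<epsilon>. (\<Sum>a\<in>I. \<Sum>b\<in>I. g a * g b * (U a b + \<epsilon> * H a b)\<^sup>2)\<^sup>2)
    has_real_derivative 4 * (\<Sum>a\<in>I. \<Sum>b\<in>I. H a b * ((\<Sum>c\<in>I. \<Sum>d\<in>I. g c * g d * (U c d)\<^sup>2) * (g a * g b * U a b)))) (at 0)"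
proof -
  have "((\<lambda>\<epsilon>. \<Sum>a\<in>I. \<Sum>b\<in>I. g a * g b * (U a b + \<epsilon> * H a b)\<^sup>2) has_real_derivative
     (\<Sum>a\<in>I. \<Sum>b\<in>I. g a * g b * (H a b * U a b + U a b * H a b))) (at 0)"
    unfolding power2_eq_square by (intro DERIV_sum deriv_two_factors)
  from DERIV_power[OF this, of 2] show ?thesis
    by (rule DERIV_cong) (simp add: sum_distrib_left sum_distrib_right mult_ac algebra_simps)
qed

text \<open>Exchanging a and b identifies the two product-rule terms of the mixed product, hence the
  common factor 2 and a single coefficient for \<open>k a b r\<close>.\<close>

lemma kinetic_variation:
  fixes d k :: "'i \<Rightarrow> 'i \<Rightarrow> 'i \<Rightarrow> real" and g :: "'i \<Rightarrow> real"
  shows "((\<lambda>\<epsilon>. (\<Sum>a\<in>I. \<Sum>b\<in>I. \<Sum>r\<in>I. g a * g b * g r * (d a b r + \<epsilon> * k a b r)\<^sup>2)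
        - (\<Sum>a\<in>I. \<Sum>b\<in>I. \<Sum>r\<in>I. g r * ((d a b r + \<epsilon> * k a b r) * (d b a r + \<epsilon> * k b a r))))
    has_real_derivative 2 * (\<Sum>a\<in>I. \<Sum>b\<in>I. \<Sum>r\<in>I. (g a * g b * g r * d a b r - g r * d b a r) * k a b r)) (at 0)"
proof -
  have "(\<Sum>a\<in>I. \<Sum>b\<in>I. \<Sum>r\<in>I. g r * (k a b r * d b a r + d a b r * k b a r))
     = (\<Sum>a\<in>I. \<Sum>b\<in>I. \<Sum>r\<in>I. g r * (k a b r * d b a r)) + (\<Sum>a\<in>I. \<Sum>b\<in>I. \<Sum>r\<in>I. g r * (d a b r * k b a r))"
    by (simp add: sum.distrib distrib_left)
  also have "(\<Sum>a\<in>I. \<Sum>b\<in>I. \<Sum>r\<in>I. g r * (d a b r * k b a r)) = (\<Sum>a\<in>I. \<Sum>b\<in>I. \<Sum>r\<in>I. g r * (k a b r * d b a r))"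
    by (subst sum.swap) (simp add: mult_ac)
  finally have dup: "(\<Sum>a\<in>I. \<Sum>b\<in>I. \<Sum>r\<in>I. g r * (k a b r * d b a r + d a b r * k b a r))
     = (\<Sum>a\<in>I. \<Sum>b\<in>I. \<Sum>r\<in>I. g r * (k a b r * d b a r)) + (\<Sum>a\<in>I. \<Sum>b\<in>I. \<Sum>r\<in>I. g r * (k a b r * d b a r))" .
  have eq: "2 * (\<Sum>a\<in>I. \<Sum>b\<in>I. \<Sum>r\<in>I. (g a * g b * g r * d a b r - g r * d b a r) * k a b r)
    = (\<Sum>a\<in>I. \<Sum>b\<in>I. \<Sum>r\<in>I. g a * g b * g r * (k a b r * d a b r + d a b r * k a b r))
      - (\<Sum>a\<in>I. \<Sum>b\<in>I. \<Sum>r\<in>I. g r * (k a b r * d b a r + d a b r * k b a r))"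
  proof -
    have "(\<Sum>a\<in>I. \<Sum>b\<in>I. \<Sum>r\<in>I. (g a * g b * g r * d a b r - g r * d b a r) * k a b r)
      = (\<Sum>a\<in>I. \<Sum>b\<in>I. \<Sum>r\<in>I. g a * g b * g r * (k a b r * d a b r)) - (\<Sum>a\<in>I. \<Sum>b\<in>I. \<Sum>r\<in>I. g r * (k a b r * d b a r))"
      unfolding sum_subtractf[symmetric] by (intro sum.cong refl) (simp add: algebra_simps)
    moreover have "(\<Sum>a\<in>I. \<Sum>b\<in>I. \<Sum>r\<in>I. g a * g b * g r * (k a b r * d a b r + d a b r * k a b r))
      = 2 * (\<Sum>a\<in>I. \<Sum>b\<in>I. \<Sum>r\<in>I. g a * g b * g r * (k a b r * d a b r))"
      by (simp add: sum_distrib_left mult_ac)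
    moreover note dup
    ultimately show ?thesis by linarith
  qed
  show ?thesis
    unfolding eq power2_eq_square by (intro DERIV_diff DERIV_sum deriv_two_factors)
qed

text \<open>The derivative of L with respect to \<open>partial a\<close> of the component (b, r),
  all components being treated as independent. The 64 is twice the 32 of
  \<open>vector_lagrangian\<close>; the sign is positive because L contains - \<tau> times a density
  with -32.\<close>

definition kinetic_momentum :: "real \<Rightarrow> real \<Rightarrow> tensor_field \<Rightarrow> 4 \<Rightarrow> 4 \<Rightarrow> 4 \<Rightarrow> spacetime \<Rightarrow> real" where
  "kinetic_momentum \<tau> \<zeta> S a b r x = 64 * \<tau> * cos (2 * \<zeta>) *
     (eta a a * eta b b * eta r r * partial a (\<lambda>y. S y $ b $ r) x - eta r r * partial b (\<lambda>y. S y $ a $ r) x)"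

text \<open>For symmetric S, a quarter of the gradient of the quartic bracket in
  \<open>vector_lagrangian\<close>; hence 256 = 4 * 64 in \<open>algebraic_force\<close>.\<close>

definition potential_force :: "tensor_field \<Rightarrow> 4 \<Rightarrow> 4 \<Rightarrow> spacetime \<Rightarrow> real" where
  "potential_force S a b x =
     (\<Sum>c\<in>UNIV. \<Sum>d\<in>UNIV. eta a a * eta b b * eta c c * eta d d * (S x $ a $ c * S x $ c $ d * S x $ d $ b))
     - (\<Sum>c\<in>UNIV. \<Sum>d\<in>UNIV. eta c c * eta d d * (S x $ c $ d)\<^sup>2) * (eta a a * eta b b * S x $ a $ b)"

definition algebraic_force :: "real \<Rightarrow> real \<Rightarrow> (spacetime \<Rightarrow> ext) \<Rightarrow> tensor_field \<Rightarrow> 4 \<Rightarrow> 4 \<Rightarrow> spacetime \<Rightarrow> real" where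
  "algebraic_force \<tau> \<zeta> \<psi> S a b x = source \<zeta> \<psi> a b x - 256 * \<tau> * (cos (2 * \<zeta>))\<^sup>2 * potential_force S a b x"

definition real_lagrangian :: "real \<Rightarrow> real \<Rightarrow> real \<Rightarrow> (spacetime \<Rightarrow> ext) \<Rightarrow> tensor_field \<Rightarrow> spacetime \<Rightarrow> real" where
  "real_lagrangian m \<tau> \<zeta> \<psi> S x = free_lagrangian m \<psi> x
     + (\<Sum>a\<in>UNIV. \<Sum>b\<in>UNIV. S x $ a $ b * source \<zeta> \<psi> a b x) - \<tau> * vector_lagrangian \<zeta> S x"

lemma partial_component_variation:
  fixes S h :: tensor_field
  assumes "smooth S" and "smooth h"
  shows "partial m (\<lambda>y. (S y + \<epsilon> *\<^sub>R h y) $ a $ b) x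
     = partial m (\<lambda>y. S y $ a $ b) x + \<epsilon> * partial m (\<lambda>y. h y $ a $ b) x"
proof -
  have d: "(\<lambda>y. S y $ a $ b) differentiable (at x)" "(\<lambda>y. h y $ a $ b) differentiable (at x)"
    by (rule smooth_differentiable[OF smooth_component[OF assms(1)]],
        rule smooth_differentiable[OF smooth_component[OF assms(2)]])
  then have "(\<lambda>y. \<epsilon> * h y $ a $ b) differentiable (at x)" by (intro derivative_intros) auto
  then show ?thesis using d by (simp add: partial_add partial_cmult)
qed

lemma first_variation:
  assumes "smooth S" and "smooth h" and "sym_field S"
  shows "((\<lambda>\<epsilon>. real_lagrangian m \<tau> \<zeta> \<psi> (\<lambda>y. S y + \<epsilon> *\<^sub>R h y) x) has_real_derivative
     (\<Sum>a\<in>UNIV. \<Sum>b\<in>UNIV. h x $ a $ b * algebraic_force \<tau> \<zeta> \<psi> S a b x)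
     + (\<Sum>a\<in>UNIV. \<Sum>b\<in>UNIV. \<Sum>r\<in>UNIV. kinetic_momentum \<tau> \<zeta> S a b r x * partial a (\<lambda>y. h y $ b $ r) x)) (at 0)"
proof -
  have sym: "S x $ a $ b = S x $ b $ a" for a b using assms(3) by (simp add: sym_field_def)
  have src: "((\<lambda>\<epsilon>. \<Sum>a\<in>UNIV. \<Sum>b\<in>UNIV. (S x $ a $ b + \<epsilon> * h x $ a $ b) * source \<zeta> \<psi> a b x) has_real_derivative
     (\<Sum>a\<in>UNIV. \<Sum>b\<in>UNIV. h x $ a $ b * source \<zeta> \<psi> a b x)) (at 0)"
    by (intro DERIV_sum) (auto intro!: derivative_eq_intros)
  have pot: "4 * (\<Sum>a\<in>UNIV. \<Sum>b\<in>UNIV. h x $ a $ b * (\<Sum>c\<in>UNIV. \<Sum>d\<in>UNIV. eta a a * eta b b * eta c c * eta d d *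
        (S x $ a $ c * S x $ c $ d * S x $ d $ b)))
      - 4 * (\<Sum>a\<in>UNIV. \<Sum>b\<in>UNIV. h x $ a $ b * ((\<Sum>c\<in>UNIV. \<Sum>d\<in>UNIV. eta c c * eta d d * (S x $ c $ d)\<^sup>2) *
        (eta a a * eta b b * S x $ a $ b)))
     = 4 * (\<Sum>a\<in>UNIV. \<Sum>b\<in>UNIV. h x $ a $ b * potential_force S a b x)"
    unfolding potential_force_def right_diff_distrib sum_subtractf ..
  have kin: "64 * \<tau> * cos (2 * \<zeta>) * (\<Sum>a\<in>UNIV. \<Sum>b\<in>UNIV. \<Sum>r\<in>UNIV. (eta a a * eta b b * eta r r * partial a (\<lambda>y. S y $ b $ r) x
        - eta r r * partial b (\<lambda>y. S y $ a $ r) x) * partial a (\<lambda>y. h y $ b $ r) x)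
     = (\<Sum>a\<in>UNIV. \<Sum>b\<in>UNIV. \<Sum>r\<in>UNIV. kinetic_momentum \<tau> \<zeta> S a b r x * partial a (\<lambda>y. h y $ b $ r) x)"
    unfolding kinetic_momentum_def sum_distrib_left by (simp only: mult.assoc)
  have alg: "(\<Sum>a\<in>UNIV. \<Sum>b\<in>UNIV. h x $ a $ b * source \<zeta> \<psi> a b x)
      - 256 * \<tau> * (cos (2 * \<zeta>))\<^sup>2 * (\<Sum>a\<in>UNIV. \<Sum>b\<in>UNIV. h x $ a $ b * potential_force S a b x)
     = (\<Sum>a\<in>UNIV. \<Sum>b\<in>UNIV. h x $ a $ b * algebraic_force \<tau> \<zeta> \<psi> S a b x)"
    unfolding algebraic_force_def right_diff_distrib sum_subtractf sum_distrib_left by (simp only: mult_ac)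
  note Q = DERIV_diff[OF quartic_variation[where U = "\<lambda>a b. S x $ a $ b" and I = UNIV and g = "\<lambda>a. eta a a" and H = "\<lambda>a b. h x $ a $ b", OF sym]
      square_variation[where U = "\<lambda>a b. S x $ a $ b" and I = UNIV and g = "\<lambda>a. eta a a" and H = "\<lambda>a b. h x $ a $ b"], unfolded pot]
  note K = kinetic_variation[where I = UNIV and g = "\<lambda>a. eta a a" and d = "\<lambda>a b r. partial a (\<lambda>y. S y $ b $ r) x"
      and k = "\<lambda>a b r. partial a (\<lambda>y. h y $ b $ r) x"]
  note V = DERIV_cmult[OF DERIV_diff[OF DERIV_cmult[OF Q, of "64 * (cos (2 * \<zeta>))\<^sup>2"]
      DERIV_cmult[OF K, of "32 * cos (2 * \<zeta>)"]], of \<tau>]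
  show ?thesis
    unfolding real_lagrangian_def vector_lagrangian_def partial_component_variation[OF assms(1,2)]
    unfolding vector_add_component vector_scaleR_component real_scaleR_def
  proof (rule DERIV_cong[OF DERIV_diff[OF DERIV_add[OF DERIV_const src] V]])
    show "0 + (\<Sum>a\<in>UNIV. \<Sum>b\<in>UNIV. h x $ a $ b * source \<zeta> \<psi> a b x) -
      \<tau> * (64 * (cos (2 * \<zeta>))\<^sup>2 * (4 * (\<Sum>a\<in>UNIV. \<Sum>b\<in>UNIV. h x $ a $ b * potential_force S a b x)) -
       32 * cos (2 * \<zeta>) * (2 * (\<Sum>a\<in>UNIV. \<Sum>b\<in>UNIV. \<Sum>r\<in>UNIV. (eta a a * eta b b * eta r r * partial a (\<lambda>y. S y $ b $ r) x
        - eta r r * partial b (\<lambda>y. S y $ a $ r) x) * partial a (\<lambda>y. h y $ b $ r) x)))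
      = (\<Sum>a\<in>UNIV. \<Sum>b\<in>UNIV. h x $ a $ b * algebraic_force \<tau> \<zeta> \<psi> S a b x)
     + (\<Sum>a\<in>UNIV. \<Sum>b\<in>UNIV. \<Sum>r\<in>UNIV. kinetic_momentum \<tau> \<zeta> S a b r x * partial a (\<lambda>y. h y $ b $ r) x)"
      unfolding alg[symmetric] kin[symmetric] by (simp only: algebra_simps)
  qed
qed

lemma real_lagrangian_polynomial_family:
  assumes "smooth S" and "smooth h" and "smooth \<psi>"
  shows "polynomial_family (\<lambda>\<epsilon>. real_lagrangian m \<tau> \<zeta> \<psi> (\<lambda>y. S y + \<epsilon> *\<^sub>R h y))"
proof -
  note c = smooth_continuous[OF smooth_component] smooth_continuous[OF smooth_partial[OF smooth_component]]
  show ?thesis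
    unfolding real_lagrangian_def[abs_def] vector_lagrangian_def partial_component_variation[OF assms(1,2)]
    unfolding vector_add_component vector_scaleR_component real_scaleR_def
    by (intro polynomial_family_add polynomial_family_mult polynomial_family_sum polynomial_family_diff
        polynomial_family_power polynomial_family_parameter polynomial_family_const[OF continuous_on_const]
        polynomial_family_const[OF c(1)[OF assms(1)]] polynomial_family_const[OF c(2)[OF assms(1)]]
        polynomial_family_const[OF c(1)[OF assms(2)]] polynomial_family_const[OF c(2)[OF assms(2)]]
        polynomial_family_const[OF continuous_source[OF assms(3)]]
        polynomial_family_const[OF continuous_free_lagrangian[OF assms(3)]])
qed

section \<open>The Euler-Lagrange expression and integration by parts\<close>

lemma smooth_cmult: "smooth f \<Longrightarrow> smooth (\<lambda>x. c * f x)" for f :: "spacetime \<Rightarrow> real"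
  by (rule smooth_bounded_linear[OF bounded_linear_mult_right])

lemma kinetic_momentum_expand:
  "kinetic_momentum \<tau> \<zeta> S a b r = (\<lambda>x. (64 * \<tau> * cos (2 * \<zeta>) * (eta a a * eta b b * eta r r)) * partial a (\<lambda>y. S y $ b $ r) x
     + (- 64 * \<tau> * cos (2 * \<zeta>) * eta r r) * partial b (\<lambda>y. S y $ a $ r) x)"
  by (simp add: fun_eq_iff kinetic_momentum_def algebra_simps)

lemma smooth_kinetic_momentum: "smooth S \<Longrightarrow> smooth (kinetic_momentum \<tau> \<zeta> S a b r)"
  unfolding kinetic_momentum_expand
  by (intro smooth_add smooth_cmult smooth_partial smooth_component)

definition euler_lagrange :: "real \<Rightarrow> real \<Rightarrow> (spacetime \<Rightarrow> ext) \<Rightarrow> tensor_field \<Rightarrow> 4 \<Rightarrow> 4 \<Rightarrow> spacetime \<Rightarrow> real" where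
  "euler_lagrange \<tau> \<zeta> \<psi> S b r x =
     algebraic_force \<tau> \<zeta> \<psi> S b r x - (\<Sum>a\<in>UNIV. partial a (kinetic_momentum \<tau> \<zeta> S a b r) x)"

lemma continuous_algebraic_force:
  assumes "smooth S" and "smooth \<psi>"
  shows "continuous_on A (algebraic_force \<tau> \<zeta> \<psi> S a b)"
proof -
  have c: "continuous_on A (\<lambda>x. S x $ a $ b)" for a b
    by (rule smooth_continuous[OF smooth_component[OF assms(1)]])
  show ?thesis
    unfolding algebraic_force_def potential_force_def
    by (intro continuous_on_diff continuous_on_mult continuous_on_sum continuous_on_power continuous_on_const
        continuous_source assms(2) c)
qed

lemma continuous_euler_lagrange:
  assumes "smooth S" and "smooth \<psi>"
  shows "continuous_on A (euler_lagrange \<tau> \<zeta> \<psi> S a b)"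
  unfolding euler_lagrange_def
  by (intro continuous_on_diff continuous_on_sum continuous_algebraic_force assms
      smooth_continuous[OF smooth_partial[OF smooth_kinetic_momentum[OF assms(1)]]])

text \<open>The momentum contracted with h is a current V whose divergence accounts for the
  difference of the two integrands. V vanishes off K, so its divergence integrates to 0; all terms
  vanish off K, so the integral over K is one over the whole space.\<close>

lemma integral_first_variation:
  fixes S h :: tensor_field
  assumes S: "smooth S" and h: "smooth h" and \<psi>: "smooth \<psi>" and K: "compact K" and off: "\<And>x. x \<notin> K \<Longrightarrow> h x = 0"
  shows "(LINT x:K|lborel. (\<Sum>a\<in>UNIV. \<Sum>b\<in>UNIV. h x $ a $ b * algebraic_force \<tau> \<zeta> \<psi> S a b x)
       + (\<Sum>a\<in>UNIV. \<Sum>b\<in>UNIV. \<Sum>r\<in>UNIV. kinetic_momentum \<tau> \<zeta> S a b r x * partial a (\<lambda>y. h y $ b $ r) x))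
     = integral\<^sup>L lborel (\<lambda>x. \<Sum>a\<in>UNIV. \<Sum>b\<in>UNIV. h x $ a $ b * euler_lagrange \<tau> \<zeta> \<psi> S a b x)"
proof -
  let ?W = "kinetic_momentum \<tau> \<zeta> S"
  define V where "V = (\<lambda>a x. \<Sum>b\<in>UNIV. \<Sum>r\<in>UNIV. ?W a b r x * h x $ b $ r)"
  define E where "E = (\<lambda>x. \<Sum>a\<in>UNIV. \<Sum>b\<in>UNIV. h x $ a $ b * euler_lagrange \<tau> \<zeta> \<psi> S a b x)"
  note dW = smooth_differentiable[OF smooth_kinetic_momentum[OF S]]
  note dh = smooth_differentiable[OF smooth_component[OF h]]
  note cW = smooth_continuous[OF smooth_kinetic_momentum[OF S]]
    smooth_continuous[OF smooth_partial[OF smooth_kinetic_momentum[OF S]]]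
  note ch = smooth_continuous[OF smooth_component[OF h]]
    smooth_continuous[OF smooth_partial[OF smooth_component[OF h]]]
  have Vd: "V a differentiable (at x)" for a x
    unfolding V_def by (intro differentiable_sum differentiable_mult dW dh finite ballI)
  have Vp: "partial m (V a) x = (\<Sum>b\<in>UNIV. \<Sum>r\<in>UNIV. partial m (?W a b r) x * h x $ b $ r
      + ?W a b r x * partial m (\<lambda>y. h y $ b $ r) x)" for m a x
    unfolding V_def
    by (subst partial_sum, intro differentiable_sum differentiable_mult dW dh finite ballI,
        intro sum.cong refl, subst partial_sum, intro differentiable_mult dW dh,
        intro sum.cong refl, rule partial_mult[OF dW dh])
  have Vpc: "continuous_on UNIV (partial m (V a))" for m a
    unfolding Vp[abs_def] by (intro continuous_on_add continuous_on_mult continuous_on_sum cW ch)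
  have V0: "V a x = 0" if "x \<notin> K" for a x using off[OF that] by (simp add: V_def)
  have Ec: "continuous_on UNIV E"
    unfolding E_def by (intro continuous_on_mult continuous_on_sum ch continuous_euler_lagrange S \<psi>)
  have E0: "E x = 0" if "x \<notin> K" for x using off[OF that] by (simp add: E_def)
  have pV0: "partial a (V a) x = 0" if "x \<notin> K" for a x
    by (rule partial_outside_support[OF K V0 that])
  have "(\<Sum>a\<in>UNIV. \<Sum>b\<in>UNIV. h x $ a $ b * algebraic_force \<tau> \<zeta> \<psi> S a b x)
       + (\<Sum>a\<in>UNIV. \<Sum>b\<in>UNIV. \<Sum>r\<in>UNIV. ?W a b r x * partial a (\<lambda>y. h y $ b $ r) x)
     = E x + (\<Sum>a\<in>UNIV. partial a (V a) x)" for x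
  proof -
    have "(\<Sum>a\<in>UNIV. partial a (V a) x) = (\<Sum>a\<in>UNIV. \<Sum>b\<in>UNIV. \<Sum>r\<in>UNIV. h x $ b $ r * partial a (?W a b r) x)
      + (\<Sum>a\<in>UNIV. \<Sum>b\<in>UNIV. \<Sum>r\<in>UNIV. ?W a b r x * partial a (\<lambda>y. h y $ b $ r) x)"
      by (simp add: Vp sum.distrib mult.commute)
    also have "(\<Sum>a\<in>UNIV. \<Sum>b\<in>UNIV. \<Sum>r\<in>UNIV. h x $ b $ r * partial a (?W a b r) x)
      = (\<Sum>b\<in>UNIV. \<Sum>r\<in>UNIV. h x $ b $ r * (\<Sum>a\<in>UNIV. partial a (?W a b r) x))"
      unfolding sum_distrib_left by (rule trans[OF sum.swap sum.cong[OF refl sum.swap]])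
    finally show ?thesis
      by (simp add: E_def euler_lagrange_def right_diff_distrib sum_subtractf)
  qed
  then have "(LINT x:K|lborel. (\<Sum>a\<in>UNIV. \<Sum>b\<in>UNIV. h x $ a $ b * algebraic_force \<tau> \<zeta> \<psi> S a b x)
       + (\<Sum>a\<in>UNIV. \<Sum>b\<in>UNIV. \<Sum>r\<in>UNIV. ?W a b r x * partial a (\<lambda>y. h y $ b $ r) x))
     = (LINT x:K|lborel. E x + (\<Sum>a\<in>UNIV. partial a (V a) x))" by simp
  also have "\<dots> = integral\<^sup>L lborel (\<lambda>x. E x + (\<Sum>a\<in>UNIV. partial a (V a) x))"
    unfolding set_lebesgue_integral_def
    by (intro Bochner_Integration.integral_cong refl) (use E0 pV0 in \<open>auto simp: indicator_def\<close>)
  also have "\<dots> = integral\<^sup>L lborel E + (\<Sum>a\<in>UNIV. integral\<^sup>L lborel (partial a (V a)))"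
    using compact_support_integrable[OF Ec K E0] compact_support_integrable[OF Vpc K pV0] by simp
  also have "\<dots> = integral\<^sup>L lborel E"
    by (simp add: integral_partial_compact_support[OF Vd Vpc K V0])
  finally show ?thesis by (simp add: E_def)
qed

section \<open>From stationarity to a pointwise condition\<close>

lemma sym_field_variation: "sym_field S \<Longrightarrow> sym_field h \<Longrightarrow> sym_field (\<lambda>y. S y + \<epsilon> *\<^sub>R h y)"
  by (simp add: sym_field_def)

lemma smooth_variation: "smooth S \<Longrightarrow> smooth h \<Longrightarrow> smooth (\<lambda>y. S y + \<epsilon> *\<^sub>R h y)"
  by (intro smooth_add smooth_bounded_linear[OF bounded_linear_scaleR_right])

text \<open>The derivative of the integral at \<epsilon> = 0 always exists and equals the weak
  expression, so by uniqueness of derivatives stationarity means that this expression is 0.\<close>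

lemma stationary_iff_weak:
  fixes S :: tensor_field
  assumes S: "smooth S" "sym_field S" and \<psi>: "smooth \<psi>"
  shows "stationary (total_L m \<tau> \<zeta> \<psi>) S \<longleftrightarrow>
    (\<forall>K h. compact K \<and> smooth h \<and> sym_field h \<and> contraction_free h \<and> (\<forall>x. x \<notin> K \<longrightarrow> h x = 0) \<longrightarrow>
       integral\<^sup>L lborel (\<lambda>x. \<Sum>a\<in>UNIV. \<Sum>b\<in>UNIV. h x $ a $ b * euler_lagrange \<tau> \<zeta> \<psi> S a b x) = 0)"
proof -
  have "((\<lambda>\<epsilon>::real. LINT x:K|lborel. total_L m \<tau> \<zeta> \<psi> (\<lambda>y. S y + \<epsilon> *\<^sub>R h y) x) has_vector_derivative 0) (at 0)
     \<longleftrightarrow> integral\<^sup>L lborel (\<lambda>x. \<Sum>a\<in>UNIV. \<Sum>b\<in>UNIV. h x $ a $ b * euler_lagrange \<tau> \<zeta> \<psi> S a b x) = 0"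
    if K: "compact K" and h: "smooth h" "sym_field h" and off: "\<forall>x. x \<notin> K \<longrightarrow> h x = 0" for K h
  proof -
    have "((\<lambda>\<epsilon>. LINT x:K|lborel. complex_of_real (real_lagrangian m \<tau> \<zeta> \<psi> (\<lambda>y. S y + \<epsilon> *\<^sub>R h y) x)) has_vector_derivative
       complex_of_real (integral\<^sup>L lborel (\<lambda>x. \<Sum>a\<in>UNIV. \<Sum>b\<in>UNIV. h x $ a $ b * euler_lagrange \<tau> \<zeta> \<psi> S a b x))) (at 0)"
      using polynomial_family_integral[OF real_lagrangian_polynomial_family[OF S(1) h(1) \<psi>] K first_variation[OF S(1) h(1) S(2)]]
        integral_first_variation[OF S(1) h(1) \<psi> K] off by simp
    then have D: "((\<lambda>\<epsilon>. LINT x:K|lborel. total_L m \<tau> \<zeta> \<psi> (\<lambda>y. S y + \<epsilon> *\<^sub>R h y) x) has_vector_derivative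
       complex_of_real (integral\<^sup>L lborel (\<lambda>x. \<Sum>a\<in>UNIV. \<Sum>b\<in>UNIV. h x $ a $ b * euler_lagrange \<tau> \<zeta> \<psi> S a b x))) (at 0)"
      by (simp only: total_L_eq[OF smooth_variation[OF S(1) h(1)] sym_field_variation[OF S(2) h(2)]] real_lagrangian_def)
    show ?thesis
    proof
      assume "((\<lambda>\<epsilon>::real. LINT x:K|lborel. total_L m \<tau> \<zeta> \<psi> (\<lambda>y. S y + \<epsilon> *\<^sub>R h y) x) has_vector_derivative 0) (at 0)"
      from vector_derivative_unique_at[OF D this]
      show "integral\<^sup>L lborel (\<lambda>x. \<Sum>a\<in>UNIV. \<Sum>b\<in>UNIV. h x $ a $ b * euler_lagrange \<tau> \<zeta> \<psi> S a b x) = 0"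
        by (simp only: of_real_eq_0_iff)
    next
      assume "integral\<^sup>L lborel (\<lambda>x. \<Sum>a\<in>UNIV. \<Sum>b\<in>UNIV. h x $ a $ b * euler_lagrange \<tau> \<zeta> \<psi> S a b x) = 0"
      then show "((\<lambda>\<epsilon>::real. LINT x:K|lborel. total_L m \<tau> \<zeta> \<psi> (\<lambda>y. S y + \<epsilon> *\<^sub>R h y) x) has_vector_derivative 0) (at 0)"
        using D by (simp only: of_real_0)
    qed
  qed
  then show ?thesis unfolding stationary_def by blast
qed

text \<open>Twice the symmetric traceless part.\<close>

definition traceless_part :: "(4 \<Rightarrow> 4 \<Rightarrow> real) \<Rightarrow> 4 \<Rightarrow> 4 \<Rightarrow> real" where
  "traceless_part F a b = F a b + F b a - 1 / 2 * eta a b * (\<Sum>c\<in>UNIV. eta c c * F c c)"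

text \<open>At a point this is linear algebra: the matrices whose contraction with every symmetric
  contraction-free matrix is 0 are the sums of an antisymmetric matrix and a multiple of
  \<open>eta\<close>, and these are the ones with vanishing \<open>traceless_part\<close>.\<close>

lemma weak_iff_pointwise:
  fixes F :: "4 \<Rightarrow> 4 \<Rightarrow> spacetime \<Rightarrow> real"
  assumes F: "\<And>a b. continuous_on UNIV (F a b)"
  shows "(\<forall>K h. compact K \<and> smooth h \<and> sym_field h \<and> contraction_free h \<and> (\<forall>x. x \<notin> K \<longrightarrow> h x = 0) \<longrightarrow>
       integral\<^sup>L lborel (\<lambda>x. \<Sum>a\<in>UNIV. \<Sum>b\<in>UNIV. h x $ a $ b * F a b x) = 0)
    \<longleftrightarrow> (\<forall>x a b. traceless_part (\<lambda>a b. F a b x) a b = 0)" (is "?L \<longleftrightarrow> ?R")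
proof
  assume R: ?R
  show ?L
  proof (intro allI impI)
    fix K :: "spacetime set" and h :: tensor_field
    assume "compact K \<and> smooth h \<and> sym_field h \<and> contraction_free h \<and> (\<forall>x. x \<notin> K \<longrightarrow> h x = 0)"
    then have sym: "h x $ a $ b = h x $ b $ a" and tr: "(\<Sum>a\<in>UNIV. \<Sum>b\<in>UNIV. eta a b * h x $ a $ b) = 0" for x a b
      by (auto simp: sym_field_def contraction_free_def)
    have "(\<Sum>a\<in>UNIV. \<Sum>b\<in>UNIV. h x $ a $ b * F a b x) = 0" for x
    proof -
      define t where "t = (\<Sum>c\<in>UNIV. eta c c * F c c x)"
      have e: "F a b x + F b a x = 1 / 2 * eta a b * t" for a b
        using R by (simp add: traceless_part_def t_def)
      have "(\<Sum>a\<in>UNIV. \<Sum>b\<in>UNIV. h x $ a $ b * F b a x) = (\<Sum>a\<in>UNIV. \<Sum>b\<in>UNIV. h x $ a $ b * F a b x)"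
        by (subst sum.swap) (simp add: sym[of x])
      then have "2 * (\<Sum>a\<in>UNIV. \<Sum>b\<in>UNIV. h x $ a $ b * F a b x)
        = (\<Sum>a\<in>UNIV. \<Sum>b\<in>UNIV. h x $ a $ b * (F a b x + F b a x))"
        by (simp add: distrib_left sum.distrib)
      also have "\<dots> = 1 / 2 * t * (\<Sum>a\<in>UNIV. \<Sum>b\<in>UNIV. eta a b * h x $ a $ b)"
        unfolding e by (simp add: sum_distrib_left mult_ac)
      finally show ?thesis by (simp add: tr)
    qed
    then show "integral\<^sup>L lborel (\<lambda>x. \<Sum>a\<in>UNIV. \<Sum>b\<in>UNIV. h x $ a $ b * F a b x) = 0" by simp
  qed
next
  assume L: ?L
  show ?R
  proof (intro allI)
    fix x a b
    \<comment> \<open>Contraction with \<open>M\<close> extracts the \<open>(a, b)\<close> entry of the symmetric traceless part.\<close>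
    define M :: "real ^ 4 ^ 4" where
      "M = (\<chi> c d. (if c = a \<and> d = b then 1 else 0) + (if c = b \<and> d = a then 1 else 0) - 1 / 2 * eta a b * eta c d)"
    have delta: "(\<Sum>c\<in>UNIV. \<Sum>d\<in>UNIV. (if c = i \<and> d = j then 1 else 0) * f c d) = f i j" for i j :: 4 and f :: "4 \<Rightarrow> 4 \<Rightarrow> real"
    proof -
      have "(\<Sum>d\<in>UNIV. (if c = i \<and> d = j then 1 else 0) * f c d) = (if c = i then f i j else 0)" for c
        by (cases "c = i") (simp_all add: if_distrib if_distribR cong: if_cong)
      then show ?thesis by simp
    qed
    have MF: "(\<Sum>c\<in>UNIV. \<Sum>d\<in>UNIV. M $ c $ d * f c d) = traceless_part f a b" for f
    proof -
      have "(\<Sum>c\<in>UNIV. \<Sum>d\<in>UNIV. M $ c $ d * f c d)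
        = (\<Sum>c\<in>UNIV. \<Sum>d\<in>UNIV. (if c = a \<and> d = b then 1 else 0) * f c d)
        + (\<Sum>c\<in>UNIV. \<Sum>d\<in>UNIV. (if c = b \<and> d = a then 1 else 0) * f c d)
        - 1 / 2 * eta a b * (\<Sum>c\<in>UNIV. \<Sum>d\<in>UNIV. eta c d * f c d)"
        by (simp add: M_def distrib_right left_diff_distrib sum.distrib sum_subtractf sum_distrib_left mult.assoc)
      then show ?thesis unfolding delta by (simp add: traceless_part_def sum_eta)
    qed
    \<comment> \<open>By \<open>MF\<close> this is the contraction of M with \<open>eta\<close>; it
      vanishes because 2 - 1/2 * 4 = 0, so M is an admissible direction.\<close>
    have tr: "traceless_part eta a b = 0"
      by (simp add: traceless_part_def eta_sq eta_sym[of b a])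
    have "(\<Sum>c\<in>UNIV. \<Sum>d\<in>UNIV. M $ c $ d * F c d x) = 0"
    proof (rule fundamental_lemma[of "\<lambda>x. \<Sum>c\<in>UNIV. \<Sum>d\<in>UNIV. M $ c $ d * F c d x"])
      show "continuous_on UNIV (\<lambda>x. \<Sum>c\<in>UNIV. \<Sum>d\<in>UNIV. M $ c $ d * F c d x)"
        by (intro continuous_on_mult continuous_on_sum continuous_on_const F)
      fix K and \<phi> :: "spacetime \<Rightarrow> real"
      assume K: "compact K" and \<phi>: "smooth \<phi>" "\<And>x. x \<notin> K \<Longrightarrow> \<phi> x = 0"
      have "smooth (\<lambda>x. \<phi> x *\<^sub>R M)"
        by (rule smooth_bounded_linear[OF bounded_linear_scaleR_left \<phi>(1)])
      moreover have "sym_field (\<lambda>x. \<phi> x *\<^sub>R M)"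
      proof -
        have "M $ c $ d = M $ d $ c" for c d
          unfolding M_def vec_lambda_beta eta_sym[of d c] conj_commute[of "d = a"] conj_commute[of "d = b"]
          by (simp only: add.commute)
        then show ?thesis by (simp add: sym_field_def)
      qed
      moreover have "contraction_free (\<lambda>x. \<phi> x *\<^sub>R M)"
      proof -
        have "(\<Sum>c\<in>UNIV. \<Sum>d\<in>UNIV. eta c d * (\<phi> y *\<^sub>R M) $ c $ d) = \<phi> y * (\<Sum>c\<in>UNIV. \<Sum>d\<in>UNIV. M $ c $ d * eta c d)" for y
          by (simp add: sum_distrib_left mult_ac)
        then show ?thesis unfolding contraction_free_def MF tr by simp
      qed
      ultimately have "integral\<^sup>L lborel (\<lambda>x. \<Sum>c\<in>UNIV. \<Sum>d\<in>UNIV. (\<phi> x *\<^sub>R M) $ c $ d * F c d x) = 0"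
        using L K \<phi>(2) by (auto dest!: spec[of _ K] spec[of _ "\<lambda>x. \<phi> x *\<^sub>R M"])
      then show "integral\<^sup>L lborel (\<lambda>x. \<phi> x * (\<Sum>c\<in>UNIV. \<Sum>d\<in>UNIV. M $ c $ d * F c d x)) = 0"
        by (simp add: sum_distrib_left mult_ac)
    qed
    then show "traceless_part (\<lambda>a b. F a b x) a b = 0" unfolding MF .
  qed
qed

lemma stationary_iff:
  fixes S :: tensor_field
  assumes "smooth S" "sym_field S" "smooth \<psi>"
  shows "stationary (total_L m \<tau> \<zeta> \<psi>) S \<longleftrightarrow>
    (\<forall>x a b. traceless_part (\<lambda>a b. euler_lagrange \<tau> \<zeta> \<psi> S a b x) a b = 0)"
  unfolding stationary_iff_weak[OF assms]
  by (rule weak_iff_pointwise[OF continuous_euler_lagrange[OF assms(1,3)]])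

section \<open>The field equation\<close>

lemma wave_term:
  assumes "smooth S"
  shows "(\<Sum>m\<in>UNIV. partial m (partial_up m (\<lambda>y. low S y $ a $ b)) x)
    = eta a a * eta b b * (\<Sum>m\<in>UNIV. eta m m * partial m (partial m (\<lambda>y. S y $ a $ b)) x)"
proof -
  have "partial m (partial_up m (\<lambda>y. low S y $ a $ b)) x
      = eta a a * eta b b * (eta m m * partial m (partial m (\<lambda>y. S y $ a $ b)) x)" for m
  proof -
    have "partial_up m (\<lambda>y. low S y $ a $ b)
        = (\<lambda>y. (eta a a * eta b b * eta m m) * partial m (\<lambda>y. S y $ a $ b) y)"
      by (simp add: fun_eq_iff partial_up_eq partial_low[OF assms])
    then show ?thesis
      using smooth_differentiable[OF smooth_partial[OF smooth_component[OF assms]]]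
      by (simp add: partial_cmult)
  qed
  then show ?thesis by (simp add: sum_distrib_left)
qed

text \<open>The statement takes the divergence first and then differentiates, whereas the divergence
  of the momentum has these operations in the opposite order; \<open>partial_commute\<close>
  reconciles them.\<close>

lemma divergence_term:
  assumes "smooth S"
  shows "partial a (\<lambda>y. \<Sum>m\<in>UNIV. partial_up m (\<lambda>z. low S z $ m $ b) y) x
    = eta b b * (\<Sum>m\<in>UNIV. partial m (partial a (\<lambda>y. S y $ m $ b)) x)"
proof -
  have d: "partial m (\<lambda>y. S y $ m $ b) differentiable (at x)" for m
    by (rule smooth_differentiable[OF smooth_partial[OF smooth_component[OF assms]]])
  have "(\<lambda>y. \<Sum>m\<in>UNIV. partial_up m (\<lambda>z. low S z $ m $ b) y)
      = (\<lambda>y. eta b b * (\<Sum>m\<in>UNIV. partial m (\<lambda>z. S z $ m $ b) y))"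
    by (simp add: fun_eq_iff partial_up_eq partial_low[OF assms] mult.assoc eta_sq_left sum_distrib_left)
  moreover have "partial a (\<lambda>y. eta b b * (\<Sum>m\<in>UNIV. partial m (\<lambda>z. S z $ m $ b) y)) x
      = eta b b * (\<Sum>m\<in>UNIV. partial a (partial m (\<lambda>z. S z $ m $ b)) x)"
    using d by (subst partial_cmult) (auto simp: partial_sum intro!: differentiable_sum)
  ultimately show ?thesis
    by (simp add: partial_commute[OF smooth_component[OF assms], of a])
qed

text \<open>The constraint is a linear identity in all x with constant coefficients, so it survives
  each of the two differentiations.\<close>

lemma wave_trace:
  assumes "smooth S" and "contraction_free S"
  shows "(\<Sum>c\<in>UNIV. eta c c * (\<Sum>m\<in>UNIV. eta m m * partial m (partial m (\<lambda>y. S y $ c $ c)) x)) = 0"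
proof -
  have tr: "(\<Sum>c\<in>UNIV. eta c c * S y $ c $ c) = 0" for y
    using assms(2) by (simp add: contraction_free_def sum_eta)
  note sm = smooth_component[OF assms(1)]
  have "(\<Sum>c\<in>UNIV. eta c c * partial m (\<lambda>y. S y $ c $ c) y) = 0" for m y
  proof -
    have "partial m (\<lambda>y. \<Sum>c\<in>UNIV. eta c c * S y $ c $ c) y = (\<Sum>c\<in>UNIV. partial m (\<lambda>y. eta c c * S y $ c $ c) y)"
      by (rule partial_sum) (rule smooth_differentiable[OF smooth_cmult[OF sm]])
    then show ?thesis
      by (simp add: tr partial_const partial_cmult smooth_differentiable[OF sm])
  qed
  note tr1 = this
  have "(\<Sum>c\<in>UNIV. eta c c * partial m (partial m (\<lambda>y. S y $ c $ c)) y) = 0" for m y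
  proof -
    have "partial m (\<lambda>y. \<Sum>c\<in>UNIV. eta c c * partial m (\<lambda>y. S y $ c $ c) y) y
        = (\<Sum>c\<in>UNIV. partial m (\<lambda>y. eta c c * partial m (\<lambda>y. S y $ c $ c) y) y)"
      by (rule partial_sum) (rule smooth_differentiable[OF smooth_cmult[OF smooth_partial[OF sm]]])
    then show ?thesis
      by (simp add: tr1 partial_const partial_cmult smooth_differentiable[OF smooth_partial[OF sm]])
  qed
  then have "(\<Sum>m\<in>UNIV. eta m m * (\<Sum>c\<in>UNIV. eta c c * partial m (partial m (\<lambda>y. S y $ c $ c)) x)) = 0"
    by simp
  then show ?thesis
    unfolding sum_distrib_left by (subst sum.swap) (simp add: mult_ac)
qed

lemma partial_kinetic_momentum:
  assumes "smooth S"
  shows "(\<Sum>m\<in>UNIV. partial m (kinetic_momentum \<tau> \<zeta> S m a b) x) = 64 * \<tau> * cos (2 * \<zeta>) *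
    (eta a a * eta b b * (\<Sum>m\<in>UNIV. eta m m * partial m (partial m (\<lambda>y. S y $ a $ b)) x)
     - eta b b * (\<Sum>m\<in>UNIV. partial m (partial a (\<lambda>y. S y $ m $ b)) x))"
proof -
  have "partial m (kinetic_momentum \<tau> \<zeta> S m a b) x = 64 * \<tau> * cos (2 * \<zeta>) *
    (eta a a * eta b b * (eta m m * partial m (partial m (\<lambda>y. S y $ a $ b)) x)
     - eta b b * partial m (partial a (\<lambda>y. S y $ m $ b)) x)" for m
    unfolding kinetic_momentum_expand
      partial_add[OF smooth_differentiable[OF smooth_cmult[OF smooth_partial[OF smooth_component[OF assms]]]]
        smooth_differentiable[OF smooth_cmult[OF smooth_partial[OF smooth_component[OF assms]]]]]
      partial_cmult[OF smooth_differentiable[OF smooth_partial[OF smooth_component[OF assms]]]]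
    by (simp add: algebra_simps)
  then show ?thesis by (simp add: sum_distrib_left sum_subtractf right_diff_distrib)
qed

lemma potential_force_sym:
  assumes "sym_field S"
  shows "potential_force S a b x = potential_force S b a x"
proof -
  have sym: "S x $ a $ b = S x $ b $ a" for a b using assms by (simp add: sym_field_def)
  have "(\<Sum>c\<in>UNIV. \<Sum>d\<in>UNIV. eta a a * eta b b * eta c c * eta d d * (S x $ a $ c * S x $ c $ d * S x $ d $ b))
      = (\<Sum>c\<in>UNIV. \<Sum>d\<in>UNIV. eta b b * eta a a * eta c c * eta d d * (S x $ b $ c * S x $ c $ d * S x $ d $ a))"
  proof (subst sum.swap, intro sum.cong refl)
    fix c d
    have "S x $ a $ d * S x $ d $ c * S x $ c $ b = S x $ b $ c * S x $ c $ d * S x $ d $ a"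
      using sym[of a d] sym[of d c] sym[of c b] by simp
    then show "eta a a * eta b b * eta d d * eta c c * (S x $ a $ d * S x $ d $ c * S x $ c $ b)
        = eta b b * eta a a * eta c c * eta d d * (S x $ b $ c * S x $ c $ d * S x $ d $ a)"
      by (simp only: mult_ac)
  qed
  then show ?thesis by (simp add: potential_force_def sym[of a b] mult_ac)
qed

text \<open>In the cubic part each of the three summed indices keeps one sign, which makes it the
  trace of the cube of the mixed tensor. The other part is proportional to the contraction of S and
  drops out.\<close>

lemma potential_force_trace:
  assumes "contraction_free S"
  shows "(\<Sum>c\<in>UNIV. eta c c * potential_force S c c x)
    = (\<Sum>\<mu>\<in>UNIV. \<Sum>\<nu>\<in>UNIV. \<Sum>\<sigma>\<in>UNIV. mixed S x $ \<mu> $ \<nu> * mixed S x $ \<nu> $ \<sigma> * mixed S x $ \<sigma> $ \<mu>)"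
proof -
  have tr: "(\<Sum>c\<in>UNIV. eta c c * S x $ c $ c) = 0"
    using assms by (simp add: contraction_free_def sum_eta)
  let ?q = "\<Sum>c\<in>UNIV. \<Sum>d\<in>UNIV. eta c c * eta d d * (S x $ c $ d)\<^sup>2"
  have "eta c c * potential_force S c c x
      = (\<Sum>d\<in>UNIV. \<Sum>e\<in>UNIV. mixed S x $ c $ d * mixed S x $ d $ e * mixed S x $ e $ c) - ?q * (eta c c * S x $ c $ c)" for c
  proof -
    have "eta c c * (eta c c * eta c c * eta d d * eta e e * (S x $ c $ d * S x $ d $ e * S x $ e $ c))
        = mixed S x $ c $ d * mixed S x $ d $ e * mixed S x $ e $ c" for d e
      unfolding mixed_component by (simp add: eta_sq)
    then have "eta c c * (\<Sum>d\<in>UNIV. \<Sum>e\<in>UNIV. eta c c * eta c c * eta d d * eta e e * (S x $ c $ d * S x $ d $ e * S x $ e $ c))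
        = (\<Sum>d\<in>UNIV. \<Sum>e\<in>UNIV. mixed S x $ c $ d * mixed S x $ d $ e * mixed S x $ e $ c)"
      by (simp only: sum_distrib_left)
    moreover have "eta c c * (?q * (eta c c * eta c c * S x $ c $ c)) = ?q * (eta c c * S x $ c $ c)"
      by (simp only: eta_sq mult.left_commute mult_1)
    ultimately show ?thesis
      unfolding potential_force_def right_diff_distrib by (simp only:)
  qed
  then show ?thesis by (simp only: sum_subtractf sum_distrib_left[symmetric] tr mult_zero_right diff_zero)
qed

lemma potential_force_low:
  "(\<Sum>\<mu>\<in>UNIV. \<Sum>\<nu>\<in>UNIV. low S x $ a $ \<mu> * S x $ \<mu> $ \<nu> * low S x $ \<nu> $ b)
    - (\<Sum>\<mu>\<in>UNIV. \<Sum>\<nu>\<in>UNIV. S x $ \<mu> $ \<nu> * low S x $ \<mu> $ \<nu>) * low S x $ a $ b = potential_force S a b x"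
proof -
  have "low S x $ a $ \<mu> * S x $ \<mu> $ \<nu> * low S x $ \<nu> $ b
      = eta a a * eta b b * eta \<mu> \<mu> * eta \<nu> \<nu> * (S x $ a $ \<mu> * S x $ \<mu> $ \<nu> * S x $ \<nu> $ b)" for \<mu> \<nu>
    unfolding low_component by (simp only: mult_ac)
  moreover have "S x $ \<mu> $ \<nu> * low S x $ \<mu> $ \<nu> = eta \<mu> \<mu> * eta \<nu> \<nu> * (S x $ \<mu> $ \<nu>)\<^sup>2" for \<mu> \<nu>
    unfolding low_component power2_eq_square by (simp only: mult_ac)
  ultimately show ?thesis
    unfolding potential_force_def low_component[of S x a b] by (simp only:)
qed

text \<open>Symmetrising doubles the 64 of the momentum to 128, so each divergence term appears with
  1/2, and the doubled potential coefficient 512 cos^2 splits as 128 cos times 4 cos. The subtracted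
  trace supplies the two terms with 1/4 \<open>eta\<close>, its wave part being 0.\<close>

lemma traceless_part_euler_lagrange:
  assumes "smooth S" and "sym_field S" and "contraction_free S"
  shows "traceless_part (\<lambda>a b. euler_lagrange \<tau> \<zeta> \<psi> S a b x) \<alpha> \<beta>
    = traceless_part (\<lambda>a b. source \<zeta> \<psi> a b x) \<alpha> \<beta> - 128 * \<tau> * cos (2 * \<zeta>) *
       ((\<Sum>\<mu>\<in>UNIV. partial \<mu> (partial_up \<mu> (\<lambda>y. low S y $ \<alpha> $ \<beta>)) x)
        - 1 / 2 * partial \<alpha> (\<lambda>y. \<Sum>\<mu>\<in>UNIV. partial_up \<mu> (\<lambda>z. low S z $ \<mu> $ \<beta>) y) x
        - 1 / 2 * partial \<beta> (\<lambda>y. \<Sum>\<mu>\<in>UNIV. partial_up \<mu> (\<lambda>z. low S z $ \<mu> $ \<alpha>) y) x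
        + 1 / 4 * eta \<alpha> \<beta> *
            (\<Sum>\<mu>\<in>UNIV. \<Sum>\<nu>\<in>UNIV. partial \<mu> (partial \<nu> (\<lambda>y. S y $ \<mu> $ \<nu>)) x)
        + 4 * cos (2 * \<zeta>) *
            ((\<Sum>\<mu>\<in>UNIV. \<Sum>\<nu>\<in>UNIV.
                low S x $ \<alpha> $ \<mu> * S x $ \<mu> $ \<nu> * low S x $ \<nu> $ \<beta>)
             - (\<Sum>\<mu>\<in>UNIV. \<Sum>\<nu>\<in>UNIV. S x $ \<mu> $ \<nu> * low S x $ \<mu> $ \<nu>) * low S x $ \<alpha> $ \<beta>
             - 1 / 4 * eta \<alpha> \<beta> *
                 (\<Sum>\<mu>\<in>UNIV. \<Sum>\<nu>\<in>UNIV. \<Sum>\<sigma>\<in>UNIV.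
                    mixed S x $ \<mu> $ \<nu> * mixed S x $ \<nu> $ \<sigma> * mixed S x $ \<sigma> $ \<mu>)))"
proof -
  define box where "box = (\<lambda>a b. \<Sum>m\<in>UNIV. eta m m * partial m (partial m (\<lambda>y. S y $ a $ b)) x)"
  define dv where "dv = (\<lambda>a b. \<Sum>m\<in>UNIV. partial m (partial a (\<lambda>y. S y $ m $ b)) x)"
  define pf where "pf = (\<lambda>a b. potential_force S a b x)"
  define src where "src = (\<lambda>a b. source \<zeta> \<psi> a b x)"
  define C where "C = cos (2 * \<zeta>)"
  have box_sym: "box b a = box a b" for a b
    using assms(2) by (simp add: box_def sym_field_def)
  have pf_sym: "pf b a = pf a b" for a b
    unfolding pf_def by (rule potential_force_sym[OF assms(2)])
  have E: "euler_lagrange \<tau> \<zeta> \<psi> S a b x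
      = src a b - 256 * \<tau> * C\<^sup>2 * pf a b - 64 * \<tau> * C * (eta a a * eta b b * box a b - eta b b * dv a b)" for a b
    unfolding euler_lagrange_def algebraic_force_def partial_kinetic_momentum[OF assms(1)]
      box_def dv_def pf_def src_def C_def ..
  have box_tr: "(\<Sum>c\<in>UNIV. eta c c * box c c) = 0"
    unfolding box_def by (rule wave_trace[OF assms(1,3)])
  have dv_tr: "(\<Sum>c\<in>UNIV. dv c c) = (\<Sum>\<mu>\<in>UNIV. \<Sum>\<nu>\<in>UNIV. partial \<mu> (partial \<nu> (\<lambda>y. S y $ \<mu> $ \<nu>)) x)"
    unfolding dv_def by (rule sum.swap)
  have tr: "(\<Sum>c\<in>UNIV. eta c c * euler_lagrange \<tau> \<zeta> \<psi> S c c x)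
      = (\<Sum>c\<in>UNIV. eta c c * src c c) - 256 * \<tau> * C\<^sup>2 * (\<Sum>c\<in>UNIV. eta c c * pf c c) + 64 * \<tau> * C * (\<Sum>c\<in>UNIV. dv c c)"
  proof -
    have "eta c c * euler_lagrange \<tau> \<zeta> \<psi> S c c x
      = eta c c * src c c - 256 * \<tau> * C\<^sup>2 * (eta c c * pf c c) - 64 * \<tau> * C * (eta c c * box c c) + 64 * \<tau> * C * dv c c" for c
      unfolding E by (simp add: algebra_simps eta_sq_left)
    then show ?thesis
      by (simp only: sum.distrib sum_subtractf sum_distrib_left[symmetric] box_tr mult_zero_right diff_zero)
  qed
  have fold: "(\<Sum>m\<in>UNIV. eta m m * partial m (partial m (\<lambda>y. S y $ a $ b)) x) = box a b"
    "(\<Sum>m\<in>UNIV. partial m (partial a (\<lambda>y. S y $ m $ b)) x) = dv a b"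
    "potential_force S a b x = pf a b" "source \<zeta> \<psi> a b x = src a b" for a b
    by (simp_all only: box_def dv_def pf_def src_def)
  show ?thesis
    unfolding traceless_part_def tr wave_term[OF assms(1)] divergence_term[OF assms(1)]
      potential_force_low potential_force_trace[OF assms(3), symmetric] dv_tr[symmetric]
    unfolding E fold C_def[symmetric] box_sym[of \<beta> \<alpha>] pf_sym[of \<beta> \<alpha>]
    by (simp add: algebra_simps power2_eq_square)
qed

text \<open>The bracket of gamma and Theta products is \<open>traceless_part\<close> formed at the
  level of operators. Pairing with \<psi> is linear in the operator, and the entries are real by
  \<open>source_eq\<close>.\<close>

lemma source_tensor:
  "dagger_dot (\<psi> x)
     ((hat_eta ** chiral \<zeta> **
       (gamma \<alpha> ** Theta {\<beta>} + gamma \<beta> ** Theta {\<alpha>}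
        - (1 / 2 * eta \<alpha> \<beta>) *\<^sub>R (\<Sum>\<mu>\<in>UNIV. gamma_up \<mu> ** Theta {\<mu>}))) *v \<psi> x)
   = complex_of_real (traceless_part (\<lambda>a b. source \<zeta> \<psi> a b x) \<alpha> \<beta>)"
proof -
  note lin = bounded_linear.linear[OF bounded_linear_op]
  have "dagger_dot (\<psi> x)
     ((hat_eta ** chiral \<zeta> **
       (gamma \<alpha> ** Theta {\<beta>} + gamma \<beta> ** Theta {\<alpha>}
        - (1 / 2 * eta \<alpha> \<beta>) *\<^sub>R (\<Sum>\<mu>\<in>UNIV. gamma_up \<mu> ** Theta {\<mu>}))) *v \<psi> x)
   = hat_form (\<psi> x) (chiral \<zeta> *v (gamma \<alpha> *v (Theta {\<beta>} *v \<psi> x)) + chiral \<zeta> *v (gamma \<beta> *v (Theta {\<alpha>} *v \<psi> x))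
       - (1 / 2 * eta \<alpha> \<beta>) *\<^sub>R (\<Sum>\<mu>\<in>UNIV. eta \<mu> \<mu> *\<^sub>R (chiral \<zeta> *v (gamma \<mu> *v (Theta {\<mu>} *v \<psi> x)))))"
    unfolding hat_form_def op_mult_simps(1-3) op_vec_scaleR_left op_vec_sum_left gamma_up_vec
      linear_add[OF lin] linear_diff[OF lin] linear_scale[OF lin] linear_sum[OF lin] ..
  also have "\<dots> = complex_of_real (traceless_part (\<lambda>a b. source \<zeta> \<psi> a b x) \<alpha> \<beta>)"
    unfolding hat_form_right hat_form_sum source_eq[symmetric] traceless_part_def by simp
  finally show ?thesis .
qed

theorem mainTheorem9:
  fixes S :: tensor_field and \<zeta> :: real
  assumes "smooth S" and "sym_field S" and "contraction_free S"
  shows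
    "(\<forall>x. L_V (NN \<zeta> S) x = complex_of_real (
        64 * (cos (2 * \<zeta>))\<^sup>2 *
          ((\<Sum>\<alpha>\<in>UNIV. \<Sum>\<beta>\<in>UNIV. \<Sum>\<rho>\<in>UNIV. \<Sum>\<sigma>\<in>UNIV.
              S x $ \<alpha> $ \<beta> * low S x $ \<beta> $ \<rho> * S x $ \<rho> $ \<sigma> * low S x $ \<sigma> $ \<alpha>)
           - (\<Sum>\<alpha>\<in>UNIV. \<Sum>\<beta>\<in>UNIV. S x $ \<alpha> $ \<beta> * low S x $ \<alpha> $ \<beta>)\<^sup>2)
        - 32 * cos (2 * \<zeta>) *
          ((\<Sum>\<alpha>\<in>UNIV. \<Sum>\<beta>\<in>UNIV. \<Sum>\<rho>\<in>UNIV.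
              partial \<alpha> (\<lambda>y. S y $ \<beta> $ \<rho>) x * partial_up \<alpha> (\<lambda>y. low S y $ \<beta> $ \<rho>) x)
           - (\<Sum>\<alpha>\<in>UNIV. \<Sum>\<beta>\<in>UNIV. \<Sum>\<rho>\<in>UNIV.
              partial_up \<alpha> (\<lambda>y. S y $ \<beta> $ \<rho>) x * partial \<beta> (\<lambda>y. low S y $ \<alpha> $ \<rho>) x))))
     \<and>
     (\<forall>(\<psi> :: spacetime \<Rightarrow> ext) (m :: real) (\<tau> :: real).
        smooth \<psi> \<longrightarrow> \<tau> \<noteq> 0 \<longrightarrow> cos (2 * \<zeta>) \<noteq> 0 \<longrightarrow>
        (stationary (total_L m \<tau> \<zeta> \<psi>) S \<longleftrightarrow>
          (\<forall>x \<alpha> \<beta>.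
            complex_of_real (
              (\<Sum>\<mu>\<in>UNIV. partial \<mu> (partial_up \<mu> (\<lambda>y. low S y $ \<alpha> $ \<beta>)) x)
              - 1 / 2 * partial \<alpha> (\<lambda>y. \<Sum>\<mu>\<in>UNIV. partial_up \<mu> (\<lambda>z. low S z $ \<mu> $ \<beta>) y) x
              - 1 / 2 * partial \<beta> (\<lambda>y. \<Sum>\<mu>\<in>UNIV. partial_up \<mu> (\<lambda>z. low S z $ \<mu> $ \<alpha>) y) x
              + 1 / 4 * eta \<alpha> \<beta> *
                  (\<Sum>\<mu>\<in>UNIV. \<Sum>\<nu>\<in>UNIV. partial \<mu> (partial \<nu> (\<lambda>y. S y $ \<mu> $ \<nu>)) x)
              + 4 * cos (2 * \<zeta>) *
                  ((\<Sum>\<mu>\<in>UNIV. \<Sum>\<nu>\<in>UNIV.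
                      low S x $ \<alpha> $ \<mu> * S x $ \<mu> $ \<nu> * low S x $ \<nu> $ \<beta>)
                   - (\<Sum>\<mu>\<in>UNIV. \<Sum>\<nu>\<in>UNIV. S x $ \<mu> $ \<nu> * low S x $ \<mu> $ \<nu>) * low S x $ \<alpha> $ \<beta>
                   - 1 / 4 * eta \<alpha> \<beta> *
                       (\<Sum>\<mu>\<in>UNIV. \<Sum>\<nu>\<in>UNIV. \<Sum>\<sigma>\<in>UNIV.
                          mixed S x $ \<mu> $ \<nu> * mixed S x $ \<nu> $ \<sigma> * mixed S x $ \<sigma> $ \<mu>)))
            = complex_of_real (1 / (128 * \<tau> * cos (2 * \<zeta>))) *
              dagger_dot (\<psi> x)
                ((hat_eta ** chiral \<zeta> **
                  (gamma \<alpha> ** Theta {\<beta>} + gamma \<beta> ** Theta {\<alpha>}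
                   - (1 / 2 * eta \<alpha> \<beta>) *\<^sub>R (\<Sum>\<mu>\<in>UNIV. gamma_up \<mu> ** Theta {\<mu>}))) *v \<psi> x))))"
proof (intro conjI allI impI, goal_cases)
  case (1 x)
  show ?case
    using L_V_NN[OF assms(1,2), of \<zeta> x] unfolding vector_lagrangian_eq[OF assms(1)] .
next
  case (2 \<psi> m \<tau>)
  then have nz: "128 * \<tau> * cos (2 * \<zeta>) \<noteq> 0" by simp
  \<comment> \<open>Both sides of the field equation are embedded real numbers, so clearing the
    nonzero denominator turns it into the vanishing of the expression in
    \<open>traceless_part_euler_lagrange\<close>.\<close>
  have eq: "complex_of_real l = complex_of_real (1 / (128 * \<tau> * cos (2 * \<zeta>))) * complex_of_real r
      \<longleftrightarrow> r - 128 * \<tau> * cos (2 * \<zeta>) * l = 0" for l r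
    unfolding of_real_mult[symmetric] of_real_eq_iff using nz by (auto simp: field_simps)
  show ?case
    unfolding stationary_iff[OF assms(1,2) 2(1)] traceless_part_euler_lagrange[OF assms] source_tensor eq ..
qed

end
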